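(* Let $(H,A,C)$ and $(H,A',C)$ be monoidal Doi Hom-Hopf data (with the same $(H,\alpha)$ and $(C,\gamma)$, and with $(A,\beta)$, $(A',\beta')$), and let $\chi=(\mathrm{id}_H,\psi,\mathrm{id}_C):(H,A,C)\to(H,A',C)$ be a monoidal morphism, i.e. $\psi:A\to A'$ is a monoidal Hom-bialgebra map with $\rho_{A'}(\psi(a))=\psi(a_{[0]})\otimes a_{[1]}$. Let $F:{}_A\widetilde{\mathscr H}(\mathscr M_k)(H)^C\to{}_{A'}\widetilde{\mathscr H}(\mathscr M_k)(H)^{C}$ and $G:{}_{A'}\widetilde{\mathscr H}(\mathscr M_k)(H)^{C}\to{}_A\widetilde{\mathscr H}(\mathscr M_k)(H)^{C}$ be the induced functors. Then $$F(A)=A'$$ (canonical isomorphism in ${}_{A'}\widetilde{\mathscr H}(\mathscr M_k)(H)^{C}$). Let $(M,\mu)\in{}_A\widetilde{\mathscr H}(\mathscr M_k)(H)^C$ be flat as a $k$-module and let $(N,\nu)\in{}_{A'}\widetilde{\mathscr H}(\mathscr M_k)(H)^{C}$. If $(A',\beta')$ is a monoidal Hom-Hopf algebra, then $$F(M)\otimes N\cong F(M\otimes G(N))\quad\text{in }{}_{A'}\widetilde{\mathscr H}(\mathscr M_k)(H)^C.$$ If $(A',\beta')$ has a twisted antipode $\overline S$, then $$N\otimes F(M)\cong F(G(N)\otimes M)\quad\text{in }{}_{A'}\widetilde{\mathscr H}(\mathscr M_k)(H)^C.$$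
   Context: $k$ is a commutative ring and $\otimes=\otimes_k$. $\widetilde{\mathscr H}(\mathscr M_k)$ has objects pairs $(M,\mu)$, $M$ a $k$-module and $\mu$ a $k$-linear automorphism; morphisms are $k$-linear maps commuting with the automorphisms. It is symmetric monoidal (with the flip) via $(M,\mu)\otimes(N,\nu)=(M\otimes N,\mu\otimes\nu)$, with associator $(m\otimes n)\otimes p\mapsto\mu(m)\otimes(n\otimes\pi^{-1}(p))$. All structure maps below, and all maps of Hom-structures, are morphisms in this category. Monoidal Hom-algebra $(A,\beta)$: multiplication and $1_A$ with $\beta(ab)=\beta(a)\beta(b)$, $\beta(1_A)=1_A$, $\beta(a)(bc)=(ab)\beta(c)$, $a1_A=1_Aa=\beta(a)$. Monoidal Hom-coalgebra $(C,\gamma)$: $\Delta(c)=c_{(1)}\otimes c_{(2)}$ and $\varepsilon$, commuting with $\gamma$ ($\varepsilon\gamma=\varepsilon$), with $\gamma^{-1}(c_{(1)})\otimes c_{(2)(1)}\otimes c_{(2)(2)}=c_{(1)(1)}\otimes c_{(1)(2)}\otimes\gamma^{-1}(c_{(2)})$ and $\varepsilon(c_{(1)})c_{(2)}=\varepsilon(c_{(2)})c_{(1)}=\gamma^{-1}(c)$. Monoidal Hom-bialgebra: both structures with the same automorphism, $\Delta,\varepsilon$ multiplicative and unital. Monoidal Hom-Hopf algebra: a monoidal Hom-bialgebra with $k$-linear antipode $S$ commuting with the automorphism and $S(a_{(1)})a_{(2)}=a_{(1)}S(a_{(2)})=\varepsilon(a)1$. A twisted antipode $\overline S$ is a $k$-linear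 map commuting with the automorphism with $\overline S(a_{(2)})a_{(1)}=a_{(2)}\overline S(a_{(1)})=\varepsilon(a)1$. Left $(A,\beta)$-Hom-module $(M,\mu)$: $\beta(a)\cdot(b\cdot m)=(ab)\cdot\mu(m)$, $1_A\cdot m=\mu(m)$, $\mu(a\cdot m)=\beta(a)\cdot\mu(m)$. Right $(C,\gamma)$-Hom-comodule $(M,\mu)$: $\rho_M(m)=m_{[0]}\otimes m_{[1]}\in M\otimes C$ with $m_{[0][0]}\otimes m_{[0][1]}\otimes\gamma^{-1}(m_{[1]})=\mu^{-1}(m_{[0]})\otimes\Delta(m_{[1]})$, $m_{[0]}\varepsilon(m_{[1]})=\mu^{-1}(m)$, $\rho_M(\mu(m))=\mu(m_{[0]})\otimes\gamma(m_{[1]})$. A Doi Hom-Hopf datum $(H,A,C)$: a monoidal Hom-Hopf algebra $(H,\alpha)$; a right $(H,\alpha)$-Hom-comodule algebra $(A,\beta)$ (monoidal Hom-algebra and right $(H,\alpha)$-Hom-comodule with $\rho_A(ab)=a_{[0]}b_{[0]}\otimes a_{[1]}b_{[1]}$, $\rho_A(1_A)=1_A\otimes1_H$); a left $(H,\alpha)$-Hom-module coalgebra $(C,\gamma)$ (monoidal Hom-coalgebra and left $(H,\alpha)$-Hom-module with $\Delta_C(h\cdot c)=h_{(1)}\cdot c_{(1)}\otimes h_{(2)}\cdot c_{(2)}$, $\varepsilon_C(h\cdot c)=\varepsilon_H(h)\varepsilon_C(c)$). ${}_A\widetilde{\mathscr H}(\mathscr M_k)(H)^C$ is the category of Doi Hom-Hopf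 modules: $(M,\mu)$ a left $(A,\beta)$-Hom-module and right $(C,\gamma)$-Hom-comodule with $\rho_M(a\cdot m)=a_{[0]}\cdot m_{[0]}\otimes a_{[1]}\cdot m_{[1]}$; morphisms are $A$-linear $C$-colinear morphisms of $\widetilde{\mathscr H}(\mathscr M_k)$. The datum is monoidal if $A$ and $C$ are monoidal Hom-bialgebras such that for all $a\in A$, $c,d\in C$: $a_{(1)[0]}\otimes a_{(2)[0]}\otimes(a_{(1)[1]}\cdot c)(a_{(2)[1]}\cdot d)=a_{[0](1)}\otimes a_{[0](2)}\otimes a_{[1]}\cdot(cd)$ and $\varepsilon_A(a)1_C=\varepsilon_A(a_{[0]})(a_{[1]}\cdot1_C)$. Then the category is monoidal with $a\cdot(m\otimes n)=a_{(1)}\cdot m\otimes a_{(2)}\cdot n$, $\rho(m\otimes n)=m_{[0]}\otimes n_{[0]}\otimes m_{[1]}n_{[1]}$. $F(M)=A'\otimes_AM$, the quotient of $A'\otimes M$ by the submodule generated by all $a'\psi(a)\otimes m-\beta'(a')\otimes a\cdot\mu^{-1}(m)$, with automorphism induced by $\beta'\otimes\mu$, action $b'\cdot(a'\otimes_Am)=\beta'^{-1}(b')a'\otimes_A\mu(m)$ and coaction $a'\otimes_Am\mapsto a'_{[0]}\otimes_Am_{[0]}\otimes a'_{[1]}\cdot m_{[1]}$. $G(N)=N\Box_CC\cong N$ is $N$ with the same $C$-coaction and $A$-action $a\cdot n=\psi(a)\cdot n$. $A$ (and likewise $A'$) is regarded as a Doi Hom-Hopf module with action by left multiplication and coaction $a\mapsto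 a_{[0]}\otimes\alpha^{-1}(a_{[1]})\cdot1_C$. *)

theory Defs
  imports "HOL-Algebra.AbelCoset" "HOL-Algebra.Module"
begin

section \<open>Linear algebra over a commutative ring\<close>

text \<open>Modules over the commutative ring \<open>R\<close> (the ring \<open>k\<close>) are those of \<^theory>\<open>HOL-Algebra.Module\<close>.
  A module record also has the fields \<^const>\<open>mult\<close> and \<^const>\<open>one\<close>, on which the
  \<^locale>\<open>module\<close> axioms say nothing: they hold the product and the unit when the module is a
  Hom-algebra, and are \<^const>\<open>undefined\<close> in the plain modules constructed below.\<close>

definition lin_maps ::
  "('k,'r) ring_scheme \<Rightarrow> ('k,'m,'x) module_scheme \<Rightarrow> ('k,'n,'y) module_scheme \<Rightarrow> ('m \<Rightarrow> 'n) set"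
  where "lin_maps R M N = {f. f \<in> carrier M \<rightarrow> carrier N \<and>
    (\<forall>x\<in>carrier M. \<forall>y\<in>carrier M. f (x \<oplus>\<^bsub>M\<^esub> y) = f x \<oplus>\<^bsub>N\<^esub> f y) \<and>
    (\<forall>r\<in>carrier R. \<forall>x\<in>carrier M. f (r \<odot>\<^bsub>M\<^esub> x) = r \<odot>\<^bsub>N\<^esub> f x)}"

definition bilin_maps ::
  "('k,'r) ring_scheme \<Rightarrow> ('k,'m,'x) module_scheme \<Rightarrow> ('k,'n,'y) module_scheme \<Rightarrow>
   ('k,'p,'z) module_scheme \<Rightarrow> ('m \<Rightarrow> 'n \<Rightarrow> 'p) set"
  where "bilin_maps R M N P = {f. (\<forall>x\<in>carrier M. f x \<in> lin_maps R N P) \<and>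
    (\<forall>y\<in>carrier N. (\<lambda>x. f x y) \<in> lin_maps R M P)}"

definition self_module :: "('k,'r) ring_scheme \<Rightarrow> ('k,'k) module"
  where "self_module R = \<lparr>carrier = carrier R, mult = mult R, one = one R, zero = zero R,
    add = add R, smult = mult R\<rparr>"

definition free_module :: "('k,'r) ring_scheme \<Rightarrow> 'x set \<Rightarrow> ('k, 'x \<Rightarrow> 'k) module"
  where "free_module R X = \<lparr>
    carrier = {f. (\<forall>x. f x \<in> carrier R) \<and> (\<forall>x. x \<notin> X \<longrightarrow> f x = \<zero>\<^bsub>R\<^esub>) \<and> finite {x. f x \<noteq> \<zero>\<^bsub>R\<^esub>}},
    mult = undefined, one = undefined,
    zero = (\<lambda>x. \<zero>\<^bsub>R\<^esub>),
    add = (\<lambda>f g x. f x \<oplus>\<^bsub>R\<^esub> g x),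
    smult = (\<lambda>r f x. r \<otimes>\<^bsub>R\<^esub> f x)\<rparr>"

definition free_gen :: "('k,'r) ring_scheme \<Rightarrow> 'x \<Rightarrow> 'x \<Rightarrow> 'k"
  where "free_gen R x = (\<lambda>y. if y = x then \<one>\<^bsub>R\<^esub> else \<zero>\<^bsub>R\<^esub>)"

definition gen_submodule ::
  "('k,'r) ring_scheme \<Rightarrow> ('k,'m,'x) module_scheme \<Rightarrow> 'm set \<Rightarrow> 'm set"
  where "gen_submodule R M X = \<Inter>{S. submodule S R M \<and> X \<subseteq> S}"

definition quot_module :: "('k,'m,'x) module_scheme \<Rightarrow> 'm set \<Rightarrow> ('k, 'm set) module"
  where "quot_module M S = \<lparr>
    carrier = a_rcosets\<^bsub>M\<^esub> S,
    mult = undefined, one = undefined,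
    zero = S,
    add = set_add M,
    smult = (\<lambda>r X. \<Union>x\<in>X. S +>\<^bsub>M\<^esub> (r \<odot>\<^bsub>M\<^esub> x))\<rparr>"


subsection \<open>Tensor products\<close>

text \<open>The tensor product is the free module on \<open>carrier M \<times> carrier N\<close> modulo the bilinearity
  relations.\<close>

type_synonym ('k,'m,'n) tens = "('m \<times> 'n \<Rightarrow> 'k) set"

definition tensor_rels ::
  "('k,'r) ring_scheme \<Rightarrow> ('k,'m,'x) module_scheme \<Rightarrow> ('k,'n,'y) module_scheme \<Rightarrow> ('m \<times> 'n \<Rightarrow> 'k) set"
  where "tensor_rels R M N =
   (let F = free_module R (carrier M \<times> carrier N); e = (\<lambda>x y. free_gen R (x, y)) in
      {e (x \<oplus>\<^bsub>M\<^esub> x') y \<ominus>\<^bsub>F\<^esub> (e x y \<oplus>\<^bsub>F\<^esub> e x' y) | x x' y.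
         x \<in> carrier M \<and> x' \<in> carrier M \<and> y \<in> carrier N}
    \<union> {e x (y \<oplus>\<^bsub>N\<^esub> y') \<ominus>\<^bsub>F\<^esub> (e x y \<oplus>\<^bsub>F\<^esub> e x y') | x y y'.
         x \<in> carrier M \<and> y \<in> carrier N \<and> y' \<in> carrier N}
    \<union> {e (r \<odot>\<^bsub>M\<^esub> x) y \<ominus>\<^bsub>F\<^esub> r \<odot>\<^bsub>F\<^esub> e x y | r x y.
         r \<in> carrier R \<and> x \<in> carrier M \<and> y \<in> carrier N}
    \<union> {e x (r \<odot>\<^bsub>N\<^esub> y) \<ominus>\<^bsub>F\<^esub> r \<odot>\<^bsub>F\<^esub> e x y | r x y.
         r \<in> carrier R \<and> x \<in> carrier M \<and> y \<in> carrier N})"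

definition tensor_ker ::
  "('k,'r) ring_scheme \<Rightarrow> ('k,'m,'x) module_scheme \<Rightarrow> ('k,'n,'y) module_scheme \<Rightarrow> ('m \<times> 'n \<Rightarrow> 'k) set"
  where "tensor_ker R M N =
    gen_submodule R (free_module R (carrier M \<times> carrier N)) (tensor_rels R M N)"

definition tensor ::
  "('k,'r) ring_scheme \<Rightarrow> ('k,'m,'x) module_scheme \<Rightarrow> ('k,'n,'y) module_scheme \<Rightarrow>
   ('k, ('k,'m,'n) tens) module"
  where "tensor R M N =
    quot_module (free_module R (carrier M \<times> carrier N)) (tensor_ker R M N)"

definition tens ::
  "('k,'r) ring_scheme \<Rightarrow> ('k,'m,'x) module_scheme \<Rightarrow> ('k,'n,'y) module_scheme \<Rightarrow>
   'm \<Rightarrow> 'n \<Rightarrow> ('k,'m,'n) tens"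
  where "tens R M N x y =
    tensor_ker R M N +>\<^bsub>free_module R (carrier M \<times> carrier N)\<^esub> free_gen R (x, y)"

text \<open>Threefold tensors are bracketed to the right, as plain tensor products of modules; the
  twisted associator of the Hom-category is not involved.\<close>

definition tens3 ::
  "('k,'r) ring_scheme \<Rightarrow> ('k,'m,'x) module_scheme \<Rightarrow> ('k,'n,'y) module_scheme \<Rightarrow>
   ('k,'p,'z) module_scheme \<Rightarrow> 'm \<Rightarrow> 'n \<Rightarrow> 'p \<Rightarrow> ('k,'m,('k,'n,'p) tens) tens"
  where "tens3 R M N P x y z = tens R M (tensor R N P) x (tens R N P y z)"

text \<open>Sweedler notation. If \<open>t \<in> M \<otimes> N\<close> is written \<open>t = \<Sum> x \<otimes> y\<close> and \<open>f\<close> is bilinear with values in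
  \<open>P\<close>, then \<open>sweedler R P t f\<close> is \<open>\<Sum> f x y\<close>, i.e. the value at \<open>t\<close> of the linear map
  \<open>M \<otimes> N \<rightarrow> P\<close> induced by \<open>f\<close>. It is computed from an arbitrary representative of \<open>t\<close> in the
  free module, on which the result does not depend when \<open>f\<close> is bilinear. All uses
  below are of this kind: for instance \<open>sweedler R P (comul C c) (\<lambda>c1 c2. f c1 c2)\<close> reads
  \<open>f(c\<^sub>(\<^sub>1\<^sub>), c\<^sub>(\<^sub>2\<^sub>))\<close>.\<close>

definition sweedler ::
  "('k,'r) ring_scheme \<Rightarrow> ('k,'p,'z) module_scheme \<Rightarrow> ('k,'m,'n) tens \<Rightarrow> ('m \<Rightarrow> 'n \<Rightarrow> 'p) \<Rightarrow> 'p"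
  where "sweedler R P t f =
    (let u = (SOME u. u \<in> t) in \<Oplus>\<^bsub>P\<^esub>p\<in>{p. u p \<noteq> \<zero>\<^bsub>R\<^esub>}. u p \<odot>\<^bsub>P\<^esub> f (fst p) (snd p))"

text \<open>HOL cannot quantify over all modules inside a formula, so the modules \<open>P\<close> and \<open>Q\<close> range over
  those whose elements have the type \<open>'k\<close> of the scalars. This is enough: they include all inclusions
  \<open>I \<rightarrow> R\<close> of ideals, and a module that preserves the injectivity of those is flat.\<close>

definition flat_module :: "('k,'r) ring_scheme \<Rightarrow> ('k,'m,'x) module_scheme \<Rightarrow> bool"
  where "flat_module R M \<longleftrightarrow> module R M \<and>
    (\<forall>(P :: ('k,'k) module) (Q :: ('k,'k) module) f.
       module R P \<longrightarrow> module R Q \<longrightarrow> f \<in> lin_maps R P Q \<longrightarrow> inj_on f (carrier P) \<longrightarrow>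
       inj_on (\<lambda>t. sweedler R (tensor R M Q) t (\<lambda>m p. tens R M Q m (f p)))
         (carrier (tensor R M P)))"


section \<open>Monoidal Hom-structures\<close>

record ('k,'m) hom_object = "('k,'m) module" +
  aut :: "'m \<Rightarrow> 'm"

definition iaut :: "('k,'m,'x) hom_object_scheme \<Rightarrow> 'm \<Rightarrow> 'm"
  where "iaut M = inv_into (carrier M) (aut M)"

locale hom_obj =
  fixes R :: "('k,'r) ring_scheme" and M :: "('k,'m,'x) hom_object_scheme"
  assumes module: "module R M"
    and aut_lin: "aut M \<in> lin_maps R M M"
    and aut_bij: "bij_betw (aut M) (carrier M) (carrier M)"

text \<open>One record serves for Hom-algebras (product and unit are the fields \<^const>\<open>mult\<close> and
  \<^const>\<open>one\<close>), Hom-coalgebras and Hom-bialgebras.\<close>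

record ('k,'a) hom_structure = "('k,'a) hom_object" +
  comul :: "'a \<Rightarrow> ('k,'a,'a) tens"
  counit :: "'a \<Rightarrow> 'k"

locale hom_algebra =
  fixes R :: "('k,'r) ring_scheme" and A :: "('k,'a,'x) hom_object_scheme"
  assumes obj: "hom_obj R A"
    and mult_bilin: "mult A \<in> bilin_maps R A A A"
    and one_closed: "\<one>\<^bsub>A\<^esub> \<in> carrier A"
    and aut_mult: "\<lbrakk>a \<in> carrier A; b \<in> carrier A\<rbrakk> \<Longrightarrow> aut A (a \<otimes>\<^bsub>A\<^esub> b) = aut A a \<otimes>\<^bsub>A\<^esub> aut A b"
    and aut_one: "aut A \<one>\<^bsub>A\<^esub> = \<one>\<^bsub>A\<^esub>"
    and hom_assoc: "\<lbrakk>a \<in> carrier A; b \<in> carrier A; c \<in> carrier A\<rbrakk> \<Longrightarrow>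
      aut A a \<otimes>\<^bsub>A\<^esub> (b \<otimes>\<^bsub>A\<^esub> c) = (a \<otimes>\<^bsub>A\<^esub> b) \<otimes>\<^bsub>A\<^esub> aut A c"
    and mult_one: "a \<in> carrier A \<Longrightarrow> a \<otimes>\<^bsub>A\<^esub> \<one>\<^bsub>A\<^esub> = aut A a"
    and one_mult: "a \<in> carrier A \<Longrightarrow> \<one>\<^bsub>A\<^esub> \<otimes>\<^bsub>A\<^esub> a = aut A a"

locale hom_coalgebra =
  fixes R :: "('k,'r) ring_scheme" and C :: "('k,'c,'x) hom_structure_scheme"
  assumes obj: "hom_obj R C"
    and comul_lin: "comul C \<in> lin_maps R C (tensor R C C)"
    and counit_lin: "counit C \<in> lin_maps R C (self_module R)"
    and comul_aut: "c \<in> carrier C \<Longrightarrow> comul C (aut C c) =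
      sweedler R (tensor R C C) (comul C c) (\<lambda>c1 c2. tens R C C (aut C c1) (aut C c2))"
    and counit_aut: "c \<in> carrier C \<Longrightarrow> counit C (aut C c) = counit C c"
    and hom_coassoc: "c \<in> carrier C \<Longrightarrow>
      sweedler R (tensor R C (tensor R C C)) (comul C c) (\<lambda>c1 c2.
        sweedler R (tensor R C (tensor R C C)) (comul C c2) (\<lambda>c21 c22.
          tens3 R C C C (iaut C c1) c21 c22))
      = sweedler R (tensor R C (tensor R C C)) (comul C c) (\<lambda>c1 c2.
        sweedler R (tensor R C (tensor R C C)) (comul C c1) (\<lambda>c11 c12.
          tens3 R C C C c11 c12 (iaut C c2)))"
    and counit_left: "c \<in> carrier C \<Longrightarrow>
      sweedler R C (comul C c) (\<lambda>c1 c2. counit C c1 \<odot>\<^bsub>C\<^esub> c2) = iaut C c"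
    and counit_right: "c \<in> carrier C \<Longrightarrow>
      sweedler R C (comul C c) (\<lambda>c1 c2. counit C c2 \<odot>\<^bsub>C\<^esub> c1) = iaut C c"

locale hom_bialgebra =
  fixes R :: "('k,'r) ring_scheme" and A :: "('k,'a,'x) hom_structure_scheme"
  assumes algebra: "hom_algebra R A"
    and coalgebra: "hom_coalgebra R A"
    and comul_mult: "\<lbrakk>a \<in> carrier A; b \<in> carrier A\<rbrakk> \<Longrightarrow> comul A (a \<otimes>\<^bsub>A\<^esub> b) =
      sweedler R (tensor R A A) (comul A a) (\<lambda>a1 a2.
        sweedler R (tensor R A A) (comul A b) (\<lambda>b1 b2.
          tens R A A (a1 \<otimes>\<^bsub>A\<^esub> b1) (a2 \<otimes>\<^bsub>A\<^esub> b2)))"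
    and comul_one: "comul A \<one>\<^bsub>A\<^esub> = tens R A A \<one>\<^bsub>A\<^esub> \<one>\<^bsub>A\<^esub>"
    and counit_mult: "\<lbrakk>a \<in> carrier A; b \<in> carrier A\<rbrakk> \<Longrightarrow>
      counit A (a \<otimes>\<^bsub>A\<^esub> b) = counit A a \<otimes>\<^bsub>R\<^esub> counit A b"
    and counit_one: "counit A \<one>\<^bsub>A\<^esub> = \<one>\<^bsub>R\<^esub>"

locale antipode =
  fixes R :: "('k,'r) ring_scheme" and A :: "('k,'a,'x) hom_structure_scheme" and S :: "'a \<Rightarrow> 'a"
  assumes lin: "S \<in> lin_maps R A A"
    and aut: "a \<in> carrier A \<Longrightarrow> S (aut A a) = aut A (S a)"
    and left: "a \<in> carrier A \<Longrightarrow>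
      sweedler R A (comul A a) (\<lambda>a1 a2. S a1 \<otimes>\<^bsub>A\<^esub> a2) = counit A a \<odot>\<^bsub>A\<^esub> \<one>\<^bsub>A\<^esub>"
    and right: "a \<in> carrier A \<Longrightarrow>
      sweedler R A (comul A a) (\<lambda>a1 a2. a1 \<otimes>\<^bsub>A\<^esub> S a2) = counit A a \<odot>\<^bsub>A\<^esub> \<one>\<^bsub>A\<^esub>"

locale twisted_antipode =
  fixes R :: "('k,'r) ring_scheme" and A :: "('k,'a,'x) hom_structure_scheme" and S :: "'a \<Rightarrow> 'a"
  assumes lin: "S \<in> lin_maps R A A"
    and aut: "a \<in> carrier A \<Longrightarrow> S (aut A a) = aut A (S a)"
    and left: "a \<in> carrier A \<Longrightarrow>
      sweedler R A (comul A a) (\<lambda>a1 a2. S a2 \<otimes>\<^bsub>A\<^esub> a1) = counit A a \<odot>\<^bsub>A\<^esub> \<one>\<^bsub>A\<^esub>"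
    and right: "a \<in> carrier A \<Longrightarrow>
      sweedler R A (comul A a) (\<lambda>a1 a2. a2 \<otimes>\<^bsub>A\<^esub> S a1) = counit A a \<odot>\<^bsub>A\<^esub> \<one>\<^bsub>A\<^esub>"

locale hom_Hopf_algebra =
  fixes R :: "('k,'r) ring_scheme" and H :: "('k,'h,'x) hom_structure_scheme" and S :: "'h \<Rightarrow> 'h"
  assumes bialgebra: "hom_bialgebra R H"
    and antipode: "antipode R H S"

locale hom_module =
  fixes R :: "('k,'r) ring_scheme" and A :: "('k,'a,'x) hom_object_scheme"
    and M :: "('k,'m,'y) hom_object_scheme" and ac :: "'a \<Rightarrow> 'm \<Rightarrow> 'm"
  assumes algebra: "hom_algebra R A"
    and obj: "hom_obj R M"
    and act_bilin: "ac \<in> bilin_maps R A M M"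
    and act_assoc: "\<lbrakk>a \<in> carrier A; b \<in> carrier A; m \<in> carrier M\<rbrakk> \<Longrightarrow>
      ac (aut A a) (ac b m) = ac (a \<otimes>\<^bsub>A\<^esub> b) (aut M m)"
    and act_one: "m \<in> carrier M \<Longrightarrow> ac \<one>\<^bsub>A\<^esub> m = aut M m"
    and act_aut: "\<lbrakk>a \<in> carrier A; m \<in> carrier M\<rbrakk> \<Longrightarrow> aut M (ac a m) = ac (aut A a) (aut M m)"

locale hom_comodule =
  fixes R :: "('k,'r) ring_scheme" and C :: "('k,'c,'x) hom_structure_scheme"
    and M :: "('k,'m,'y) hom_object_scheme" and co :: "'m \<Rightarrow> ('k,'m,'c) tens"
  assumes coalgebra: "hom_coalgebra R C"
    and obj: "hom_obj R M"
    and coact_lin: "co \<in> lin_maps R M (tensor R M C)"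
    and coact_coassoc: "m \<in> carrier M \<Longrightarrow>
      sweedler R (tensor R M (tensor R C C)) (co m) (\<lambda>m0 m1.
        sweedler R (tensor R M (tensor R C C)) (co m0) (\<lambda>m00 m01.
          tens3 R M C C m00 m01 (iaut C m1)))
      = sweedler R (tensor R M (tensor R C C)) (co m) (\<lambda>m0 m1.
          tens R M (tensor R C C) (iaut M m0) (comul C m1))"
    and coact_counit: "m \<in> carrier M \<Longrightarrow>
      sweedler R M (co m) (\<lambda>m0 m1. counit C m1 \<odot>\<^bsub>M\<^esub> m0) = iaut M m"
    and coact_aut: "m \<in> carrier M \<Longrightarrow> co (aut M m) =
      sweedler R (tensor R M C) (co m) (\<lambda>m0 m1. tens R M C (aut M m0) (aut C m1))"


section \<open>Doi Hom-Hopf data and modules\<close>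

locale hom_comodule_algebra =
  fixes R :: "('k,'r) ring_scheme" and H :: "('k,'h,'x) hom_structure_scheme"
    and A :: "('k,'a,'y) hom_object_scheme" and rA :: "'a \<Rightarrow> ('k,'a,'h) tens"
  assumes bialgebra: "hom_bialgebra R H"
    and algebra: "hom_algebra R A"
    and comodule: "hom_comodule R H A rA"
    and coact_mult: "\<lbrakk>a \<in> carrier A; b \<in> carrier A\<rbrakk> \<Longrightarrow> rA (a \<otimes>\<^bsub>A\<^esub> b) =
      sweedler R (tensor R A H) (rA a) (\<lambda>a0 a1.
        sweedler R (tensor R A H) (rA b) (\<lambda>b0 b1. tens R A H (a0 \<otimes>\<^bsub>A\<^esub> b0) (a1 \<otimes>\<^bsub>H\<^esub> b1)))"
    and coact_one: "rA \<one>\<^bsub>A\<^esub> = tens R A H \<one>\<^bsub>A\<^esub> \<one>\<^bsub>H\<^esub>"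

locale hom_module_coalgebra =
  fixes R :: "('k,'r) ring_scheme" and H :: "('k,'h,'x) hom_structure_scheme"
    and C :: "('k,'c,'y) hom_structure_scheme" and hC :: "'h \<Rightarrow> 'c \<Rightarrow> 'c"
  assumes bialgebra: "hom_bialgebra R H"
    and coalgebra: "hom_coalgebra R C"
    and module: "hom_module R H C hC"
    and comul_act: "\<lbrakk>h \<in> carrier H; c \<in> carrier C\<rbrakk> \<Longrightarrow> comul C (hC h c) =
      sweedler R (tensor R C C) (comul H h) (\<lambda>h1 h2.
        sweedler R (tensor R C C) (comul C c) (\<lambda>c1 c2. tens R C C (hC h1 c1) (hC h2 c2)))"
    and counit_act: "\<lbrakk>h \<in> carrier H; c \<in> carrier C\<rbrakk> \<Longrightarrow>
      counit C (hC h c) = counit H h \<otimes>\<^bsub>R\<^esub> counit C c"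

text \<open>A datum \<open>(H,A,C)\<close> consists of \<open>H\<close> with antipode \<open>S\<close>, of \<open>A\<close> with \<open>H\<close>-coaction \<open>rA\<close>, and of \<open>C\<close>
  with \<open>H\<close>-action \<open>hC\<close>.\<close>

locale Doi_datum =
  fixes R :: "('k,'r) ring_scheme" and H :: "('k,'h,'x) hom_structure_scheme" and S :: "'h \<Rightarrow> 'h"
    and A :: "('k,'a,'y) hom_object_scheme" and rA :: "'a \<Rightarrow> ('k,'a,'h) tens"
    and C :: "('k,'c,'z) hom_structure_scheme" and hC :: "'h \<Rightarrow> 'c \<Rightarrow> 'c"
  assumes Hopf: "hom_Hopf_algebra R H S"
    and comodule_algebra: "hom_comodule_algebra R H A rA"
    and module_coalgebra: "hom_module_coalgebra R H C hC"

locale monoidal_Doi_datum =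
  fixes R :: "('k,'r) ring_scheme" and H :: "('k,'h,'x) hom_structure_scheme" and S :: "'h \<Rightarrow> 'h"
    and A :: "('k,'a,'y) hom_structure_scheme" and rA :: "'a \<Rightarrow> ('k,'a,'h) tens"
    and C :: "('k,'c,'z) hom_structure_scheme" and hC :: "'h \<Rightarrow> 'c \<Rightarrow> 'c"
  assumes datum: "Doi_datum R H S A rA C hC"
    and bialgebra_A: "hom_bialgebra R A"
    and bialgebra_C: "hom_bialgebra R C"
    and compat_comul: "\<lbrakk>a \<in> carrier A; c \<in> carrier C; d \<in> carrier C\<rbrakk> \<Longrightarrow>
      sweedler R (tensor R A (tensor R A C)) (comul A a) (\<lambda>a1 a2.
        sweedler R (tensor R A (tensor R A C)) (rA a1) (\<lambda>a10 a11.
          sweedler R (tensor R A (tensor R A C)) (rA a2) (\<lambda>a20 a21.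
            tens3 R A A C a10 a20 (hC a11 c \<otimes>\<^bsub>C\<^esub> hC a21 d))))
      = sweedler R (tensor R A (tensor R A C)) (rA a) (\<lambda>a0 a1.
          sweedler R (tensor R A (tensor R A C)) (comul A a0) (\<lambda>a01 a02.
            tens3 R A A C a01 a02 (hC a1 (c \<otimes>\<^bsub>C\<^esub> d))))"
    and compat_counit: "a \<in> carrier A \<Longrightarrow> counit A a \<odot>\<^bsub>C\<^esub> \<one>\<^bsub>C\<^esub> =
      sweedler R C (rA a) (\<lambda>a0 a1. counit A a0 \<odot>\<^bsub>C\<^esub> hC a1 \<one>\<^bsub>C\<^esub>)"

locale hom_bialgebra_map =
  fixes R :: "('k,'r) ring_scheme" and A :: "('k,'a,'x) hom_structure_scheme"
    and B :: "('k,'b,'y) hom_structure_scheme" and \<psi> :: "'a \<Rightarrow> 'b"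
  assumes lin: "\<psi> \<in> lin_maps R A B"
    and aut: "a \<in> carrier A \<Longrightarrow> \<psi> (aut A a) = aut B (\<psi> a)"
    and mult: "\<lbrakk>a \<in> carrier A; b \<in> carrier A\<rbrakk> \<Longrightarrow> \<psi> (a \<otimes>\<^bsub>A\<^esub> b) = \<psi> a \<otimes>\<^bsub>B\<^esub> \<psi> b"
    and one: "\<psi> \<one>\<^bsub>A\<^esub> = \<one>\<^bsub>B\<^esub>"
    and comul: "a \<in> carrier A \<Longrightarrow> comul B (\<psi> a) =
      sweedler R (tensor R B B) (comul A a) (\<lambda>a1 a2. tens R B B (\<psi> a1) (\<psi> a2))"
    and counit: "a \<in> carrier A \<Longrightarrow> counit B (\<psi> a) = counit A a"

text \<open>Monoidal morphisms of data of the form \<open>(id\<^sub>H, \<psi>, id\<^sub>C) : (H,A,C) \<rightarrow> (H,B,C)\<close>.\<close>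

locale monoidal_datum_map =
  fixes R :: "('k,'r) ring_scheme" and H :: "('k,'h,'z) hom_structure_scheme"
    and A :: "('k,'a,'x) hom_structure_scheme" and rA :: "'a \<Rightarrow> ('k,'a,'h) tens"
    and B :: "('k,'b,'y) hom_structure_scheme" and rB :: "'b \<Rightarrow> ('k,'b,'h) tens"
    and \<psi> :: "'a \<Rightarrow> 'b"
  assumes bialgebra_map: "hom_bialgebra_map R A B \<psi>"
    and coact: "a \<in> carrier A \<Longrightarrow>
      rB (\<psi> a) = sweedler R (tensor R B H) (rA a) (\<lambda>a0 a1. tens R B H (\<psi> a0) a1)"


subsection \<open>The category of Doi Hom-Hopf modules\<close>

record ('k,'a,'c,'m) Doi_obj = "('k,'m) hom_object" +
  act :: "'a \<Rightarrow> 'm \<Rightarrow> 'm"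
  coact :: "'m \<Rightarrow> ('k,'m,'c) tens"

locale Doi_module =
  fixes R :: "('k,'r) ring_scheme" and A :: "('k,'a,'x) hom_object_scheme"
    and rA :: "'a \<Rightarrow> ('k,'a,'h) tens"
    and C :: "('k,'c,'y) hom_structure_scheme" and hC :: "'h \<Rightarrow> 'c \<Rightarrow> 'c"
    and M :: "('k,'a,'c,'m) Doi_obj"
  assumes module: "hom_module R A M (act M)"
    and comodule: "hom_comodule R C M (coact M)"
    and coact_act: "\<lbrakk>a \<in> carrier A; m \<in> carrier M\<rbrakk> \<Longrightarrow> coact M (act M a m) =
      sweedler R (tensor R M C) (rA a) (\<lambda>a0 a1.
        sweedler R (tensor R M C) (coact M m) (\<lambda>m0 m1. tens R M C (act M a0 m0) (hC a1 m1)))"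

definition Doi_maps ::
  "('k,'r) ring_scheme \<Rightarrow> ('k,'a,'x) hom_object_scheme \<Rightarrow> ('k,'c,'y) hom_structure_scheme \<Rightarrow>
   ('k,'a,'c,'m) Doi_obj \<Rightarrow> ('k,'a,'c,'n) Doi_obj \<Rightarrow> ('m \<Rightarrow> 'n) set"
  where "Doi_maps R A C M N = {f. f \<in> lin_maps R M N \<and>
    (\<forall>m\<in>carrier M. f (aut M m) = aut N (f m)) \<and>
    (\<forall>a\<in>carrier A. \<forall>m\<in>carrier M. f (act M a m) = act N a (f m)) \<and>
    (\<forall>m\<in>carrier M. coact N (f m) =
       sweedler R (tensor R N C) (coact M m) (\<lambda>m0 m1. tens R N C (f m0) m1))}"

definition Doi_iso ::
  "('k,'r) ring_scheme \<Rightarrow> ('k,'a,'x) hom_object_scheme \<Rightarrow> ('a \<Rightarrow> ('k,'a,'h) tens) \<Rightarrow>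
   ('k,'c,'y) hom_structure_scheme \<Rightarrow> ('h \<Rightarrow> 'c \<Rightarrow> 'c) \<Rightarrow>
   ('k,'a,'c,'m) Doi_obj \<Rightarrow> ('k,'a,'c,'n) Doi_obj \<Rightarrow> ('m \<Rightarrow> 'n) \<Rightarrow> bool"
  where "Doi_iso R A rA C hC M N f \<longleftrightarrow>
    Doi_module R A rA C hC M \<and> Doi_module R A rA C hC N \<and> f \<in> Doi_maps R A C M N \<and>
    (\<exists>g\<in>Doi_maps R A C N M. (\<forall>m\<in>carrier M. g (f m) = m) \<and> (\<forall>n\<in>carrier N. f (g n) = n))"

definition Doi_isomorphic ::
  "('k,'r) ring_scheme \<Rightarrow> ('k,'a,'x) hom_object_scheme \<Rightarrow> ('a \<Rightarrow> ('k,'a,'h) tens) \<Rightarrow>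
   ('k,'c,'y) hom_structure_scheme \<Rightarrow> ('h \<Rightarrow> 'c \<Rightarrow> 'c) \<Rightarrow>
   ('k,'a,'c,'m) Doi_obj \<Rightarrow> ('k,'a,'c,'n) Doi_obj \<Rightarrow> bool"
  where "Doi_isomorphic R A rA C hC M N \<longleftrightarrow> (\<exists>f. Doi_iso R A rA C hC M N f)"

definition Doi_tensor ::
  "('k,'r) ring_scheme \<Rightarrow> ('k,'a,'x) hom_structure_scheme \<Rightarrow> ('k,'c,'y) hom_structure_scheme \<Rightarrow>
   ('k,'a,'c,'m) Doi_obj \<Rightarrow> ('k,'a,'c,'n) Doi_obj \<Rightarrow> ('k,'a,'c,('k,'m,'n) tens) Doi_obj"
  where "Doi_tensor R A C M N = (let T = tensor R M N in \<lparr>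
    carrier = carrier T, mult = mult T, one = one T, zero = zero T, add = add T, smult = smult T,
    aut = (\<lambda>t. sweedler R T t (\<lambda>m n. tens R M N (aut M m) (aut N n))),
    act = (\<lambda>a t. sweedler R T (comul A a) (\<lambda>a1 a2. sweedler R T t (\<lambda>m n.
      tens R M N (act M a1 m) (act N a2 n)))),
    coact = (\<lambda>t. sweedler R (tensor R T C) t (\<lambda>m n.
      sweedler R (tensor R T C) (coact M m) (\<lambda>m0 m1.
        sweedler R (tensor R T C) (coact N n) (\<lambda>n0 n1.
          tens R T C (tens R M N m0 n0) (m1 \<otimes>\<^bsub>C\<^esub> n1)))))\<rparr>)"

definition Doi_regular ::
  "('k,'r) ring_scheme \<Rightarrow> ('k,'h,'x) hom_structure_scheme \<Rightarrow>
   ('k,'a,'y) hom_object_scheme \<Rightarrow> ('a \<Rightarrow> ('k,'a,'h) tens) \<Rightarrow>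
   ('k,'c,'z) hom_structure_scheme \<Rightarrow> ('h \<Rightarrow> 'c \<Rightarrow> 'c) \<Rightarrow> ('k,'a,'c,'a) Doi_obj"
  where "Doi_regular R H A rA C hC = \<lparr>
    carrier = carrier A, mult = mult A, one = one A, zero = zero A, add = add A, smult = smult A,
    aut = aut A,
    act = mult A,
    coact = (\<lambda>a. sweedler R (tensor R A C) (rA a) (\<lambda>a0 a1.
      tens R A C a0 (hC (iaut H a1) \<one>\<^bsub>C\<^esub>)))\<rparr>"


subsection \<open>The induction functor \<open>F\<close> and the restriction functor \<open>G\<close> on objects\<close>

text \<open>\<open>B \<otimes>\<^sub>A M\<close> is a quotient of \<open>B \<otimes> M\<close>; its elements are cosets of tensors.\<close>

type_synonym ('k,'b,'m) btens = "('k,'b,'m) tens set"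

definition bal_ker ::
  "('k,'r) ring_scheme \<Rightarrow> ('k,'a,'x) hom_object_scheme \<Rightarrow> ('k,'b,'y) hom_object_scheme \<Rightarrow>
   ('a \<Rightarrow> 'b) \<Rightarrow> ('k,'a,'c,'m) Doi_obj \<Rightarrow> ('k,'b,'m) tens set"
  where "bal_ker R A B \<psi> M = gen_submodule R (tensor R B M)
    {tens R B M (b \<otimes>\<^bsub>B\<^esub> \<psi> a) m \<ominus>\<^bsub>tensor R B M\<^esub> tens R B M (aut B b) (act M a (iaut M m)) | b a m.
       b \<in> carrier B \<and> a \<in> carrier A \<and> m \<in> carrier M}"

definition bal_tensor ::
  "('k,'r) ring_scheme \<Rightarrow> ('k,'a,'x) hom_object_scheme \<Rightarrow> ('k,'b,'y) hom_object_scheme \<Rightarrow>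
   ('a \<Rightarrow> 'b) \<Rightarrow> ('k,'a,'c,'m) Doi_obj \<Rightarrow> ('k, ('k,'b,'m) btens) module"
  where "bal_tensor R A B \<psi> M = quot_module (tensor R B M) (bal_ker R A B \<psi> M)"

definition bal_tens ::
  "('k,'r) ring_scheme \<Rightarrow> ('k,'a,'x) hom_object_scheme \<Rightarrow> ('k,'b,'y) hom_object_scheme \<Rightarrow>
   ('a \<Rightarrow> 'b) \<Rightarrow> ('k,'a,'c,'m) Doi_obj \<Rightarrow> 'b \<Rightarrow> 'm \<Rightarrow> ('k,'b,'m) btens"
  where "bal_tens R A B \<psi> M b m = bal_ker R A B \<psi> M +>\<^bsub>tensor R B M\<^esub> tens R B M b m"

text \<open>The analogue of \<^const>\<open>sweedler\<close> for \<open>x = \<Sum> b \<otimes>\<^sub>A m\<close>: the result does not depend on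
  the representative when \<open>f\<close> is bilinear and respects the relations of \<open>B \<otimes>\<^sub>A M\<close>.\<close>

definition bal_sweedler ::
  "('k,'r) ring_scheme \<Rightarrow> ('k,'p,'z) module_scheme \<Rightarrow> ('k,'b,'m) btens \<Rightarrow> ('b \<Rightarrow> 'm \<Rightarrow> 'p) \<Rightarrow> 'p"
  where "bal_sweedler R P x f = sweedler R P (SOME t. t \<in> x) f"

definition Doi_ind ::
  "('k,'r) ring_scheme \<Rightarrow> ('k,'a,'x) hom_object_scheme \<Rightarrow>
   ('k,'b,'y) hom_object_scheme \<Rightarrow> ('b \<Rightarrow> ('k,'b,'h) tens) \<Rightarrow>
   ('k,'c,'z) hom_structure_scheme \<Rightarrow> ('h \<Rightarrow> 'c \<Rightarrow> 'c) \<Rightarrow> ('a \<Rightarrow> 'b) \<Rightarrow>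
   ('k,'a,'c,'m) Doi_obj \<Rightarrow> ('k,'b,'c,('k,'b,'m) btens) Doi_obj"
  where "Doi_ind R A B rB C hC \<psi> M =
   (let T = bal_tensor R A B \<psi> M; bt = bal_tens R A B \<psi> M in \<lparr>
    carrier = carrier T, mult = mult T, one = one T, zero = zero T, add = add T, smult = smult T,
    aut = (\<lambda>x. bal_sweedler R T x (\<lambda>b m. bt (aut B b) (aut M m))),
    act = (\<lambda>b' x. bal_sweedler R T x (\<lambda>b m. bt (iaut B b' \<otimes>\<^bsub>B\<^esub> b) (aut M m))),
    coact = (\<lambda>x. bal_sweedler R (tensor R T C) x (\<lambda>b m.
      sweedler R (tensor R T C) (rB b) (\<lambda>b0 b1.
        sweedler R (tensor R T C) (coact M m) (\<lambda>m0 m1.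
          tens R T C (bt b0 m0) (hC b1 m1)))))\<rparr>)"

text \<open>\<open>G(N) = N \<box>\<^sub>C C\<close> is identified with \<open>N\<close>, with \<open>A\<close> acting through \<open>\<psi>\<close>.\<close>

definition Doi_res :: "('a \<Rightarrow> 'b) \<Rightarrow> ('k,'b,'c,'n) Doi_obj \<Rightarrow> ('k,'a,'c,'n) Doi_obj"
  where "Doi_res \<psi> N = \<lparr>
    carrier = carrier N, mult = mult N, one = one N, zero = zero N, add = add N, smult = smult N,
    aut = aut N,
    act = (\<lambda>a. act N (\<psi> a)),
    coact = coact N\<rparr>"

end

(* The inverse of the canonical map b (x)_A a |-> b psi(a) is b |-> beta^-1(b) (x)_A 1.

   For the projection formulas let B = A'. The adjunction between F and G forces the map
   theta : F(M (x) G(N)) -> F(M) (x) N,  b (x)_A (m (x) n) |-> (b_1 (x)_A m) (x) b_2 n,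
   and the compatibility of the coproduct with the coactions makes it colinear. Its inverse is
   eta : (b (x)_A m) (x) n |-> beta^2(b_1) (x)_A (m (x) S(b_2) nu^-2(n)).
   That eta respects the relations of B (x)_A M needs S on products b psi(a). Instead of proving
   that S is antimultiplicative, one observes that the corresponding maps theta0 and eta0 on
   B (x) N are mutually inverse, and compares the images under theta0.
   With a twisted antipode the same computation runs with the two factors of the coproduct
   interchanged. *)

theory Submission
  imports Defs
begin

section \<open>Linear maps\<close>

text \<open>The exponents in eta are the cost of one cancellation. To bring the antipode next to its
  partner, Hom-coassociativity twists the surviving coproduct factor by one inverse automorphism,
  and the Hom-counit adds another; associativity of the action and the unit acting as the
  automorphism put \<open>aut N\<close> on n twice. The beta^2 and nu^-2 undo exactly this. The
  cancellation is proved once on each side (\<open>collapse_right\<close>,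
  \<open>collapse_left\<close>), for two maps p, q from a coalgebra D into the acting algebra: it is
  needed for (id, S), (S, id) and, over the coproduct of A, for (psi, S psi).

  The other difficulty is that Sweedler sums are evaluated at a representative picked by
  \<open>SOME\<close>. This choice depends on the tensor alone, so exchanging two sums or moving a
  linear map inside only asks for values in the carriers. Linearity in the tensor itself does
  require a bilinear (and, over A, balanced) summand. Hence every identity is first recognized as an
  equation between linear maps, then tested on pure elements, where it is a rewriting
  problem.\<close>

lemma lin_mapsI:
  assumes "\<And>x. x \<in> carrier M \<Longrightarrow> f x \<in> carrier N"
    and "\<And>x y. \<lbrakk>x \<in> carrier M; y \<in> carrier M\<rbrakk> \<Longrightarrow> f (x \<oplus>\<^bsub>M\<^esub> y) = f x \<oplus>\<^bsub>N\<^esub> f y"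
    and "\<And>r x. \<lbrakk>r \<in> carrier R; x \<in> carrier M\<rbrakk> \<Longrightarrow> f (r \<odot>\<^bsub>M\<^esub> x) = r \<odot>\<^bsub>N\<^esub> f x"
  shows "f \<in> lin_maps R M N"
  using assms by (auto simp: lin_maps_def)

lemma lin_maps_closed: "\<lbrakk>f \<in> lin_maps R M N; x \<in> carrier M\<rbrakk> \<Longrightarrow> f x \<in> carrier N"
  by (auto simp: lin_maps_def)

lemma lin_maps_add:
  "\<lbrakk>f \<in> lin_maps R M N; x \<in> carrier M; y \<in> carrier M\<rbrakk> \<Longrightarrow> f (x \<oplus>\<^bsub>M\<^esub> y) = f x \<oplus>\<^bsub>N\<^esub> f y"
  by (auto simp: lin_maps_def)

lemma lin_maps_smult:
  "\<lbrakk>f \<in> lin_maps R M N; r \<in> carrier R; x \<in> carrier M\<rbrakk> \<Longrightarrow> f (r \<odot>\<^bsub>M\<^esub> x) = r \<odot>\<^bsub>N\<^esub> f x"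
  by (auto simp: lin_maps_def)

text \<open>The operations of the constructed objects agree with their Sweedler formulas on carriers
  only. Closure of \<open>carrier M\<close> under sums and multiples lets the equation be used at
  those elements too.\<close>

lemma lin_maps_cong:
  assumes "\<And>x. x \<in> carrier M \<Longrightarrow> f x = g x" "module R M"
  shows "f \<in> lin_maps R M N \<longleftrightarrow> g \<in> lin_maps R M N"
proof -
  interpret M: module R M by fact
  show ?thesis using assms(1) by (auto simp: lin_maps_def Pi_iff)
qed

lemma lin_maps_zero:
  assumes "f \<in> lin_maps R M N" "module R M" "module R N"
  shows "f \<zero>\<^bsub>M\<^esub> = \<zero>\<^bsub>N\<^esub>"
proof -
  interpret M: module R M by fact
  interpret N: module R N by fact
  have "f (\<zero>\<^bsub>R\<^esub> \<odot>\<^bsub>M\<^esub> \<zero>\<^bsub>M\<^esub>) = \<zero>\<^bsub>R\<^esub> \<odot>\<^bsub>N\<^esub> f \<zero>\<^bsub>M\<^esub>"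
    using lin_maps_smult[OF assms(1)] by blast
  then show ?thesis using lin_maps_closed[OF assms(1)] by simp
qed

lemma lin_maps_uminus:
  assumes "f \<in> lin_maps R M N" "module R M" "module R N" "x \<in> carrier M"
  shows "f (\<ominus>\<^bsub>M\<^esub> x) = \<ominus>\<^bsub>N\<^esub> f x"
proof -
  interpret M: module R M by fact
  interpret N: module R N by fact
  have "f (\<ominus>\<^bsub>M\<^esub> x) \<oplus>\<^bsub>N\<^esub> f x = \<zero>\<^bsub>N\<^esub>"
    using lin_maps_add[OF assms(1), of "\<ominus>\<^bsub>M\<^esub> x" x] lin_maps_zero[OF assms(1-3)] assms(4)
    by (simp add: M.l_neg)
  then show ?thesis using assms(4) lin_maps_closed[OF assms(1)] by (simp add: N.minus_equality)
qed

lemma lin_maps_minus: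
  assumes "f \<in> lin_maps R M N" "module R M" "module R N" "x \<in> carrier M" "y \<in> carrier M"
  shows "f (x \<ominus>\<^bsub>M\<^esub> y) = f x \<ominus>\<^bsub>N\<^esub> f y"
proof -
  interpret M: module R M by fact
  interpret N: module R N by fact
  show ?thesis
    unfolding a_minus_def using assms lin_maps_add[OF assms(1)] lin_maps_uminus[OF assms(1-3)] by simp
qed

lemma lin_maps_finsum:
  assumes "f \<in> lin_maps R M N" "module R M" "module R N" "finite A" "g \<in> A \<rightarrow> carrier M"
  shows "f (\<Oplus>\<^bsub>M\<^esub>i\<in>A. g i) = (\<Oplus>\<^bsub>N\<^esub>i\<in>A. f (g i))"
proof -
  interpret M: module R M by fact
  interpret N: module R N by fact
  show ?thesis using assms(4,5)
  proof (induction A rule: finite_induct)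
    case empty
    show ?case using lin_maps_zero[OF assms(1-3)] by simp
  next
    case (insert x F)
    then have "g \<in> F \<rightarrow> carrier M" "g x \<in> carrier M" by auto
    moreover have "f (finsum M g F) = (\<Oplus>\<^bsub>N\<^esub>i\<in>F. f (g i))" using insert by auto
    moreover have "(\<lambda>i. f (g i)) \<in> F \<rightarrow> carrier N" "f (g x) \<in> carrier N"
      using insert lin_maps_closed[OF assms(1)] by auto
    ultimately show ?case using insert lin_maps_add[OF assms(1)] by simp
  qed
qed

lemma lin_maps_comp:
  "\<lbrakk>g \<in> lin_maps R N P; f \<in> lin_maps R M N\<rbrakk> \<Longrightarrow> (\<lambda>x. g (f x)) \<in> lin_maps R M P"
  by (auto simp: lin_maps_def Pi_iff)

lemma lin_maps_id [simp]: "(\<lambda>x. x) \<in> lin_maps R M M"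
  by (auto simp: lin_maps_def)

lemma lin_maps_smult_const:
  assumes "module R M" "module R N" "r \<in> carrier R" "f \<in> lin_maps R M N"
  shows "(\<lambda>x. r \<odot>\<^bsub>N\<^esub> f x) \<in> lin_maps R M N"
proof -
  interpret N: module R N by fact
  show ?thesis using assms(3,4)
    by (auto intro!: lin_mapsI simp: lin_maps_closed lin_maps_add lin_maps_smult N.smult_r_distr
      N.smult_assoc1[symmetric] N.m_comm)
qed

lemma lin_maps_plus:
  assumes "module R M" "module R P" "f \<in> lin_maps R M P" "g \<in> lin_maps R M P"
  shows "(\<lambda>x. f x \<oplus>\<^bsub>P\<^esub> g x) \<in> lin_maps R M P"
proof -
  interpret M: module R M by fact
  interpret P: module R P by fact
  note f = lin_maps_closed[OF assms(3)] lin_maps_add[OF assms(3)] lin_maps_smult[OF assms(3)]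
  note g = lin_maps_closed[OF assms(4)] lin_maps_add[OF assms(4)] lin_maps_smult[OF assms(4)]
  show ?thesis by (rule lin_mapsI) (simp_all add: f g P.a_ac P.smult_r_distr)
qed

lemma lin_maps_inv:
  assumes f: "f \<in> lin_maps R M N" "module R M"
    and g: "\<And>y. y \<in> carrier N \<Longrightarrow> g y \<in> carrier M" "\<And>y. y \<in> carrier N \<Longrightarrow> f (g y) = y"
      "\<And>x. x \<in> carrier M \<Longrightarrow> g (f x) = x"
  shows "g \<in> lin_maps R N M"
proof (rule lin_mapsI)
  interpret M: module R M by fact
  show "g x \<in> carrier M" if "x \<in> carrier N" for x using g that by auto
  show "g (x \<oplus>\<^bsub>N\<^esub> y) = g x \<oplus>\<^bsub>M\<^esub> g y" if "x \<in> carrier N" "y \<in> carrier N" for x y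
    using lin_maps_add[OF f(1), of "g x" "g y"] g that M.a_closed by metis
  show "g (r \<odot>\<^bsub>N\<^esub> x) = r \<odot>\<^bsub>M\<^esub> g x" if "r \<in> carrier R" "x \<in> carrier N" for r x
    using lin_maps_smult[OF f(1), of r "g x"] g that M.smult_closed by metis
qed


section \<open>Submodules and quotients\<close>

lemma gen_submodule_submodule:
  assumes "module R M" "X \<subseteq> carrier M"
  shows "submodule (gen_submodule R M X) R M"
proof -
  interpret module R M by fact
  have 1: "submodule (carrier M) R M" by (rule carrier_is_submodule)
  show ?thesis
  proof (rule submoduleI)
    show "gen_submodule R M X \<subseteq> carrier M" using 1 assms(2) by (auto simp: gen_submodule_def)
    show "\<zero>\<^bsub>M\<^esub> \<in> gen_submodule R M X"
      by (auto simp: gen_submodule_def submodule_def dest!: subgroup.one_closed)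
  qed (auto simp: gen_submodule_def intro: submoduleE)
qed

lemma gen_submodule_subset: "X \<subseteq> gen_submodule R M X"
  by (auto simp: gen_submodule_def)

lemma gen_submodule_least: "\<lbrakk>submodule S R M; X \<subseteq> S\<rbrakk> \<Longrightarrow> gen_submodule R M X \<subseteq> S"
  by (auto simp: gen_submodule_def)

lemma submodule_kernel:
  assumes "module R M" "module R N" "f \<in> lin_maps R M N"
  shows "submodule {x \<in> carrier M. f x = \<zero>\<^bsub>N\<^esub>} R M"
proof -
  interpret M: module R M by fact
  interpret N: module R N by fact
  note f = lin_maps_zero[OF assms(3,1,2)] lin_maps_uminus[OF assms(3,1,2)] lin_maps_add[OF assms(3)]
    lin_maps_smult[OF assms(3)]
  show ?thesis by (rule M.submoduleI) (auto simp: f)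
qed

text \<open>The kernel is a submodule, so it contains what its elements generate. For both kinds of
  tensor product this reduces well-definedness to the defining relations.\<close>

lemma lin_maps_gen_submodule:
  assumes "module R M" "module R N" "f \<in> lin_maps R M N"
    "\<And>x. x \<in> X \<Longrightarrow> x \<in> carrier M \<and> f x = \<zero>\<^bsub>N\<^esub>" "y \<in> gen_submodule R M X"
  shows "f y = \<zero>\<^bsub>N\<^esub>"
  using gen_submodule_least[OF submodule_kernel[OF assms(1-3)], of X] assms(4,5) by auto

locale quot_mod =
  fixes R :: "('k,'r) ring_scheme" and M :: "('k,'m,'x) module_scheme" and S :: "'m set"
  assumes M: "module R M" and S: "submodule S R M"
begin

sublocale M: module R M by (rule M)

sublocale S: abelian_subgroup S M
  by (rule abelian_subgroupI3) (use S in \<open>auto simp: submodule_def additive_subgroup_def M.abelian_group_axioms\<close>)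

abbreviation "Q \<equiv> quot_module M S"

lemma carrier_quot: "carrier Q = (\<lambda>x. S +>\<^bsub>M\<^esub> x) ` carrier M"
  by (auto simp: quot_module_def A_RCOSETS_def')

lemma coset_closed: "x \<in> carrier M \<Longrightarrow> S +>\<^bsub>M\<^esub> x \<in> carrier Q"
  by (auto simp: carrier_quot)

lemma coset_eqI:
  assumes "x \<in> carrier M" "y \<in> carrier M" "x \<ominus>\<^bsub>M\<^esub> y \<in> S"
  shows "S +>\<^bsub>M\<^esub> x = S +>\<^bsub>M\<^esub> y"
  using assms S.a_rcos_module[of y x] S.a_repr_independence'[of x y]
  by (simp add: a_minus_def)

lemma coset_mem: "\<lbrakk>x \<in> carrier M; u \<in> S +>\<^bsub>M\<^esub> x\<rbrakk> \<Longrightarrow> u \<in> carrier M \<and> (\<exists>s\<in>S. u = s \<oplus>\<^bsub>M\<^esub> x)"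
  by (auto simp: a_r_coset_def')

text \<open>\<open>quot_module\<close> multiplies a coset by taking a union over all its
  representatives. They all contribute the same coset, because S is closed under multiplication by
  r.\<close>

lemma coset_smult:
  assumes "r \<in> carrier R" "x \<in> carrier M"
  shows "r \<odot>\<^bsub>Q\<^esub> (S +>\<^bsub>M\<^esub> x) = S +>\<^bsub>M\<^esub> (r \<odot>\<^bsub>M\<^esub> x)"
proof -
  have "S +>\<^bsub>M\<^esub> (r \<odot>\<^bsub>M\<^esub> y) = S +>\<^bsub>M\<^esub> (r \<odot>\<^bsub>M\<^esub> x)" if yx: "y \<in> S +>\<^bsub>M\<^esub> x" for y
  proof -
    obtain s where s: "s \<in> S" "y = s \<oplus>\<^bsub>M\<^esub> x" and y: "y \<in> carrier M"
      using coset_mem[OF assms(2) yx] by auto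
    have sM: "s \<in> carrier M" using s by simp
    have rs: "r \<odot>\<^bsub>M\<^esub> s \<in> carrier M" "r \<odot>\<^bsub>M\<^esub> x \<in> carrier M" using sM assms by auto
    have "r \<odot>\<^bsub>M\<^esub> y = r \<odot>\<^bsub>M\<^esub> s \<oplus>\<^bsub>M\<^esub> r \<odot>\<^bsub>M\<^esub> x"
      using sM assms by (simp add: s(2) M.smult_r_distr)
    then have "r \<odot>\<^bsub>M\<^esub> y \<ominus>\<^bsub>M\<^esub> r \<odot>\<^bsub>M\<^esub> x = r \<odot>\<^bsub>M\<^esub> s"
      by (simp only: a_minus_def M.a_assoc[OF rs M.a_inv_closed[OF rs(2)]] M.r_neg[OF rs(2)] M.r_zero[OF rs(1)])
    also have "\<dots> \<in> S" using S s(1) assms(1) by (auto intro: submodule.smult_closed)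
    finally show ?thesis using y assms by (intro coset_eqI) auto
  qed
  moreover have "x \<in> S +>\<^bsub>M\<^esub> x" using assms by (simp add: S.a_rcos_self)
  ultimately have "(\<Union>y\<in>S +>\<^bsub>M\<^esub> x. S +>\<^bsub>M\<^esub> (r \<odot>\<^bsub>M\<^esub> y)) = S +>\<^bsub>M\<^esub> (r \<odot>\<^bsub>M\<^esub> x)"
    by blast
  then show ?thesis by (simp add: quot_module_def)
qed

lemma coset_add:
  "\<lbrakk>x \<in> carrier M; y \<in> carrier M\<rbrakk> \<Longrightarrow> (S +>\<^bsub>M\<^esub> x) \<oplus>\<^bsub>Q\<^esub> (S +>\<^bsub>M\<^esub> y) = S +>\<^bsub>M\<^esub> (x \<oplus>\<^bsub>M\<^esub> y)"
  by (simp add: quot_module_def S.a_rcos_sum)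

lemma coset_lin: "(\<lambda>x. S +>\<^bsub>M\<^esub> x) \<in> lin_maps R M Q"
  by (rule lin_mapsI) (auto simp: coset_closed coset_smult coset_add)

lemma coset_of_submodule: "x \<in> S \<Longrightarrow> S +>\<^bsub>M\<^esub> x = \<zero>\<^bsub>Q\<^esub>"
  by (simp add: quot_module_def S.a_rcos_const)

lemma module_quot: "module R Q"
proof (rule moduleI)
  show "cring R" by (rule M.is_cring)
  have z: "\<zero>\<^bsub>Q\<^esub> = S +>\<^bsub>M\<^esub> \<zero>\<^bsub>M\<^esub>"
    by (simp add: coset_of_submodule)
  show "abelian_group Q"
  proof (rule abelian_groupI)
    fix X assume "X \<in> carrier Q"
    then obtain x where "x \<in> carrier M" "X = S +>\<^bsub>M\<^esub> x" by (auto simp: carrier_quot)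
    then show "\<exists>Y\<in>carrier Q. Y \<oplus>\<^bsub>Q\<^esub> X = \<zero>\<^bsub>Q\<^esub>"
      unfolding z by (intro bexI[of _ "S +>\<^bsub>M\<^esub> (\<ominus>\<^bsub>M\<^esub> x)"]) (auto simp: coset_add coset_closed M.l_neg)
  qed (auto simp: z carrier_quot coset_add M.a_ac)
qed (auto simp: carrier_quot coset_smult coset_add M.smult_l_distr M.smult_r_distr M.smult_assoc1)

text \<open>The representative picked by \<open>SOME\<close> differs from x by an element of S,
  which f kills.\<close>

lemma quot_some_rep:
  assumes "module R P" "f \<in> lin_maps R M P" "\<And>s. s \<in> S \<Longrightarrow> f s = \<zero>\<^bsub>P\<^esub>" "x \<in> carrier M"
  shows "f (SOME u. u \<in> S +>\<^bsub>M\<^esub> x) = f x"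
proof -
  interpret P: module R P by fact
  have "x \<in> S +>\<^bsub>M\<^esub> x" using assms by (simp add: S.a_rcos_self)
  then have "(SOME u. u \<in> S +>\<^bsub>M\<^esub> x) \<in> S +>\<^bsub>M\<^esub> x" by (rule someI)
  from coset_mem[OF assms(4) this] obtain s where s: "s \<in> S" "(SOME u. u \<in> S +>\<^bsub>M\<^esub> x) = s \<oplus>\<^bsub>M\<^esub> x"
    by auto
  then show ?thesis
    using assms lin_maps_closed[OF assms(2)] by (simp add: lin_maps_add[OF assms(2)])
qed

lemma quot_some_closed:
  assumes "t \<in> carrier Q"
  shows "(SOME u. u \<in> t) \<in> carrier M" "t = S +>\<^bsub>M\<^esub> (SOME u. u \<in> t)"
proof -
  obtain x where x: "x \<in> carrier M" "t = S +>\<^bsub>M\<^esub> x" using assms by (auto simp: carrier_quot)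
  then have "x \<in> t" by (simp add: S.a_rcos_self)
  then have u: "(SOME u. u \<in> t) \<in> t" by (rule someI)
  then show "(SOME u. u \<in> t) \<in> carrier M" using coset_mem x by auto
  show "t = S +>\<^bsub>M\<^esub> (SOME u. u \<in> t)"
    using S.a_repr_independence'[of _ x] x u by auto
qed

lemma quot_lift_lin:
  assumes "module R P" "f \<in> lin_maps R M P" "\<And>s. s \<in> S \<Longrightarrow> f s = \<zero>\<^bsub>P\<^esub>"
  shows "(\<lambda>t. f (SOME u. u \<in> t)) \<in> lin_maps R Q P"
  by (rule lin_mapsI)
    (auto simp: carrier_quot coset_smult coset_add quot_some_rep[OF assms] lin_maps_closed[OF assms(2)]
      lin_maps_add[OF assms(2)] lin_maps_smult[OF assms(2)])

end


section \<open>Free modules\<close>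

lemma carrier_free_module: "f \<in> carrier (free_module R X) \<longleftrightarrow>
    (\<forall>x. f x \<in> carrier R) \<and> {x. f x \<noteq> \<zero>\<^bsub>R\<^esub>} \<subseteq> X \<and> finite {x. f x \<noteq> \<zero>\<^bsub>R\<^esub>}"
  by (auto simp: free_module_def)

lemma free_module_sel:
  "\<zero>\<^bsub>free_module R X\<^esub> = (\<lambda>x. \<zero>\<^bsub>R\<^esub>)"
  "f \<oplus>\<^bsub>free_module R X\<^esub> g = (\<lambda>x. f x \<oplus>\<^bsub>R\<^esub> g x)"
  "r \<odot>\<^bsub>free_module R X\<^esub> f = (\<lambda>x. r \<otimes>\<^bsub>R\<^esub> f x)"
  by (auto simp: free_module_def)

lemma free_module_closed:
  assumes "cring R"
  shows "f \<in> carrier (free_module R X) \<Longrightarrow> g \<in> carrier (free_module R X)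
      \<Longrightarrow> (\<lambda>x. f x \<oplus>\<^bsub>R\<^esub> g x) \<in> carrier (free_module R X)"
    and "f \<in> carrier (free_module R X) \<Longrightarrow> r \<in> carrier R
      \<Longrightarrow> (\<lambda>x. r \<otimes>\<^bsub>R\<^esub> f x) \<in> carrier (free_module R X)"
proof -
  interpret cring R by fact
  assume f: "f \<in> carrier (free_module R X)"
  show "(\<lambda>x. f x \<oplus>\<^bsub>R\<^esub> g x) \<in> carrier (free_module R X)" if g: "g \<in> carrier (free_module R X)"
  proof -
    have "finite {x. f x \<oplus>\<^bsub>R\<^esub> g x \<noteq> \<zero>\<^bsub>R\<^esub>}"
      by (rule finite_subset[of _ "{x. f x \<noteq> \<zero>\<^bsub>R\<^esub>} \<union> {x. g x \<noteq> \<zero>\<^bsub>R\<^esub>}"])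
        (use f g in \<open>auto simp: carrier_free_module\<close>)
    then show ?thesis using f g by (auto simp: free_module_def)
  qed
  show "(\<lambda>x. r \<otimes>\<^bsub>R\<^esub> f x) \<in> carrier (free_module R X)" if r: "r \<in> carrier R"
  proof -
    have "finite {x. r \<otimes>\<^bsub>R\<^esub> f x \<noteq> \<zero>\<^bsub>R\<^esub>}"
      by (rule finite_subset[of _ "{x. f x \<noteq> \<zero>\<^bsub>R\<^esub>}"]) (use f r in \<open>auto simp: carrier_free_module\<close>)
    then show ?thesis using f r by (auto simp: free_module_def)
  qed
qed

lemma module_free_module:
  assumes "cring R"
  shows "module R (free_module R X)"
proof -
  interpret cring R by fact
  have inv: "\<exists>g\<in>carrier (free_module R X). g \<oplus>\<^bsub>free_module R X\<^esub> f = \<zero>\<^bsub>free_module R X\<^esub>"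
    if f: "f \<in> carrier (free_module R X)" for f
  proof
    have "\<ominus>\<^bsub>R\<^esub> \<one>\<^bsub>R\<^esub> \<otimes>\<^bsub>R\<^esub> f x \<oplus>\<^bsub>R\<^esub> f x = \<zero>\<^bsub>R\<^esub>" for x
      using f by (simp add: carrier_free_module l_minus l_neg)
    then show "(\<lambda>x. \<ominus>\<^bsub>R\<^esub> \<one>\<^bsub>R\<^esub> \<otimes>\<^bsub>R\<^esub> f x) \<oplus>\<^bsub>free_module R X\<^esub> f = \<zero>\<^bsub>free_module R X\<^esub>"
      by (simp add: free_module_sel)
  qed (use f in \<open>simp add: free_module_closed assms\<close>)
  have cl: "f x \<in> carrier R" if "f \<in> carrier (free_module R X)" for f x
    using that by (simp add: carrier_free_module)
  have "abelian_group (free_module R X)"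
  proof (rule abelian_groupI)
    show "\<zero>\<^bsub>free_module R X\<^esub> \<in> carrier (free_module R X)"
      by (simp add: carrier_free_module free_module_sel)
  qed (use inv cl in \<open>auto simp: free_module_closed assms free_module_sel a_ac\<close>)
  then show ?thesis
    by (intro moduleI)
      (use cl in \<open>auto simp: free_module_closed assms free_module_sel l_distr r_distr m_assoc\<close>)
qed

lemma free_gen_closed: "\<lbrakk>cring R; x \<in> X\<rbrakk> \<Longrightarrow> free_gen R x \<in> carrier (free_module R X)"
proof -
  assume "cring R" "x \<in> X"
  interpret cring R by fact
  have "finite {y. free_gen R x y \<noteq> \<zero>\<^bsub>R\<^esub>}"
    by (rule finite_subset[of _ "{x}"]) (auto simp: free_gen_def)
  then show ?thesis using \<open>x \<in> X\<close> by (auto simp: carrier_free_module free_gen_def)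
qed

text \<open>The linear extension given by the universal property of the free module;
  \<open>sweedler\<close> is this map at a chosen representative.\<close>

definition free_lift ::
  "('k,'r) ring_scheme \<Rightarrow> ('k,'p,'z) module_scheme \<Rightarrow> ('x \<Rightarrow> 'p) \<Rightarrow> ('x \<Rightarrow> 'k) \<Rightarrow> 'p"
  where "free_lift R P f u = (\<Oplus>\<^bsub>P\<^esub>p\<in>{p. u p \<noteq> \<zero>\<^bsub>R\<^esub>}. u p \<odot>\<^bsub>P\<^esub> f p)"

text \<open>Summands off the support vanish. Additivity relies on this: u, v and their sum have
  different supports and must be summed over one common set.\<close>

lemma free_lift_support:
  assumes "module R P" "u \<in> carrier (free_module R X)" "f \<in> X \<rightarrow> carrier P"
    "{p. u p \<noteq> \<zero>\<^bsub>R\<^esub>} \<subseteq> A" "finite A" "A \<subseteq> X"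
  shows "free_lift R P f u = (\<Oplus>\<^bsub>P\<^esub>p\<in>A. u p \<odot>\<^bsub>P\<^esub> f p)"
proof -
  interpret P: module R P by fact
  show ?thesis unfolding free_lift_def
    proof (rule P.add.finprod_mono_neutral_cong_left)
    have "f x \<in> carrier P" if "x \<in> A" for x using that assms by auto
    then show "\<And>i. i \<in> A - {p. u p \<noteq> \<zero>\<^bsub>R\<^esub>} \<Longrightarrow> u i \<odot>\<^bsub>P\<^esub> f i = \<zero>\<^bsub>P\<^esub>"
      "(\<lambda>p. u p \<odot>\<^bsub>P\<^esub> f p) \<in> A \<rightarrow> carrier P"
      using assms by (auto simp: carrier_free_module)
  qed (use assms in auto)
qed

lemma free_lift_lin:
  assumes "module R P" "f \<in> X \<rightarrow> carrier P"
  shows "free_lift R P f \<in> lin_maps R (free_module R X) P"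
proof -
  interpret P: module R P by fact
  note sup = free_lift_support[OF assms(1) _ assms(2)]
  show ?thesis
  proof (rule lin_mapsI)
    fix u assume u: "u \<in> carrier (free_module R X)"
    show "free_lift R P f u \<in> carrier P" unfolding free_lift_def
      by (rule P.finsum_closed) (use u assms in \<open>auto simp: carrier_free_module\<close>)
    fix r assume r: "r \<in> carrier R"
    let ?A = "{p. u p \<noteq> \<zero>\<^bsub>R\<^esub>}"
    have A: "finite ?A" "?A \<subseteq> X" and uR: "\<And>x. u x \<in> carrier R"
      using u by (auto simp: carrier_free_module)
    have "free_lift R P f (\<lambda>x. r \<otimes>\<^bsub>R\<^esub> u x) = (\<Oplus>\<^bsub>P\<^esub>p\<in>?A. (r \<otimes>\<^bsub>R\<^esub> u p) \<odot>\<^bsub>P\<^esub> f p)"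
      by (rule sup) (use A r u in \<open>auto simp: free_module_closed P.is_cring\<close>)
    also have "\<dots> = (\<Oplus>\<^bsub>P\<^esub>p\<in>?A. r \<odot>\<^bsub>P\<^esub> (u p \<odot>\<^bsub>P\<^esub> f p))"
      by (rule P.finsum_cong') (use A r uR assms in \<open>auto simp: P.smult_assoc1 Pi_iff subset_iff\<close>)
    also have "\<dots> = r \<odot>\<^bsub>P\<^esub> free_lift R P f u" unfolding free_lift_def
      by (rule P.finsum_smult_ldistr[symmetric]) (use A r uR assms in auto)
    finally show "free_lift R P f (r \<odot>\<^bsub>free_module R X\<^esub> u) = r \<odot>\<^bsub>P\<^esub> free_lift R P f u"
      by (simp add: free_module_sel)
  next
    fix u v assume u: "u \<in> carrier (free_module R X)" and v: "v \<in> carrier (free_module R X)"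
    let ?A = "{p. u p \<noteq> \<zero>\<^bsub>R\<^esub>} \<union> {p. v p \<noteq> \<zero>\<^bsub>R\<^esub>}"
    have A: "finite ?A" "?A \<subseteq> X" and uR: "\<And>x. u x \<in> carrier R" "\<And>x. v x \<in> carrier R"
      using u v by (auto simp: carrier_free_module)
    have fP: "\<And>x. x \<in> ?A \<Longrightarrow> f x \<in> carrier P" using A assms(2) by auto
    have "free_lift R P f (\<lambda>x. u x \<oplus>\<^bsub>R\<^esub> v x) = (\<Oplus>\<^bsub>P\<^esub>p\<in>?A. (u p \<oplus>\<^bsub>R\<^esub> v p) \<odot>\<^bsub>P\<^esub> f p)"
      by (rule sup) (use A u v in \<open>auto simp: free_module_closed P.is_cring\<close>)
    also have "\<dots> = (\<Oplus>\<^bsub>P\<^esub>p\<in>?A. (u p \<odot>\<^bsub>P\<^esub> f p) \<oplus>\<^bsub>P\<^esub> (v p \<odot>\<^bsub>P\<^esub> f p))"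
      by (rule P.finsum_cong') (use uR fP in \<open>auto simp: P.smult_l_distr\<close>)
    also have "\<dots> = (\<Oplus>\<^bsub>P\<^esub>p\<in>?A. u p \<odot>\<^bsub>P\<^esub> f p) \<oplus>\<^bsub>P\<^esub> (\<Oplus>\<^bsub>P\<^esub>p\<in>?A. v p \<odot>\<^bsub>P\<^esub> f p)"
      by (rule P.finsum_addf) (use uR fP in auto)
    also have "(\<Oplus>\<^bsub>P\<^esub>p\<in>?A. u p \<odot>\<^bsub>P\<^esub> f p) = free_lift R P f u"
      by (rule sup[symmetric]) (use A u in auto)
    also have "(\<Oplus>\<^bsub>P\<^esub>p\<in>?A. v p \<odot>\<^bsub>P\<^esub> f p) = free_lift R P f v"
      by (rule sup[symmetric]) (use A v in auto)
    finally show "free_lift R P f (u \<oplus>\<^bsub>free_module R X\<^esub> v) = free_lift R P f u \<oplus>\<^bsub>P\<^esub> free_lift R P f v"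
      by (simp add: free_module_sel)
  qed
qed

lemma free_lift_gen:
  assumes "module R P" "f x \<in> carrier P"
  shows "free_lift R P f (free_gen R x) = f x"
proof -
  interpret P: module R P by fact
  show ?thesis
  proof (cases "\<one>\<^bsub>R\<^esub> = \<zero>\<^bsub>R\<^esub>")
    \<comment> \<open>In the zero ring a generator has empty support and the sum is zero. The claim
      survives because one = zero forces every module element to be zero.\<close>
    case True
    then have "f x = \<zero>\<^bsub>P\<^esub>" using P.smult_one[OF assms(2)] assms(2) by simp
    then show ?thesis using True by (simp add: free_lift_def free_gen_def)
  next
    case False
    then have "{p. free_gen R x p \<noteq> \<zero>\<^bsub>R\<^esub>} = {x}" by (auto simp: free_gen_def)
    then show ?thesis using assms by (simp add: free_lift_def free_gen_def)
  qed
qed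

lemma free_module_ext:
  assumes "module R P" "f \<in> lin_maps R (free_module R X) P" "g \<in> lin_maps R (free_module R X) P"
    "\<And>x. x \<in> X \<Longrightarrow> f (free_gen R x) = g (free_gen R x)" "u \<in> carrier (free_module R X)"
  shows "f u = g u"
proof -
  interpret P: module R P by fact
  interpret F: module R "free_module R X" by (rule module_free_module[OF P.is_cring])
  have "f u = g u" if "finite A" "A \<subseteq> X" "u \<in> carrier (free_module R X)" "{x. u x \<noteq> \<zero>\<^bsub>R\<^esub>} \<subseteq> A" for A u
    using that
  proof (induction A arbitrary: u rule: finite_induct)
    case empty
    then have "u = \<zero>\<^bsub>free_module R X\<^esub>" by (auto simp: free_module_sel)
    then show ?case
      using lin_maps_zero[OF assms(2) F.module_axioms assms(1)] lin_maps_zero[OF assms(3) F.module_axioms assms(1)] by simp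
  next
    case (insert x A)
    \<comment> \<open>Clearing the entry at x leaves support inside \<open>A\<close>, where the
      induction hypothesis applies; what was removed is a multiple of a single generator.\<close>
    let ?v = "\<lambda>y. if y = x then \<zero>\<^bsub>R\<^esub> else u y"
    have uR: "u y \<in> carrier R" for y using insert.prems by (auto simp: carrier_free_module)
    have v: "?v \<in> carrier (free_module R X)"
      using insert.prems(2) by (auto simp: carrier_free_module elim!: finite_subset[rotated])
    have g: "free_gen R x \<in> carrier (free_module R X)"
      using insert.prems by (intro free_gen_closed P.is_cring) auto
    have "u = ?v \<oplus>\<^bsub>free_module R X\<^esub> (u x \<odot>\<^bsub>free_module R X\<^esub> free_gen R x)"
      by (rule ext) (auto simp: free_module_sel free_gen_def uR)
    moreover have "f ?v = g ?v" by (rule insert.IH) (use insert.prems v in auto)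
    moreover have "f (free_gen R x) = g (free_gen R x)" using insert.prems assms(4) by auto
    moreover have "u x \<odot>\<^bsub>free_module R X\<^esub> free_gen R x \<in> carrier (free_module R X)"
      using g uR by simp
    moreover have "f (?v \<oplus>\<^bsub>free_module R X\<^esub> (u x \<odot>\<^bsub>free_module R X\<^esub> free_gen R x))
        = f ?v \<oplus>\<^bsub>P\<^esub> u x \<odot>\<^bsub>P\<^esub> f (free_gen R x)"
      using lin_maps_add[OF assms(2)] lin_maps_smult[OF assms(2)] v g uR by simp
    moreover have "g (?v \<oplus>\<^bsub>free_module R X\<^esub> (u x \<odot>\<^bsub>free_module R X\<^esub> free_gen R x))
        = g ?v \<oplus>\<^bsub>P\<^esub> u x \<odot>\<^bsub>P\<^esub> g (free_gen R x)"
      using lin_maps_add[OF assms(3)] lin_maps_smult[OF assms(3)] v g uR by simp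
    ultimately show ?case by metis
  qed
  from this[of "{x. u x \<noteq> \<zero>\<^bsub>R\<^esub>}" u] assms(5) show ?thesis by (auto simp: carrier_free_module)
qed

section \<open>Tensor products\<close>

lemma bilin_mapsI [simp]:
  assumes "\<And>x. x \<in> carrier M \<Longrightarrow> (\<lambda>y. f x y) \<in> lin_maps R N P"
    and "\<And>y. y \<in> carrier N \<Longrightarrow> (\<lambda>x. f x y) \<in> lin_maps R M P"
  shows "f \<in> bilin_maps R M N P"
  using assms by (simp add: bilin_maps_def)

lemma bilin_mapsD1: "\<lbrakk>f \<in> bilin_maps R M N P; x \<in> carrier M\<rbrakk> \<Longrightarrow> f x \<in> lin_maps R N P"
  by (simp add: bilin_maps_def)

lemma bilin_mapsD2: "\<lbrakk>f \<in> bilin_maps R M N P; y \<in> carrier N\<rbrakk> \<Longrightarrow> (\<lambda>x. f x y) \<in> lin_maps R M P"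
  by (simp add: bilin_maps_def)

lemma bilin_maps_closed:
  "\<lbrakk>f \<in> bilin_maps R M N P; x \<in> carrier M; y \<in> carrier N\<rbrakk> \<Longrightarrow> f x y \<in> carrier P"
  by (blast dest: bilin_mapsD1 lin_maps_closed)

context
  fixes R :: "('k,'r) ring_scheme"
    and M :: "('k,'m,'x) module_scheme" and N :: "('k,'n,'y) module_scheme"
  assumes M: "module R M" and N: "module R N"
begin

interpretation M: module R M by (rule M)
interpretation N: module R N by (rule N)

private abbreviation (input) "F \<equiv> free_module R (carrier M \<times> carrier N)"

interpretation F: module R F by (rule module_free_module[OF M.is_cring])

lemma tensor_gen_closed: "\<lbrakk>x \<in> carrier M; y \<in> carrier N\<rbrakk> \<Longrightarrow> free_gen R (x, y) \<in> carrier F"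
  by (rule free_gen_closed[OF M.is_cring]) simp

lemma tensor_rels_closed: "tensor_rels R M N \<subseteq> carrier F"
  by (auto simp: tensor_rels_def Let_def tensor_gen_closed)

lemma tensor_relsI:
  "\<lbrakk>x \<in> carrier M; x' \<in> carrier M; y \<in> carrier N\<rbrakk> \<Longrightarrow>
    free_gen R (x \<oplus>\<^bsub>M\<^esub> x', y) \<ominus>\<^bsub>F\<^esub> (free_gen R (x, y) \<oplus>\<^bsub>F\<^esub> free_gen R (x', y)) \<in> tensor_rels R M N"
  "\<lbrakk>x \<in> carrier M; y \<in> carrier N; y' \<in> carrier N\<rbrakk> \<Longrightarrow>
    free_gen R (x, y \<oplus>\<^bsub>N\<^esub> y') \<ominus>\<^bsub>F\<^esub> (free_gen R (x, y) \<oplus>\<^bsub>F\<^esub> free_gen R (x, y')) \<in> tensor_rels R M N"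
  "\<lbrakk>r \<in> carrier R; x \<in> carrier M; y \<in> carrier N\<rbrakk> \<Longrightarrow>
    free_gen R (r \<odot>\<^bsub>M\<^esub> x, y) \<ominus>\<^bsub>F\<^esub> r \<odot>\<^bsub>F\<^esub> free_gen R (x, y) \<in> tensor_rels R M N"
  "\<lbrakk>r \<in> carrier R; x \<in> carrier M; y \<in> carrier N\<rbrakk> \<Longrightarrow>
    free_gen R (x, r \<odot>\<^bsub>N\<^esub> y) \<ominus>\<^bsub>F\<^esub> r \<odot>\<^bsub>F\<^esub> free_gen R (x, y) \<in> tensor_rels R M N"
  unfolding tensor_rels_def Let_def by blast+

lemma tensor_relsE:
  assumes "w \<in> tensor_rels R M N"
  obtains (add1) x x' y where "x \<in> carrier M" "x' \<in> carrier M" "y \<in> carrier N"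
      "w = free_gen R (x \<oplus>\<^bsub>M\<^esub> x', y) \<ominus>\<^bsub>F\<^esub> (free_gen R (x, y) \<oplus>\<^bsub>F\<^esub> free_gen R (x', y))"
    | (add2) x y y' where "x \<in> carrier M" "y \<in> carrier N" "y' \<in> carrier N"
      "w = free_gen R (x, y \<oplus>\<^bsub>N\<^esub> y') \<ominus>\<^bsub>F\<^esub> (free_gen R (x, y) \<oplus>\<^bsub>F\<^esub> free_gen R (x, y'))"
    | (smult1) r x y where "r \<in> carrier R" "x \<in> carrier M" "y \<in> carrier N"
      "w = free_gen R (r \<odot>\<^bsub>M\<^esub> x, y) \<ominus>\<^bsub>F\<^esub> r \<odot>\<^bsub>F\<^esub> free_gen R (x, y)"
    | (smult2) r x y where "r \<in> carrier R" "x \<in> carrier M" "y \<in> carrier N"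
      "w = free_gen R (x, r \<odot>\<^bsub>N\<^esub> y) \<ominus>\<^bsub>F\<^esub> r \<odot>\<^bsub>F\<^esub> free_gen R (x, y)"
  using assms unfolding tensor_rels_def Let_def
  by (elim UnE CollectE exE conjE) ((rule that; assumption)+)

lemma tensor_ker_submodule: "submodule (tensor_ker R M N) R F"
  unfolding tensor_ker_def by (rule gen_submodule_submodule[OF F.module_axioms tensor_rels_closed])

interpretation quot_mod R F "tensor_ker R M N"
  by (rule quot_mod.intro[OF F.module_axioms tensor_ker_submodule])

lemma module_tensor [simp]: "module R (tensor R M N)"
  unfolding tensor_def by (rule module_quot)

lemma tens_bilin: "tens R M N \<in> bilin_maps R M N (tensor R M N)"
proof -
  note d = tens_def[of R M N] tensor_def[of R M N]
  note g = tensor_gen_closed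
  have rel: "w \<in> tensor_ker R M N" if "w \<in> tensor_rels R M N" for w
    unfolding tensor_ker_def by (rule subsetD[OF gen_submodule_subset that])
  have eq: "tensor_ker R M N +>\<^bsub>F\<^esub> w = tensor_ker R M N +>\<^bsub>F\<^esub> w'"
    if "w \<ominus>\<^bsub>F\<^esub> w' \<in> tensor_rels R M N" "w \<in> carrier F" "w' \<in> carrier F" for w w'
    by (rule coset_eqI) (use that rel in auto)
  show ?thesis
  proof (rule bilin_mapsI; rule lin_mapsI)
    fix x y assume "x \<in> carrier M" "y \<in> carrier N"
    then show "tens R M N x y \<in> carrier (tensor R M N)" "tens R M N x y \<in> carrier (tensor R M N)"
      by (auto simp: d g coset_closed)
  next
    fix x y y' assume *: "x \<in> carrier M" "y \<in> carrier N" "y' \<in> carrier N"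
    have "tensor_ker R M N +>\<^bsub>F\<^esub> free_gen R (x, y \<oplus>\<^bsub>N\<^esub> y')
        = tensor_ker R M N +>\<^bsub>F\<^esub> (free_gen R (x, y) \<oplus>\<^bsub>F\<^esub> free_gen R (x, y'))"
      by (rule eq) (use * in \<open>simp_all add: tensor_relsI g\<close>)
    then show "tens R M N x (y \<oplus>\<^bsub>N\<^esub> y') = tens R M N x y \<oplus>\<^bsub>tensor R M N\<^esub> tens R M N x y'"
      using * by (simp add: d g coset_add)
  next
    fix r x y assume *: "r \<in> carrier R" "x \<in> carrier M" "y \<in> carrier N"
    have "tensor_ker R M N +>\<^bsub>F\<^esub> free_gen R (x, r \<odot>\<^bsub>N\<^esub> y)
        = tensor_ker R M N +>\<^bsub>F\<^esub> (r \<odot>\<^bsub>F\<^esub> free_gen R (x, y))"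
      by (rule eq) (use * in \<open>simp_all add: tensor_relsI g\<close>)
    then show "tens R M N x (r \<odot>\<^bsub>N\<^esub> y) = r \<odot>\<^bsub>tensor R M N\<^esub> tens R M N x y"
      using * by (simp add: d g coset_smult)
    have "tensor_ker R M N +>\<^bsub>F\<^esub> free_gen R (r \<odot>\<^bsub>M\<^esub> x, y)
        = tensor_ker R M N +>\<^bsub>F\<^esub> (r \<odot>\<^bsub>F\<^esub> free_gen R (x, y))"
      by (rule eq) (use * in \<open>simp_all add: tensor_relsI g\<close>)
    then show "tens R M N (r \<odot>\<^bsub>M\<^esub> x) y = r \<odot>\<^bsub>tensor R M N\<^esub> tens R M N x y"
      using * by (simp add: d g coset_smult)
  next
    fix x x' y assume *: "x \<in> carrier M" "x' \<in> carrier M" "y \<in> carrier N"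
    have "tensor_ker R M N +>\<^bsub>F\<^esub> free_gen R (x \<oplus>\<^bsub>M\<^esub> x', y)
        = tensor_ker R M N +>\<^bsub>F\<^esub> (free_gen R (x, y) \<oplus>\<^bsub>F\<^esub> free_gen R (x', y))"
      by (rule eq) (use * in \<open>simp_all add: tensor_relsI g\<close>)
    then show "tens R M N (x \<oplus>\<^bsub>M\<^esub> x') y = tens R M N x y \<oplus>\<^bsub>tensor R M N\<^esub> tens R M N x' y"
      using * by (simp add: d g coset_add)
  qed
qed

lemma tens_closed [simp]:
  "\<lbrakk>x \<in> carrier M; y \<in> carrier N\<rbrakk> \<Longrightarrow> tens R M N x y \<in> carrier (tensor R M N)"
  by (rule bilin_maps_closed[OF tens_bilin])

text \<open>Composing with the coset map gives two linear maps on the free module that agree on its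
  generators.\<close>

lemma tensor_ext:
  assumes "module R P" "f \<in> lin_maps R (tensor R M N) P" "g \<in> lin_maps R (tensor R M N) P"
    "\<And>x y. \<lbrakk>x \<in> carrier M; y \<in> carrier N\<rbrakk> \<Longrightarrow> f (tens R M N x y) = g (tens R M N x y)"
    "t \<in> carrier (tensor R M N)"
  shows "f t = g t"
proof -
  obtain u where u: "u \<in> carrier F" "t = tensor_ker R M N +>\<^bsub>F\<^esub> u"
    using assms(5) by (auto simp: tensor_def carrier_quot)
  have "f (tensor_ker R M N +>\<^bsub>F\<^esub> u) = g (tensor_ker R M N +>\<^bsub>F\<^esub> u)"
    by (rule free_module_ext[OF assms(1) _ _ _ u(1)])
      (use assms(2-4) lin_maps_comp[OF _ coset_lin] in \<open>auto simp: tens_def tensor_def\<close>)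
  then show ?thesis using u by simp
qed

text \<open>The four families of relations mirror additivity and homogeneity of f in each argument,
  so each relation goes to a difference of equal elements.\<close>

lemma free_lift_tensor_ker:
  assumes P: "module R P" and f: "f \<in> bilin_maps R M N P" and "u \<in> tensor_ker R M N"
  shows "free_lift R P (\<lambda>p. f (fst p) (snd p)) u = \<zero>\<^bsub>P\<^esub>"
proof -
  interpret P: module R P by fact
  let ?L = "free_lift R P (\<lambda>p. f (fst p) (snd p))"
  have L: "?L \<in> lin_maps R F P"
    by (rule free_lift_lin) (use P bilin_maps_closed[OF f] in auto)
  have gen: "?L (free_gen R (x, y)) = f x y" if "x \<in> carrier M" "y \<in> carrier N" for x y
    using free_lift_gen[OF P, of "\<lambda>p. f (fst p) (snd p)" "(x, y)"] that bilin_maps_closed[OF f] by simp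
  note L' = lin_maps_minus[OF L F.module_axioms P] lin_maps_add[OF L] lin_maps_smult[OF L]
  have fx: "f x y \<in> carrier P" if "x \<in> carrier M" "y \<in> carrier N" for x y
    by (rule bilin_maps_closed[OF f that])
  have f1: "f (x \<oplus>\<^bsub>M\<^esub> x') y = f x y \<oplus>\<^bsub>P\<^esub> f x' y" if "x \<in> carrier M" "x' \<in> carrier M" "y \<in> carrier N" for x x' y
    by (rule lin_maps_add[OF bilin_mapsD2[OF f that(3)] that(1,2)])
  have f2: "f (r \<odot>\<^bsub>M\<^esub> x) y = r \<odot>\<^bsub>P\<^esub> f x y" if "x \<in> carrier M" "r \<in> carrier R" "y \<in> carrier N" for x r y
    by (rule lin_maps_smult[OF bilin_mapsD2[OF f that(3)] that(2,1)])
  have f3: "f x (y \<oplus>\<^bsub>N\<^esub> y') = f x y \<oplus>\<^bsub>P\<^esub> f x y'" if "x \<in> carrier M" "y' \<in> carrier N" "y \<in> carrier N" for x y y'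
    by (rule lin_maps_add[OF bilin_mapsD1[OF f that(1)] that(3,2)])
  have f4: "f x (r \<odot>\<^bsub>N\<^esub> y) = r \<odot>\<^bsub>P\<^esub> f x y" if "x \<in> carrier M" "r \<in> carrier R" "y \<in> carrier N" for x r y
    by (rule lin_maps_smult[OF bilin_mapsD1[OF f that(1)] that(2,3)])
  note f' = fx f1 f2 f3 f4
  have z: "w \<ominus>\<^bsub>P\<^esub> w = \<zero>\<^bsub>P\<^esub>" if "w \<in> carrier P" for w
    using that by (simp add: a_minus_def P.r_neg)
  have "w \<in> carrier F \<and> ?L w = \<zero>\<^bsub>P\<^esub>" if w: "w \<in> tensor_rels R M N" for w
  proof
    show "w \<in> carrier F" using w tensor_rels_closed by auto
    from w show "?L w = \<zero>\<^bsub>P\<^esub>"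
      by (cases w rule: tensor_relsE) (simp_all add: L' tensor_gen_closed gen f' z)
  qed
  from lin_maps_gen_submodule[OF F.module_axioms P L this] assms(3) show ?thesis
    by (simp add: tensor_ker_def)
qed

lemma sweedler_free_lift:
  "sweedler R P t f = free_lift R P (\<lambda>p. f (fst p) (snd p)) (SOME u. u \<in> t)"
  by (simp add: sweedler_def free_lift_def Let_def)

lemma sweedler_lin:
  assumes "module R P" "f \<in> bilin_maps R M N P"
  shows "(\<lambda>t. sweedler R P t f) \<in> lin_maps R (tensor R M N) P"
  unfolding sweedler_free_lift tensor_def
  by (rule quot_lift_lin[OF assms(1) free_lift_lin[OF assms(1)] free_lift_tensor_ker[OF assms]])
    (use bilin_maps_closed[OF assms(2)] in auto)

lemma sweedler_tens:
  assumes "module R P" "f \<in> bilin_maps R M N P" "x \<in> carrier M" "y \<in> carrier N"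
  shows "sweedler R P (tens R M N x y) f = f x y"
proof -
  have "sweedler R P (tens R M N x y) f = free_lift R P (\<lambda>p. f (fst p) (snd p)) (free_gen R (x, y))"
    unfolding sweedler_free_lift tens_def
    by (rule quot_some_rep[OF assms(1) free_lift_lin[OF assms(1)] free_lift_tensor_ker[OF assms(1,2)]])
      (use bilin_maps_closed[OF assms(2)] tensor_gen_closed assms(3,4) in auto)
  then show ?thesis
    using free_lift_gen[OF assms(1), of "\<lambda>p. f (fst p) (snd p)" "(x, y)"]
      bilin_maps_closed[OF assms(2-4)] by simp
qed

lemma tensor_some_rep:
  assumes "t \<in> carrier (tensor R M N)"
  defines "u \<equiv> SOME u. u \<in> t"
  shows "finite {p. u p \<noteq> \<zero>\<^bsub>R\<^esub>}" "u p \<in> carrier R" "{p. u p \<noteq> \<zero>\<^bsub>R\<^esub>} \<subseteq> carrier M \<times> carrier N"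
  using quot_some_closed(1)[of t] assms unfolding tensor_def carrier_free_module by blast+

end

section \<open>Calculus of Sweedler sums\<close>

lemma tensor_ext_ball:
  assumes "module R M" "module R N" "module R P"
    "f \<in> lin_maps R (tensor R M N) P" "g \<in> lin_maps R (tensor R M N) P"
    "\<And>x y. \<lbrakk>x \<in> carrier M; y \<in> carrier N\<rbrakk> \<Longrightarrow> f (tens R M N x y) = g (tens R M N x y)"
  shows "\<forall>t\<in>carrier (tensor R M N). f t = g t"
  using tensor_ext[OF assms] by blast

lemma foldSetD_cong:
  assumes "(B, y) \<in> foldSetD D f e" "\<And>x. x \<in> B \<Longrightarrow> f x = g x"
  shows "(B, y) \<in> foldSetD D g e"
  using assms
proof (induction rule: foldSetD.induct)
  case (insertI x B y)
  have "(insert x B, g x y) \<in> foldSetD D g e"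
    by (rule foldSetD.insertI) (use insertI in auto)
  then show ?case using insertI.prems by simp
qed (rule foldSetD.emptyI)

text \<open>The fold relation evaluates f only on A, so both sums are definite descriptions of the
  same predicate. This also covers summands whose values may leave the carrier.\<close>

lemma finsum_pure_cong:
  assumes "\<And>x. x \<in> A \<Longrightarrow> f x = g x"
  shows "finsum P f A = finsum P g A"
proof -
  have "(A, y) \<in> foldSetD (carrier P) (mult (add_monoid P) \<circ> f) e
      \<longleftrightarrow> (A, y) \<in> foldSetD (carrier P) (mult (add_monoid P) \<circ> g) e" for y e
    by (rule iffI; erule foldSetD_cong) (simp_all add: assms)
  then show ?thesis by (simp add: finsum_def finprod_def foldD_def)
qed

text \<open>A version of \<^const>\<open>sweedler\<close> that records the factors of the tensor product. They make
  the rewrite rules below determined by their left hand sides, and they make available, by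
  congruence, that the components lie in the carriers.\<close>

definition sw :: "('k,'r) ring_scheme \<Rightarrow> ('k,'m,'x) module_scheme \<Rightarrow> ('k,'n,'y) module_scheme \<Rightarrow>
    ('k,'p,'z) module_scheme \<Rightarrow> ('k,'m,'n) tens \<Rightarrow> ('m \<Rightarrow> 'n \<Rightarrow> 'p) \<Rightarrow> 'p"
  where "sw R M N P t f =
    sweedler R P t (\<lambda>x y. if x \<in> carrier M \<and> y \<in> carrier N then f x y else \<zero>\<^bsub>P\<^esub>)"

text \<open>Valid for every t and f, since the cut-off to zero outside the carriers makes the two
  functions passed to \<open>sweedler\<close> equal everywhere.\<close>

lemma sw_cong [cong]:
  assumes "t = t'" "\<And>x y. \<lbrakk>x \<in> carrier M; y \<in> carrier N\<rbrakk> \<Longrightarrow> f x y = g x y"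
  shows "sw R M N P t f = sw R M N P t' g"
  unfolding sw_def using assms by (intro arg_cong2[of _ _ _ _ "sweedler R P"] ext) auto

text \<open>The chosen representative of t is supported on pairs from the carriers, so the cut-off
  in \<open>sw\<close> changes no summand, whatever f is.\<close>

lemma sweedler_sw:
  assumes "t \<in> carrier (tensor R M N)" "module R M" "module R N"
  shows "sweedler R P t f = sw R M N P t f"
  unfolding sw_def sweedler_def Let_def
  by (intro finsum_pure_cong) (use tensor_some_rep[OF assms(2,3,1)] in auto)

lemma sw_lin1 [simp]:
  assumes "module R M" "module R N" "module R P" "module R Z" "g \<in> lin_maps R Z (tensor R M N)"
    "f \<in> bilin_maps R M N P"
  shows "(\<lambda>z. sw R M N P (g z) f) \<in> lin_maps R Z P"
proof -
  have "(\<lambda>z. sweedler R P (g z) f) \<in> lin_maps R Z P"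
    using lin_maps_comp[OF sweedler_lin[OF assms(1-3,6)] assms(5)] .
  moreover have "sweedler R P (g z) f = sw R M N P (g z) f" if "z \<in> carrier Z" for z
    using sweedler_sw[OF lin_maps_closed[OF assms(5) that] assms(1,2)] .
  ultimately show ?thesis
    by (rule iffD1[OF lin_maps_cong[OF _ assms(4)], rotated])
qed

lemma sw_tens [simp]:
  assumes "module R M" "module R N" "module R P" "x \<in> carrier M" "y \<in> carrier N" "f \<in> bilin_maps R M N P"
  shows "sw R M N P (tens R M N x y) f = f x y"
  using sweedler_sw[of "tens R M N x y" R M N P f] sweedler_tens[OF assms(1-3,6,4,5)] assms by simp

lemma sw_finsum:
  assumes "t \<in> carrier (tensor R M N)" "module R M" "module R N"
  defines "u \<equiv> SOME u. u \<in> t"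
  shows "sw R M N P t f = (\<Oplus>\<^bsub>P\<^esub>p\<in>{p. u p \<noteq> \<zero>\<^bsub>R\<^esub>}. u p \<odot>\<^bsub>P\<^esub> f (fst p) (snd p))"
  using sweedler_sw[OF assms(1-3), of P f] by (simp add: sweedler_def u_def Let_def)

lemma sw_closed [simp]:
  assumes "module R M" "module R N" "module R P" "t \<in> carrier (tensor R M N)"
    "\<And>x y. \<lbrakk>x \<in> carrier M; y \<in> carrier N\<rbrakk> \<Longrightarrow> f x y \<in> carrier P"
  shows "sw R M N P t f \<in> carrier P"
proof -
  interpret P: module R P by fact
  show ?thesis
    unfolding sw_finsum[OF assms(4,1,2)]
    by (rule P.finsum_closed) (use tensor_some_rep[OF assms(1,2,4)] assms(5) in auto)
qed

text \<open>Both sides use the same representative of t, so g just passes through a finite sum. Here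
  f may be any function with values in P.\<close>

lemma lin_sw:
  assumes "module R M" "module R N" "module R P" "module R Q" "t \<in> carrier (tensor R M N)"
    "g \<in> lin_maps R P Q" "\<And>x y. \<lbrakk>x \<in> carrier M; y \<in> carrier N\<rbrakk> \<Longrightarrow> f x y \<in> carrier P"
  shows "g (sw R M N P t f) = sw R M N Q t (\<lambda>x y. g (f x y))"
proof -
  interpret P: module R P by fact
  interpret Q: module R Q by fact
  note rep = tensor_some_rep[OF assms(1,2,5)]
  have cl: "f (fst p) (snd p) \<in> carrier P" if "(SOME u. u \<in> t) p \<noteq> \<zero>\<^bsub>R\<^esub>" for p
    using that rep(3) assms(7) by auto
  have "g (sw R M N P t f) = (\<Oplus>\<^bsub>Q\<^esub>p\<in>{p. (SOME u. u \<in> t) p \<noteq> \<zero>\<^bsub>R\<^esub>}. g ((SOME u. u \<in> t) p \<odot>\<^bsub>P\<^esub> f (fst p) (snd p)))"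
    unfolding sw_finsum[OF assms(5,1,2)]
    by (rule lin_maps_finsum[OF assms(6,3,4) rep(1)]) (use rep cl in auto)
  also have "\<dots> = sw R M N Q t (\<lambda>x y. g (f x y))"
    unfolding sw_finsum[OF assms(5,1,2)]
    by (rule finsum_pure_cong) (use rep cl lin_maps_smult[OF assms(6)] in auto)
  finally show ?thesis .
qed

lemma lin_maps_finsum_param:
  assumes "module R P" "module R Z" "finite A" "\<And>p. p \<in> A \<Longrightarrow> (\<lambda>z. h z p) \<in> lin_maps R Z P"
  shows "(\<lambda>z. \<Oplus>\<^bsub>P\<^esub>p\<in>A. h z p) \<in> lin_maps R Z P"
proof -
  interpret P: module R P by fact
  interpret Z: module R Z by fact
  show ?thesis
  proof (rule lin_mapsI)
    fix z z' r assume z: "z \<in> carrier Z"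
    have cl: "h z p \<in> carrier P" if "p \<in> A" "z \<in> carrier Z" for p z
      using lin_maps_closed[OF assms(4)] that by blast
    show "(\<Oplus>\<^bsub>P\<^esub>p\<in>A. h z p) \<in> carrier P" using cl z by (auto intro: P.finsum_closed)
    show "(\<Oplus>\<^bsub>P\<^esub>p\<in>A. h (z \<oplus>\<^bsub>Z\<^esub> z') p) = (\<Oplus>\<^bsub>P\<^esub>p\<in>A. h z p) \<oplus>\<^bsub>P\<^esub> (\<Oplus>\<^bsub>P\<^esub>p\<in>A. h z' p)" if "z' \<in> carrier Z"
      using P.finsum_addf[of "h z" A "h z'"] z that cl lin_maps_add[OF assms(4)]
      by (simp add: Pi_iff cong: finsum_pure_cong)
    show "(\<Oplus>\<^bsub>P\<^esub>p\<in>A. h (r \<odot>\<^bsub>Z\<^esub> z) p) = r \<odot>\<^bsub>P\<^esub> (\<Oplus>\<^bsub>P\<^esub>p\<in>A. h z p)" if "r \<in> carrier R"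
      using P.finsum_smult_ldistr[OF assms(3) that, of "h z"] z that cl lin_maps_smult[OF assms(4)]
      by (simp add: Pi_iff cong: finsum_pure_cong)
  qed
qed

text \<open>Complements \<open>sw_lin1\<close>, where the tensor varies. With t fixed, the sum is a
  fixed finite combination of maps that are linear in z.\<close>

lemma sw_lin2 [simp]:
  assumes "module R M" "module R N" "module R P" "module R Z" "t \<in> carrier (tensor R M N)"
    "\<And>x y. \<lbrakk>x \<in> carrier M; y \<in> carrier N\<rbrakk> \<Longrightarrow> (\<lambda>z. f z x y) \<in> lin_maps R Z P"
  shows "(\<lambda>z. sw R M N P t (f z)) \<in> lin_maps R Z P"
proof -
  note rep = tensor_some_rep[OF assms(1,2,5)]
  show ?thesis
    unfolding sw_finsum[OF assms(5,1,2)]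
  proof (rule lin_maps_finsum_param[OF assms(3,4) rep(1)])
    fix p assume "p \<in> {p. (SOME u. u \<in> t) p \<noteq> \<zero>\<^bsub>R\<^esub>}"
    then have "(\<lambda>z. f z (fst p) (snd p)) \<in> lin_maps R Z P" using rep(3) assms(6) by auto
    then show "(\<lambda>z. (SOME u. u \<in> t) p \<odot>\<^bsub>P\<^esub> f z (fst p) (snd p)) \<in> lin_maps R Z P"
      by (rule lin_maps_smult_const[OF assms(4,3) rep(2)])
  qed
qed

lemma finsum_swap:
  assumes "abelian_monoid P" "finite A" "finite B" "\<And>i j. \<lbrakk>i \<in> A; j \<in> B\<rbrakk> \<Longrightarrow> f i j \<in> carrier P"
  shows "(\<Oplus>\<^bsub>P\<^esub>i\<in>A. \<Oplus>\<^bsub>P\<^esub>j\<in>B. f i j) = (\<Oplus>\<^bsub>P\<^esub>j\<in>B. \<Oplus>\<^bsub>P\<^esub>i\<in>A. f i j)"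
proof -
  interpret P: abelian_monoid P by fact
  show ?thesis using assms(2,4)
  proof (induction A rule: finite_induct)
    case (insert x F)
    have "(\<Oplus>\<^bsub>P\<^esub>j\<in>B. \<Oplus>\<^bsub>P\<^esub>i\<in>insert x F. f i j) = (\<Oplus>\<^bsub>P\<^esub>j\<in>B. f x j \<oplus>\<^bsub>P\<^esub> (\<Oplus>\<^bsub>P\<^esub>i\<in>F. f i j))"
      by (rule finsum_pure_cong) (use insert in \<open>auto simp: Pi_iff\<close>)
    also have "\<dots> = (\<Oplus>\<^bsub>P\<^esub>j\<in>B. f x j) \<oplus>\<^bsub>P\<^esub> (\<Oplus>\<^bsub>P\<^esub>j\<in>B. \<Oplus>\<^bsub>P\<^esub>i\<in>F. f i j)"
      by (rule P.finsum_addf) (use insert in \<open>auto intro!: P.finsum_closed\<close>)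
    also have "\<dots> = (\<Oplus>\<^bsub>P\<^esub>i\<in>insert x F. \<Oplus>\<^bsub>P\<^esub>j\<in>B. f i j)"
      using insert by (auto intro!: P.finsum_closed)
    finally show ?case by simp
  qed simp
qed

text \<open>Fubini for two finite sums over fixed representatives. Its later uses instantiate some
  modules or tensors, which gives the rewriting a direction.\<close>

lemma sw_swap:
  assumes "module R M" "module R N" "module R M'" "module R N'" "module R P"
    "t \<in> carrier (tensor R M N)" "s \<in> carrier (tensor R M' N')"
    "\<And>x y x' y'. \<lbrakk>x \<in> carrier M; y \<in> carrier N; x' \<in> carrier M'; y' \<in> carrier N'\<rbrakk> \<Longrightarrow> f x y x' y' \<in> carrier P"
  shows "sw R M N P t (\<lambda>x y. sw R M' N' P s (\<lambda>x' y'. f x y x' y'))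
    = sw R M' N' P s (\<lambda>x' y'. sw R M N P t (\<lambda>x y. f x y x' y'))"
proof -
  interpret P: module R P by fact
  let ?u = "SOME u. u \<in> t" and ?v = "SOME u. u \<in> s"
  let ?A = "{p. ?u p \<noteq> \<zero>\<^bsub>R\<^esub>}" and ?B = "{p. ?v p \<noteq> \<zero>\<^bsub>R\<^esub>}"
  note t = tensor_some_rep[OF assms(1,2,6)] and s = tensor_some_rep[OF assms(3,4,7)]
  have cl: "f (fst p) (snd p) (fst q) (snd q) \<in> carrier P" if "p \<in> ?A" "q \<in> ?B" for p q
  proof -
    have "p \<in> carrier M \<times> carrier N" "q \<in> carrier M' \<times> carrier N'" using that t(3) s(3) by auto
    then show ?thesis by (intro assms(8)) auto
  qed
  note fs = sw_finsum[OF assms(6,1,2)] sw_finsum[OF assms(7,3,4)]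
  have "sw R M N P t (\<lambda>x y. sw R M' N' P s (f x y))
      = (\<Oplus>\<^bsub>P\<^esub>p\<in>?A. \<Oplus>\<^bsub>P\<^esub>q\<in>?B. ?u p \<odot>\<^bsub>P\<^esub> (?v q \<odot>\<^bsub>P\<^esub> f (fst p) (snd p) (fst q) (snd q)))"
    unfolding fs by (intro finsum_pure_cong P.finsum_smult_ldistr) (use t s cl in auto)
  also have "\<dots> = (\<Oplus>\<^bsub>P\<^esub>q\<in>?B. \<Oplus>\<^bsub>P\<^esub>p\<in>?A. ?u p \<odot>\<^bsub>P\<^esub> (?v q \<odot>\<^bsub>P\<^esub> f (fst p) (snd p) (fst q) (snd q)))"
    by (rule finsum_swap[OF P.abelian_monoid_axioms]) (use t s cl in auto)
  also have "\<dots> = (\<Oplus>\<^bsub>P\<^esub>q\<in>?B. \<Oplus>\<^bsub>P\<^esub>p\<in>?A. ?v q \<odot>\<^bsub>P\<^esub> (?u p \<odot>\<^bsub>P\<^esub> f (fst p) (snd p) (fst q) (snd q)))"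
    by (intro finsum_pure_cong) (use t s cl in \<open>auto simp: P.smult_assoc1[symmetric] P.m_comm\<close>)
  also have "\<dots> = sw R M' N' P s (\<lambda>x' y'. sw R M N P t (\<lambda>x y. f x y x' y'))"
    unfolding fs by (intro finsum_pure_cong P.finsum_smult_ldistr[symmetric]) (use t s cl in auto)
  finally show ?thesis .
qed

lemma lin_tens1 [simp]:
  assumes "module R M" "module R N" "f \<in> lin_maps R X M" "y \<in> carrier N"
  shows "(\<lambda>x. tens R M N (f x) y) \<in> lin_maps R X (tensor R M N)"
  by (rule lin_maps_comp[OF bilin_mapsD2[OF tens_bilin[OF assms(1,2)] assms(4)] assms(3)])

lemma lin_tens2 [simp]:
  assumes "module R M" "module R N" "f \<in> lin_maps R X N" "x \<in> carrier M"
  shows "(\<lambda>y. tens R M N x (f y)) \<in> lin_maps R X (tensor R M N)"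
  by (rule lin_maps_comp[OF bilin_mapsD1[OF tens_bilin[OF assms(1,2)] assms(4)] assms(3)])

lemma tensor_smult_closed [simp]:
  assumes "module R M" "module R N" "r \<in> carrier R" "t \<in> carrier (tensor R M N)"
  shows "r \<odot>\<^bsub>tensor R M N\<^esub> t \<in> carrier (tensor R M N)"
  by (rule module.smult_closed[OF module_tensor[OF assms(1,2)] assms(3,4)])

lemma lin_smult2 [simp]:
  assumes "module R N" "module R M" "r \<in> carrier R" "f \<in> lin_maps R M N"
  shows "(\<lambda>x. r \<odot>\<^bsub>N\<^esub> f x) \<in> lin_maps R M N"
  by (rule lin_maps_smult_const[OF assms(2,1,3,4)])

lemma sw_tens_id [simp]:
  assumes "module R M" "module R N" "t \<in> carrier (tensor R M N)"
  shows "sw R M N (tensor R M N) t (\<lambda>x y. tens R M N x y) = t"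
    "sw R M N (tensor R M N) t (tens R M N) = t"
  using bspec[OF tensor_ext_ball[of R M N "tensor R M N" "\<lambda>t. sw R M N (tensor R M N) t (\<lambda>x y. tens R M N x y)" "\<lambda>t. t"] assms(3)]
    assms by simp_all

lemma sw_sw [simp]:
  assumes "module R M" "module R N" "module R T" "module R U" "module R P"
    "t \<in> carrier (tensor R M N)" "f \<in> bilin_maps R T U P"
    "\<And>x y. \<lbrakk>x \<in> carrier M; y \<in> carrier N\<rbrakk> \<Longrightarrow> g x y \<in> carrier (tensor R T U)"
  shows "sw R T U P (sw R M N (tensor R T U) t g) f = sw R M N P t (\<lambda>x y. sw R T U P (g x y) f)"
  by (rule lin_sw[of R M N "tensor R T U" P t "\<lambda>s. sw R T U P s f" g]) (use assms in auto)

lemma sw_smult [simp]: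
  assumes "module R M" "module R N" "module R P" "t \<in> carrier (tensor R M N)" "r \<in> carrier R"
    "\<And>x y. \<lbrakk>x \<in> carrier M; y \<in> carrier N\<rbrakk> \<Longrightarrow> f x y \<in> carrier P"
  shows "sw R M N P t (\<lambda>x y. r \<odot>\<^bsub>P\<^esub> f x y) = r \<odot>\<^bsub>P\<^esub> sw R M N P t f"
  by (rule lin_sw[of R M N P P t "\<lambda>s. r \<odot>\<^bsub>P\<^esub> s" f, symmetric]) (use assms in auto)

lemma tens_sw1 [simp]:
  assumes "module R M" "module R N" "module R X" "module R Y" "t \<in> carrier (tensor R M N)" "y \<in> carrier Y"
    "\<And>u v. \<lbrakk>u \<in> carrier M; v \<in> carrier N\<rbrakk> \<Longrightarrow> f u v \<in> carrier X"
  shows "tens R X Y (sw R M N X t f) y = sw R M N (tensor R X Y) t (\<lambda>u v. tens R X Y (f u v) y)"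
  by (rule lin_sw[of R M N X "tensor R X Y" t "\<lambda>s. tens R X Y s y" f]) (use assms in auto)

lemma tens_sw2 [simp]:
  assumes "module R M" "module R N" "module R X" "module R Y" "t \<in> carrier (tensor R M N)" "x \<in> carrier X"
    "\<And>u v. \<lbrakk>u \<in> carrier M; v \<in> carrier N\<rbrakk> \<Longrightarrow> f u v \<in> carrier Y"
  shows "tens R X Y x (sw R M N Y t f) = sw R M N (tensor R X Y) t (\<lambda>u v. tens R X Y x (f u v))"
  by (rule lin_sw[of R M N Y "tensor R X Y" t "\<lambda>s. tens R X Y x s" f]) (use assms in auto)

declare tens3_def [simp]


subsection \<open>Linear maps out of triple tensor products\<close>

definition trilin_maps ::
  "('k,'r) ring_scheme \<Rightarrow> ('k,'m,'x) module_scheme \<Rightarrow> ('k,'n,'y) module_scheme \<Rightarrow>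
   ('k,'l,'w) module_scheme \<Rightarrow> ('k,'p,'z) module_scheme \<Rightarrow> ('m \<Rightarrow> 'n \<Rightarrow> 'l \<Rightarrow> 'p) set"
  where "trilin_maps R M N L P = {f.
    (\<forall>x\<in>carrier M. \<forall>y\<in>carrier N. (\<lambda>z. f x y z) \<in> lin_maps R L P) \<and>
    (\<forall>x\<in>carrier M. \<forall>z\<in>carrier L. (\<lambda>y. f x y z) \<in> lin_maps R N P) \<and>
    (\<forall>y\<in>carrier N. \<forall>z\<in>carrier L. (\<lambda>x. f x y z) \<in> lin_maps R M P)}"

lemma trilin_mapsI [simp]:
  assumes "\<And>x y. \<lbrakk>x \<in> carrier M; y \<in> carrier N\<rbrakk> \<Longrightarrow> (\<lambda>z. f x y z) \<in> lin_maps R L P"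
    "\<And>x z. \<lbrakk>x \<in> carrier M; z \<in> carrier L\<rbrakk> \<Longrightarrow> (\<lambda>y. f x y z) \<in> lin_maps R N P"
    "\<And>y z. \<lbrakk>y \<in> carrier N; z \<in> carrier L\<rbrakk> \<Longrightarrow> (\<lambda>x. f x y z) \<in> lin_maps R M P"
  shows "f \<in> trilin_maps R M N L P"
  using assms by (simp add: trilin_maps_def)

lemma trilin_mapsD:
  assumes "f \<in> trilin_maps R M N L P"
  shows "\<lbrakk>x \<in> carrier M; y \<in> carrier N\<rbrakk> \<Longrightarrow> (\<lambda>z. f x y z) \<in> lin_maps R L P"
    "\<lbrakk>x \<in> carrier M; z \<in> carrier L\<rbrakk> \<Longrightarrow> (\<lambda>y. f x y z) \<in> lin_maps R N P"
    "\<lbrakk>y \<in> carrier N; z \<in> carrier L\<rbrakk> \<Longrightarrow> (\<lambda>x. f x y z) \<in> lin_maps R M P"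
    "\<lbrakk>x \<in> carrier M; y \<in> carrier N; z \<in> carrier L\<rbrakk> \<Longrightarrow> f x y z \<in> carrier P"
  using assms lin_maps_closed[of "\<lambda>z. f x y z" R L P z] by (auto simp: trilin_maps_def)

text \<open>The linear map induced by a trilinear f on the right-bracketed triple tensor product.
  Applying it turns an axiom between threefold tensors into an equation for every trilinear
  expression.\<close>

definition lift3 ::
  "('k,'r) ring_scheme \<Rightarrow> ('k,'m,'x) module_scheme \<Rightarrow> ('k,'n,'y) module_scheme \<Rightarrow>
   ('k,'l,'w) module_scheme \<Rightarrow> ('k,'p,'z) module_scheme \<Rightarrow> ('m \<Rightarrow> 'n \<Rightarrow> 'l \<Rightarrow> 'p) \<Rightarrow>
   ('k,'m,('k,'n,'l) tens) tens \<Rightarrow> 'p"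
  where "lift3 R M N L P f t = sw R M (tensor R N L) P t (\<lambda>x s. sw R N L P s (\<lambda>y z. f x y z))"

context
  fixes R :: "('k,'r) ring_scheme"
    and M :: "('k,'m,'x) module_scheme" and N :: "('k,'n,'y) module_scheme"
    and L :: "('k,'l,'w) module_scheme" and P :: "('k,'p,'z) module_scheme" and f
  assumes mods: "module R M" "module R N" "module R L" "module R P"
    and f: "f \<in> trilin_maps R M N L P"
begin

lemma lift3_lin: "lift3 R M N L P f \<in> lin_maps R (tensor R M (tensor R N L)) P"
  unfolding lift3_def[abs_def] using mods trilin_mapsD[OF f] by simp

lemma lift3_tens:
  "\<lbrakk>x \<in> carrier M; s \<in> carrier (tensor R N L)\<rbrakk> \<Longrightarrow>
    lift3 R M N L P f (tens R M (tensor R N L) x s) = sw R N L P s (\<lambda>y z. f x y z)"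
  unfolding lift3_def using mods trilin_mapsD[OF f] by simp

lemma lift3_sw:
  assumes "module R X" "module R Y" "t \<in> carrier (tensor R X Y)"
    "\<And>u v. \<lbrakk>u \<in> carrier X; v \<in> carrier Y\<rbrakk> \<Longrightarrow> g u v \<in> carrier (tensor R M (tensor R N L))"
  shows "lift3 R M N L P f (sw R X Y (tensor R M (tensor R N L)) t g)
    = sw R X Y P t (\<lambda>u v. lift3 R M N L P f (g u v))"
  by (rule lin_sw[OF assms(1,2) _ mods(4) assms(3) lift3_lin assms(4)]) (use mods in auto)

end


subsection \<open>Balanced tensor products\<close>

locale balanced =
  fixes R :: "('k,'r) ring_scheme" and A :: "('k,'a,'x) hom_object_scheme"
    and B :: "('k,'b,'y) hom_object_scheme" and \<psi> :: "'a \<Rightarrow> 'b" and M :: "('k,'a,'c,'m) Doi_obj"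
  assumes B: "hom_algebra R B" and \<psi>: "\<psi> \<in> lin_maps R A B" and M: "hom_module R A M (act M)"
begin

abbreviation "BM \<equiv> bal_tensor R A B \<psi> M"
abbreviation "bt \<equiv> bal_tens R A B \<psi> M"

definition bal_rels :: "('k,'b,'m) tens set" where
  "bal_rels = {tens R B M (b \<otimes>\<^bsub>B\<^esub> \<psi> a) m \<ominus>\<^bsub>tensor R B M\<^esub> tens R B M (aut B b) (act M a (iaut M m)) | b a m.
       b \<in> carrier B \<and> a \<in> carrier A \<and> m \<in> carrier M}"

lemma bal_ker_gen: "bal_ker R A B \<psi> M = gen_submodule R (tensor R B M) bal_rels"
  by (simp add: bal_ker_def bal_rels_def)

lemma mod_B: "module R B" and mod_M: "module R M"
  using B M by (auto simp: hom_algebra_def hom_module_def hom_obj_def)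

lemma bal_elems:
  assumes "b \<in> carrier B" "a \<in> carrier A" "m \<in> carrier M"
  shows "b \<otimes>\<^bsub>B\<^esub> \<psi> a \<in> carrier B" "aut B b \<in> carrier B" "act M a (iaut M m) \<in> carrier M"
proof -
  interpret B: hom_algebra R B by (rule B)
  interpret M: hom_module R A M "act M" by (rule M)
  show "b \<otimes>\<^bsub>B\<^esub> \<psi> a \<in> carrier B"
    using bilin_maps_closed[OF B.mult_bilin] lin_maps_closed[OF \<psi>] assms by auto
  show "aut B b \<in> carrier B"
    using assms B.obj by (auto simp: hom_obj_def intro: lin_maps_closed)
  have "iaut M m \<in> carrier M"
    using M.obj assms(3) by (auto simp: hom_obj_def iaut_def bij_betw_def intro: inv_into_into)
  then show "act M a (iaut M m) \<in> carrier M"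
    using bilin_maps_closed[OF M.act_bilin] assms by auto
qed

lemma bal_rels_closed: "bal_rels \<subseteq> carrier (tensor R B M)"
proof -
  interpret T: module R "tensor R B M" by (rule module_tensor[OF mod_B mod_M])
  show ?thesis using bal_elems mod_B mod_M by (auto simp: bal_rels_def)
qed

sublocale quot_mod R "tensor R B M" "bal_ker R A B \<psi> M"
  by (rule quot_mod.intro[OF module_tensor[OF mod_B mod_M]])
    (simp add: bal_ker_gen gen_submodule_submodule[OF module_tensor[OF mod_B mod_M] bal_rels_closed])

lemma module_bal [simp]: "module R BM"
  unfolding bal_tensor_def by (rule module_quot)

lemma bt_closed [simp]: "\<lbrakk>b \<in> carrier B; m \<in> carrier M\<rbrakk> \<Longrightarrow> bt b m \<in> carrier BM"
  unfolding bal_tensor_def bal_tens_def using mod_B mod_M by (simp add: coset_closed)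

lemma bt_lin1 [simp]: "\<lbrakk>f \<in> lin_maps R X B; m \<in> carrier M\<rbrakk> \<Longrightarrow> (\<lambda>x. bt (f x) m) \<in> lin_maps R X BM"
  unfolding bal_tensor_def bal_tens_def
  by (rule lin_maps_comp[OF coset_lin]) (use mod_B mod_M in simp)

lemma bt_lin2 [simp]: "\<lbrakk>f \<in> lin_maps R X M; b \<in> carrier B\<rbrakk> \<Longrightarrow> (\<lambda>x. bt b (f x)) \<in> lin_maps R X BM"
  unfolding bal_tensor_def bal_tens_def
  by (rule lin_maps_comp[OF coset_lin]) (use mod_B mod_M in simp)

lemma bt_lin2' [simp]: "b \<in> carrier B \<Longrightarrow> bt b \<in> lin_maps R M BM"
  using bt_lin2[of "\<lambda>x. x" M b] by simp

lemma bt_rel: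
  assumes "b \<in> carrier B" "a \<in> carrier A" "m \<in> carrier M"
  shows "bt (b \<otimes>\<^bsub>B\<^esub> \<psi> a) m = bt (aut B b) (act M a (iaut M m))"
  unfolding bal_tens_def
proof (rule coset_eqI)
  have "tens R B M (b \<otimes>\<^bsub>B\<^esub> \<psi> a) m \<ominus>\<^bsub>tensor R B M\<^esub> tens R B M (aut B b) (act M a (iaut M m)) \<in> bal_rels"
    using assms by (auto simp: bal_rels_def)
  then show "tens R B M (b \<otimes>\<^bsub>B\<^esub> \<psi> a) m \<ominus>\<^bsub>tensor R B M\<^esub> tens R B M (aut B b) (act M a (iaut M m))
      \<in> bal_ker R A B \<psi> M"
    unfolding bal_ker_gen by (rule subsetD[OF gen_submodule_subset])
qed (use assms bal_elems mod_B mod_M in auto)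

definition bal_maps :: "('k,'p,'z) module_scheme \<Rightarrow> ('b \<Rightarrow> 'm \<Rightarrow> 'p) set" where
  "bal_maps P = {f \<in> bilin_maps R B M P. \<forall>b\<in>carrier B. \<forall>a\<in>carrier A. \<forall>m\<in>carrier M.
     f (b \<otimes>\<^bsub>B\<^esub> \<psi> a) m = f (aut B b) (act M a (iaut M m))}"

lemma bal_mapsI:
  assumes "f \<in> bilin_maps R B M P"
    "\<And>b a m. \<lbrakk>b \<in> carrier B; a \<in> carrier A; m \<in> carrier M\<rbrakk> \<Longrightarrow>
      f (b \<otimes>\<^bsub>B\<^esub> \<psi> a) m = f (aut B b) (act M a (iaut M m))"
  shows "f \<in> bal_maps P"
  using assms by (simp add: bal_maps_def)

lemma bal_ext:
  assumes "module R P" "f \<in> lin_maps R BM P" "g \<in> lin_maps R BM P"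
    "\<And>b m. \<lbrakk>b \<in> carrier B; m \<in> carrier M\<rbrakk> \<Longrightarrow> f (bt b m) = g (bt b m)" "x \<in> carrier BM"
  shows "f x = g x"
proof -
  obtain t where t: "t \<in> carrier (tensor R B M)" "x = bal_ker R A B \<psi> M +>\<^bsub>tensor R B M\<^esub> t"
    using assms(5) by (auto simp: bal_tensor_def carrier_quot)
  have "f (bal_ker R A B \<psi> M +>\<^bsub>tensor R B M\<^esub> t) = g (bal_ker R A B \<psi> M +>\<^bsub>tensor R B M\<^esub> t)"
    by (rule tensor_ext[OF mod_B mod_M assms(1) _ _ _ t(1)])
      (use assms(2-4) lin_maps_comp[OF _ coset_lin] in \<open>auto simp: bal_tens_def bal_tensor_def\<close>)
  then show ?thesis using t by simp
qed

lemma sweedler_bal_ker: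
  assumes "module R P" "f \<in> bal_maps P" "s \<in> bal_ker R A B \<psi> M"
  shows "sweedler R P s f = \<zero>\<^bsub>P\<^esub>"
proof -
  interpret P: module R P by fact
  have f: "f \<in> bilin_maps R B M P" using assms(2) by (simp add: bal_maps_def)
  note L = sweedler_lin[OF mod_B mod_M assms(1) f]
  note cl = bal_elems tens_closed[OF mod_B mod_M]
  show ?thesis
  proof (rule lin_maps_gen_submodule[OF module_tensor[OF mod_B mod_M] assms(1) L])
    show "s \<in> gen_submodule R (tensor R B M) bal_rels" using assms(3) by (simp add: bal_ker_gen)
    fix w assume w: "w \<in> bal_rels"
    then obtain b a m where *: "b \<in> carrier B" "a \<in> carrier A" "m \<in> carrier M"
      "w = tens R B M (b \<otimes>\<^bsub>B\<^esub> \<psi> a) m \<ominus>\<^bsub>tensor R B M\<^esub> tens R B M (aut B b) (act M a (iaut M m))"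
      by (auto simp: bal_rels_def)
    have "sweedler R P w f = f (aut B b) (act M a (iaut M m)) \<ominus>\<^bsub>P\<^esub> f (aut B b) (act M a (iaut M m))"
      unfolding *(4) using * assms(2) cl
      by (subst lin_maps_minus[OF L module_tensor[OF mod_B mod_M] assms(1)])
        (auto simp: sweedler_tens[OF mod_B mod_M assms(1) f] bal_maps_def)
    also have "\<dots> = \<zero>\<^bsub>P\<^esub>"
      using bilin_maps_closed[OF f bal_elems(2,3)[OF *(1-3)]] by (simp add: a_minus_def P.r_neg)
    finally show "w \<in> carrier (tensor R B M) \<and> sweedler R P w f = \<zero>\<^bsub>P\<^esub>"
      using w bal_rels_closed by auto
  qed
qed

lemma bal_sweedler_bt:
  assumes "module R P" "f \<in> bal_maps P" "b \<in> carrier B" "m \<in> carrier M"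
  shows "bal_sweedler R P (bt b m) f = f b m"
proof -
  have f: "f \<in> bilin_maps R B M P" using assms(2) by (simp add: bal_maps_def)
  have "bal_sweedler R P (bt b m) f = sweedler R P (tens R B M b m) f"
    unfolding bal_sweedler_def bal_tens_def
    by (rule quot_some_rep[OF assms(1) sweedler_lin[OF mod_B mod_M assms(1) f] sweedler_bal_ker[OF assms(1,2)]])
      (use assms mod_B mod_M in auto)
  then show ?thesis using sweedler_tens[OF mod_B mod_M assms(1) f assms(3,4)] by simp
qed

lemma bal_sweedler_lin:
  assumes "module R P" "f \<in> bal_maps P"
  shows "(\<lambda>x. bal_sweedler R P x f) \<in> lin_maps R BM P"
  unfolding bal_sweedler_def bal_tensor_def
  by (rule quot_lift_lin[OF assms(1) sweedler_lin[OF mod_B mod_M assms(1)] sweedler_bal_ker[OF assms]])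
    (use assms(2) in \<open>auto simp: bal_maps_def\<close>)

text \<open>The tensor picked from the coset lies in the carrier, so its Sweedler sum only sees f
  and g on the carriers.\<close>

lemma bal_sweedler_cong:
  assumes "x \<in> carrier BM" "\<And>b m. \<lbrakk>b \<in> carrier B; m \<in> carrier M\<rbrakk> \<Longrightarrow> f b m = g b m"
  shows "bal_sweedler R P x f = bal_sweedler R P x g"
proof -
  have "(SOME t. t \<in> x) \<in> carrier (tensor R B M)"
    using quot_some_closed(1) assms(1) by (simp add: bal_tensor_def)
  from sweedler_sw[OF this mod_B mod_M, of P f] sweedler_sw[OF this mod_B mod_M, of P g] show ?thesis
    using assms(2) by (simp add: bal_sweedler_def)
qed

end


subsection \<open>Modules with the same underlying module\<close>

text \<open>The constructed objects extend a module record by further fields and so have another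
  type than the tensor product, quotient or algebra beneath them. Linear maps, tensor products and
  sums read just these four fields.\<close>

definition same_module :: "('k,'m,'x) module_scheme \<Rightarrow> ('k,'m,'y) module_scheme \<Rightarrow> bool"
  where "same_module M M' \<longleftrightarrow> carrier M = carrier M' \<and> add M = add M' \<and> zero M = zero M' \<and> smult M = smult M'"

lemma same_module_sym: "same_module M M' \<Longrightarrow> same_module M' M"
  by (simp add: same_module_def)

lemma same_module_imp:
  assumes "same_module M M'" "module R M"
  shows "module R M'"
proof -
  interpret module R M by fact
  have sel: "carrier M' = carrier M" "add M' = add M" "zero M' = zero M" "smult M' = smult M"
    using assms(1) by (auto simp: same_module_def)
  show ?thesis
  proof (rule moduleI)
    show "abelian_group M'"
      by (rule abelian_groupI) (auto simp: sel M.a_ac M.l_neg intro: bexI[of _ "\<ominus>\<^bsub>M\<^esub> _"])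
  qed (auto simp: sel is_cring smult_l_distr smult_r_distr smult_assoc1)
qed

context
  fixes M :: "('k,'m,'x) module_scheme" and M' :: "('k,'m,'y) module_scheme"
  assumes same: "same_module M M'"
begin

lemma same_sel: "carrier M = carrier M'" "add M = add M'" "zero M = zero M'" "smult M = smult M'"
  using same by (auto simp: same_module_def)

lemma same_lin_maps: "lin_maps R M P = lin_maps R M' P" "lin_maps R P M = lin_maps R P M'"
  by (auto simp: lin_maps_def same_sel)

lemma same_module_iff: "module R M \<longleftrightarrow> module R M'"
  by (blast intro: same_module_imp[OF same] same_module_imp[OF same_module_sym[OF same]])

lemma same_tensor: "tensor R M N = tensor R M' N" "tensor R N M = tensor R N M'"
  by (auto simp: tensor_def tensor_ker_def tensor_rels_def same_sel)

lemma same_tens: "tens R M N = tens R M' N" "tens R N M = tens R N M'"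
  by (auto simp: tens_def[abs_def] tensor_ker_def tensor_rels_def same_sel)

lemma same_finsum: "finsum M f A = finsum M' f A"
  by (simp add: finsum_def finprod_def foldD_def same_sel)

lemma same_sweedler: "sweedler R M t f = sweedler R M' t f"
  by (simp add: sweedler_def same_finsum same_sel)

lemma same_bal_sweedler: "bal_sweedler R M t f = bal_sweedler R M' t f"
  by (simp add: bal_sweedler_def same_sweedler)

lemma same_sw: "sw R M N P = sw R M' N P" "sw R N M P = sw R N M' P" "sw R N P M = sw R N P M'"
  by (auto simp: sw_def[abs_def] same_sweedler same_sel cong: if_cong)

lemmas same_module_rules = same_sel same_lin_maps same_module_iff same_tensor same_tens same_sweedler
  same_bal_sweedler same_sw

end

section \<open>Calculation rules for Hom-structures\<close>

subsection \<open>Objects and algebras\<close>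

declare hom_obj.module [simp] hom_obj.aut_lin [simp]

context hom_obj
begin

lemma hom_obj [simp]: "hom_obj R M"
  by (rule hom_obj_axioms)

lemma aut_closed [simp]: "x \<in> carrier M \<Longrightarrow> aut M x \<in> carrier M"
  by (rule lin_maps_closed[OF aut_lin])

lemma iaut_closed [simp]: "x \<in> carrier M \<Longrightarrow> iaut M x \<in> carrier M"
  unfolding iaut_def using bij_betw_apply[OF bij_betw_inv_into[OF aut_bij]] .

lemma aut_iaut [simp]: "x \<in> carrier M \<Longrightarrow> aut M (iaut M x) = x"
  unfolding iaut_def by (rule bij_betw_inv_into_right[OF aut_bij])

lemma iaut_aut [simp]: "x \<in> carrier M \<Longrightarrow> iaut M (aut M x) = x"
  unfolding iaut_def by (rule bij_betw_inv_into_left[OF aut_bij])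

lemma iaut_lin: "iaut M \<in> lin_maps R M M"
  by (rule lin_maps_inv[OF aut_lin module]) auto

lemma iaut_eq_iff: "\<lbrakk>x \<in> carrier M; y \<in> carrier M\<rbrakk> \<Longrightarrow> iaut M x = y \<longleftrightarrow> x = aut M y"
  using iaut_aut aut_iaut by auto

lemma hom_obj_smult_closed [simp]: "\<lbrakk>r \<in> carrier R; x \<in> carrier M\<rbrakk> \<Longrightarrow> r \<odot>\<^bsub>M\<^esub> x \<in> carrier M"
  by (rule module.smult_closed[OF module])

lemma hom_obj_smult [simp]:
  "\<lbrakk>r \<in> carrier R; x \<in> carrier M\<rbrakk> \<Longrightarrow> aut M (r \<odot>\<^bsub>M\<^esub> x) = r \<odot>\<^bsub>M\<^esub> aut M x"
  "\<lbrakk>r \<in> carrier R; x \<in> carrier M\<rbrakk> \<Longrightarrow> iaut M (r \<odot>\<^bsub>M\<^esub> x) = r \<odot>\<^bsub>M\<^esub> iaut M x"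
  by (rule lin_maps_smult[OF aut_lin] lin_maps_smult[OF iaut_lin]; assumption)+

lemma hom_obj_smult_one [simp]:
  "\<one>\<^bsub>R\<^esub> \<in> carrier R" "x \<in> carrier M \<Longrightarrow> \<one>\<^bsub>R\<^esub> \<odot>\<^bsub>M\<^esub> x = x"
proof -
  interpret module R M by (rule module)
  show "\<one>\<^bsub>R\<^esub> \<in> carrier R" "x \<in> carrier M \<Longrightarrow> \<one>\<^bsub>R\<^esub> \<odot>\<^bsub>M\<^esub> x = x" by simp_all
qed

end

declare hom_obj.iaut_lin [simp]

lemma lin_aut [simp]: "\<lbrakk>hom_obj R M; f \<in> lin_maps R X M\<rbrakk> \<Longrightarrow> (\<lambda>x. aut M (f x)) \<in> lin_maps R X M"
  by (rule lin_maps_comp[OF hom_obj.aut_lin])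

lemma lin_iaut [simp]: "\<lbrakk>hom_obj R M; f \<in> lin_maps R X M\<rbrakk> \<Longrightarrow> (\<lambda>x. iaut M (f x)) \<in> lin_maps R X M"
  by (rule lin_maps_comp[OF hom_obj.iaut_lin])

text \<open>A linear two-sided inverse gives the bijectivity and at the same time identifies
  \<open>iaut\<close>, which is defined by the uninformative \<open>inv_into\<close>.\<close>

lemma hom_objI:
  assumes "module R M" "aut M \<in> lin_maps R M M" "g \<in> lin_maps R M M"
    "\<And>x. x \<in> carrier M \<Longrightarrow> aut M (g x) = x" "\<And>x. x \<in> carrier M \<Longrightarrow> g (aut M x) = x"
  shows "hom_obj R M" "\<And>x. x \<in> carrier M \<Longrightarrow> iaut M x = g x"
proof -
  have "bij_betw (aut M) (carrier M) (carrier M)"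
    by (rule bij_betw_byWitness[of _ g])
      (use assms lin_maps_closed[OF assms(2)] lin_maps_closed[OF assms(3)] in auto)
  then show *: "hom_obj R M" using assms by (intro hom_obj.intro)
  show "iaut M x = g x" if "x \<in> carrier M" for x
    using hom_obj.iaut_aut[OF *, of "g x"] assms(4)[OF that] lin_maps_closed[OF assms(3) that] by simp
qed

declare hom_algebra.obj [simp]

context hom_algebra
begin

sublocale hom_obj R A by (rule obj)

lemma hom_algebra [simp]: "hom_algebra R A"
  by (rule hom_algebra_axioms)

declare one_closed [simp] aut_mult [simp] aut_one [simp] mult_one [simp] one_mult [simp]

lemma mult_closed [simp]: "\<lbrakk>a \<in> carrier A; b \<in> carrier A\<rbrakk> \<Longrightarrow> a \<otimes>\<^bsub>A\<^esub> b \<in> carrier A"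
  by (rule bilin_maps_closed[OF mult_bilin])

lemma mult_mult:
  "\<lbrakk>a \<in> carrier A; b \<in> carrier A; c \<in> carrier A\<rbrakk> \<Longrightarrow>
    a \<otimes>\<^bsub>A\<^esub> (b \<otimes>\<^bsub>A\<^esub> c) = (iaut A a \<otimes>\<^bsub>A\<^esub> b) \<otimes>\<^bsub>A\<^esub> aut A c"
  using hom_assoc[of "iaut A a" b c] by simp

lemma mult_lin [simp]:
  "\<lbrakk>f \<in> lin_maps R X A; b \<in> carrier A\<rbrakk> \<Longrightarrow> (\<lambda>x. f x \<otimes>\<^bsub>A\<^esub> b) \<in> lin_maps R X A"
  "\<lbrakk>f \<in> lin_maps R X A; b \<in> carrier A\<rbrakk> \<Longrightarrow> (\<lambda>x. b \<otimes>\<^bsub>A\<^esub> f x) \<in> lin_maps R X A"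
  "b \<in> carrier A \<Longrightarrow> mult A b \<in> lin_maps R A A"
  by (rule lin_maps_comp[OF bilin_mapsD2[OF mult_bilin]] lin_maps_comp[OF bilin_mapsD1[OF mult_bilin]]
    bilin_mapsD1[OF mult_bilin]; assumption)+

lemma iaut_mult [simp]:
  "\<lbrakk>a \<in> carrier A; b \<in> carrier A\<rbrakk> \<Longrightarrow> iaut A (a \<otimes>\<^bsub>A\<^esub> b) = iaut A a \<otimes>\<^bsub>A\<^esub> iaut A b"
  by (subst iaut_eq_iff) auto

lemma iaut_one [simp]: "iaut A \<one>\<^bsub>A\<^esub> = \<one>\<^bsub>A\<^esub>"
  by (subst iaut_eq_iff) auto

end


subsection \<open>Coalgebras\<close>

lemma lin_maps_self_module: "lin_maps R M (self_module R) = {f. f \<in> carrier M \<rightarrow> carrier R \<and>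
    (\<forall>x\<in>carrier M. \<forall>y\<in>carrier M. f (x \<oplus>\<^bsub>M\<^esub> y) = f x \<oplus>\<^bsub>R\<^esub> f y) \<and>
    (\<forall>r\<in>carrier R. \<forall>x\<in>carrier M. f (r \<odot>\<^bsub>M\<^esub> x) = r \<otimes>\<^bsub>R\<^esub> f x)}"
  by (simp add: lin_maps_def self_module_def)

context hom_coalgebra
begin

sublocale hom_obj R C by (rule obj)

lemma hom_coalgebra [simp]: "hom_coalgebra R C"
  by (rule hom_coalgebra_axioms)

lemma comul_closed [simp]: "c \<in> carrier C \<Longrightarrow> comul C c \<in> carrier (tensor R C C)"
  by (rule lin_maps_closed[OF comul_lin])

lemma comul_lin' [simp]: "comul C \<in> lin_maps R C (tensor R C C)"
  by (rule comul_lin)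

lemma counit_closed [simp]: "c \<in> carrier C \<Longrightarrow> counit C c \<in> carrier R"
  using counit_lin by (auto simp: lin_maps_self_module)

lemma counit_smult [simp]:
  "\<lbrakk>r \<in> carrier R; c \<in> carrier C\<rbrakk> \<Longrightarrow> counit C (r \<odot>\<^bsub>C\<^esub> c) = r \<otimes>\<^bsub>R\<^esub> counit C c"
  using counit_lin by (auto simp: lin_maps_self_module)

lemma lin_counit [simp]:
  assumes "module R P" "f \<in> lin_maps R X C" "y \<in> carrier P"
  shows "(\<lambda>x. counit C (f x) \<odot>\<^bsub>P\<^esub> y) \<in> lin_maps R X P"
proof -
  interpret P: module R P by fact
  show ?thesis
    using counit_lin lin_maps_closed[OF assms(2)] lin_maps_add[OF assms(2)] lin_maps_smult[OF assms(2)] assms(3)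
    by (intro lin_mapsI) (auto simp: lin_maps_self_module P.smult_l_distr P.smult_assoc1)
qed

declare counit_aut [simp]

lemma counit_iaut [simp]: "c \<in> carrier C \<Longrightarrow> counit C (iaut C c) = counit C c"
  using counit_aut[of "iaut C c"] by simp

lemma comul_sweedler: "c \<in> carrier C \<Longrightarrow> sweedler R P (comul C c) f = sw R C C P (comul C c) f"
  by (rule sweedler_sw) auto

lemma comul_aut_sw [simp]:
  "c \<in> carrier C \<Longrightarrow> comul C (aut C c) = sw R C C (tensor R C C) (comul C c) (\<lambda>c1 c2. tens R C C (aut C c1) (aut C c2))"
  using comul_aut[of c] by (simp add: comul_sweedler)

lemma comul_iaut_sw [simp]:
  assumes c: "c \<in> carrier C"
  shows "comul C (iaut C c) = sw R C C (tensor R C C) (comul C c) (\<lambda>c1 c2. tens R C C (iaut C c1) (iaut C c2))"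
proof -
  let ?G = "\<lambda>t. sw R C C (tensor R C C) t (\<lambda>c1 c2. tens R C C (iaut C c1) (iaut C c2))"
  \<comment> \<open>Compatibility with \<open>aut\<close> is used at \<open>iaut C c\<close>, and
    \<open>?G\<close> strips the automorphism from both factors. The deleted rules keep
    \<open>aut C (iaut C c)\<close> from collapsing beforehand.\<close>
  have "?G (comul C (aut C (iaut C c))) = comul C (iaut C c)"
    by (subst comul_aut_sw) (use c in \<open>simp_all del: aut_iaut comul_aut_sw\<close>)
  then show ?thesis using c by simp
qed

text \<open>The counit axiom pushed through an arbitrary linear f, so that it rewrites inside longer
  expressions.\<close>

lemma counit_left_sw [simp]:
  assumes "module R P" "c \<in> carrier C" "f \<in> lin_maps R C P"
  shows "sw R C C P (comul C c) (\<lambda>c1 c2. counit C c1 \<odot>\<^bsub>P\<^esub> f c2) = f (iaut C c)"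
proof -
  have "f (iaut C c) = f (sw R C C C (comul C c) (\<lambda>c1 c2. counit C c1 \<odot>\<^bsub>C\<^esub> c2))"
    using counit_left[of c] assms by (simp add: comul_sweedler)
  also have "\<dots> = sw R C C P (comul C c) (\<lambda>c1 c2. f (counit C c1 \<odot>\<^bsub>C\<^esub> c2))"
    by (rule lin_sw[of R C C C P]) (use assms in auto)
  also have "\<dots> = sw R C C P (comul C c) (\<lambda>c1 c2. counit C c1 \<odot>\<^bsub>P\<^esub> f c2)"
    by (rule sw_cong[OF refl]) (simp add: lin_maps_smult[OF assms(3)])
  finally show ?thesis by simp
qed

lemma counit_right_sw [simp]:
  assumes "module R P" "c \<in> carrier C" "f \<in> lin_maps R C P"
  shows "sw R C C P (comul C c) (\<lambda>c1 c2. counit C c2 \<odot>\<^bsub>P\<^esub> f c1) = f (iaut C c)"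
proof -
  have "f (iaut C c) = f (sw R C C C (comul C c) (\<lambda>c1 c2. counit C c2 \<odot>\<^bsub>C\<^esub> c1))"
    using counit_right[of c] assms by (simp add: comul_sweedler)
  also have "\<dots> = sw R C C P (comul C c) (\<lambda>c1 c2. f (counit C c2 \<odot>\<^bsub>C\<^esub> c1))"
    by (rule lin_sw[of R C C C P]) (use assms in auto)
  also have "\<dots> = sw R C C P (comul C c) (\<lambda>c1 c2. counit C c2 \<odot>\<^bsub>P\<^esub> f c1)"
    by (rule sw_cong[OF refl]) (simp add: lin_maps_smult[OF assms(3)])
  finally show ?thesis by simp
qed

lemma coassoc_sw:
  assumes P: "module R P" and c: "c \<in> carrier C" and f: "f \<in> trilin_maps R C C C P"
  shows "sw R C C P (comul C c) (\<lambda>c1 c2. sw R C C P (comul C c2) (\<lambda>c21 c22. f c1 c21 c22))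
    = sw R C C P (comul C c) (\<lambda>c1 c2. sw R C C P (comul C c1) (\<lambda>c11 c12. f (aut C c11) c12 (iaut C c2)))"
proof -
  let ?T = "tensor R C (tensor R C C)"
  \<comment> \<open>The automorphism in the first slot cancels the \<open>iaut C c1\<close> of the
    axiom, so that all twisting ends up on the right-hand side.\<close>
  define g where "g = (\<lambda>x y z. f (aut C x) y z)"
  have g: "g \<in> trilin_maps R C C C P"
    unfolding g_def using trilin_mapsD[OF f]
      lin_maps_comp[OF trilin_mapsD(3)[OF f] aut_lin] by simp
  have "lift3 R C C C P g (sw R C C ?T (comul C c) (\<lambda>c1 c2. sw R C C ?T (comul C c2) (\<lambda>c21 c22. tens3 R C C C (iaut C c1) c21 c22)))
     = lift3 R C C C P g (sw R C C ?T (comul C c) (\<lambda>c1 c2. sw R C C ?T (comul C c1) (\<lambda>c11 c12. tens3 R C C C c11 c12 (iaut C c2))))"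
    using hom_coassoc[OF c] c by (simp add: comul_sweedler)
  then show ?thesis
    using c P g trilin_mapsD[OF g] trilin_mapsD[OF f] by (simp add: lift3_sw lift3_tens g_def)
qed

end

context hom_bialgebra
begin

sublocale hom_algebra R A by (rule algebra)
sublocale hom_coalgebra R A by (rule coalgebra)

lemma comul_mult_sw [simp]:
  "\<lbrakk>a \<in> carrier A; b \<in> carrier A\<rbrakk> \<Longrightarrow> comul A (a \<otimes>\<^bsub>A\<^esub> b) =
      sw R A A (tensor R A A) (comul A a) (\<lambda>a1 a2.
        sw R A A (tensor R A A) (comul A b) (\<lambda>b1 b2.
          tens R A A (a1 \<otimes>\<^bsub>A\<^esub> b1) (a2 \<otimes>\<^bsub>A\<^esub> b2)))"
  using comul_mult[of a b] by (simp add: comul_sweedler)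

declare comul_one [simp] counit_mult [simp] counit_one [simp]

end


subsection \<open>Modules and comodules\<close>

context hom_module
begin

sublocale A: hom_algebra R A by (rule algebra)
sublocale hom_obj R M by (rule obj)

lemma ac_closed [simp]: "\<lbrakk>a \<in> carrier A; m \<in> carrier M\<rbrakk> \<Longrightarrow> ac a m \<in> carrier M"
  by (rule bilin_maps_closed[OF act_bilin])

lemma ac_lin [simp]:
  "\<lbrakk>f \<in> lin_maps R X A; m \<in> carrier M\<rbrakk> \<Longrightarrow> (\<lambda>x. ac (f x) m) \<in> lin_maps R X M"
  "\<lbrakk>g \<in> lin_maps R X M; a \<in> carrier A\<rbrakk> \<Longrightarrow> (\<lambda>x. ac a (g x)) \<in> lin_maps R X M"
  "a \<in> carrier A \<Longrightarrow> ac a \<in> lin_maps R M M"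
  by (rule lin_maps_comp[OF bilin_mapsD2[OF act_bilin]] lin_maps_comp[OF bilin_mapsD1[OF act_bilin]]
    bilin_mapsD1[OF act_bilin]; assumption)+

lemma ac_smult [simp]:
  "\<lbrakk>r \<in> carrier R; a \<in> carrier A; b \<in> carrier M\<rbrakk> \<Longrightarrow> ac (r \<odot>\<^bsub>A\<^esub> a) b = r \<odot>\<^bsub>M\<^esub> (ac a b)"
  "\<lbrakk>r \<in> carrier R; a \<in> carrier A; b \<in> carrier M\<rbrakk> \<Longrightarrow> ac a (r \<odot>\<^bsub>M\<^esub> b) = r \<odot>\<^bsub>M\<^esub> (ac a b)"
  by (rule lin_maps_smult[OF bilin_mapsD2[OF act_bilin]] lin_maps_smult[OF bilin_mapsD1[OF act_bilin]];
    assumption)+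

declare act_one [simp] act_aut [simp]

lemma iaut_act [simp]:
  "\<lbrakk>a \<in> carrier A; m \<in> carrier M\<rbrakk> \<Longrightarrow> iaut M (ac a m) = ac (iaut A a) (iaut M m)"
  by (subst iaut_eq_iff) auto

lemma act_act:
  "\<lbrakk>a \<in> carrier A; b \<in> carrier A; m \<in> carrier M\<rbrakk> \<Longrightarrow> ac a (ac b m) = ac (iaut A a \<otimes>\<^bsub>A\<^esub> b) (aut M m)"
  using act_assoc[of "iaut A a" b m] by simp

text \<open>Opposite in orientation to \<open>act_act\<close>. It serves
  \<open>\<eta>0_mult\<close>, where products must be split into successive actions before matching
  factors become neighbours.\<close>

lemma act_mult:
  "\<lbrakk>a \<in> carrier A; b \<in> carrier A; m \<in> carrier M\<rbrakk> \<Longrightarrow> ac (a \<otimes>\<^bsub>A\<^esub> b) m = ac (aut A a) (ac b (iaut M m))"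
  using act_assoc[of a b "iaut M m"] by simp

end

context hom_comodule
begin

sublocale C: hom_coalgebra R C by (rule coalgebra)

sublocale hom_obj R M by (rule obj)

lemma co_closed [simp]: "m \<in> carrier M \<Longrightarrow> co m \<in> carrier (tensor R M C)"
  by (rule lin_maps_closed[OF coact_lin])

lemma co_lin [simp]: "co \<in> lin_maps R M (tensor R M C)"
  by (rule coact_lin)

lemma co_sweedler: "m \<in> carrier M \<Longrightarrow> sweedler R P (co m) f = sw R M C P (co m) f"
  by (rule sweedler_sw) auto

lemma co_aut [simp]:
  "m \<in> carrier M \<Longrightarrow> co (aut M m) = sw R M C (tensor R M C) (co m) (\<lambda>m0 m1. tens R M C (aut M m0) (aut C m1))"
  using coact_aut[of m] by (simp add: co_sweedler)

lemma co_iaut [simp]: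
  assumes c: "m \<in> carrier M"
  shows "co (iaut M m) = sw R M C (tensor R M C) (co m) (\<lambda>m0 m1. tens R M C (iaut M m0) (iaut C m1))"
proof -
  let ?G = "\<lambda>t. sw R M C (tensor R M C) t (\<lambda>c1 c2. tens R M C (iaut M c1) (iaut C c2))"
  have "?G (co (aut M (iaut M m))) = co (iaut M m)"
    by (subst co_aut) (use c in \<open>simp_all del: aut_iaut co_aut\<close>)
  then show ?thesis using c by simp
qed

lemma co_counit [simp]:
  assumes "module R P" "m \<in> carrier M" "f \<in> lin_maps R M P"
  shows "sw R M C P (co m) (\<lambda>m0 m1. counit C m1 \<odot>\<^bsub>P\<^esub> f m0) = f (iaut M m)"
proof -
  have "f (iaut M m) = f (sw R M C M (co m) (\<lambda>m0 m1. counit C m1 \<odot>\<^bsub>M\<^esub> m0))"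
    using coact_counit[of m] assms by (simp add: co_sweedler)
  also have "\<dots> = sw R M C P (co m) (\<lambda>m0 m1. f (counit C m1 \<odot>\<^bsub>M\<^esub> m0))"
    by (rule lin_sw[of R M C M P]) (use assms in auto)
  also have "\<dots> = sw R M C P (co m) (\<lambda>m0 m1. counit C m1 \<odot>\<^bsub>P\<^esub> f m0)"
    by (rule sw_cong[OF refl]) (simp add: lin_maps_smult[OF assms(3)])
  finally show ?thesis by simp
qed

text \<open>Trades the coproduct of m1 for an iterated coaction. As a rewrite rule it brings both
  sides of a comodule axiom for a constructed object to iterated coactions.\<close>

lemma co_coassoc:
  assumes P: "module R P" and m: "m \<in> carrier M" and f: "f \<in> trilin_maps R M C C P"
  shows "sw R M C P (co m) (\<lambda>m0 m1. sw R C C P (comul C m1) (\<lambda>c1 c2. f m0 c1 c2))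
    = sw R M C P (co m) (\<lambda>m0 m1. sw R M C P (co m0) (\<lambda>m00 m01. f (aut M m00) m01 (iaut C m1)))"
proof -
  let ?T = "tensor R M (tensor R C C)"
  define g where "g = (\<lambda>x y z. f (aut M x) y z)"
  have g: "g \<in> trilin_maps R M C C P"
    unfolding g_def using trilin_mapsD[OF f] lin_maps_comp[OF trilin_mapsD(3)[OF f] aut_lin] by simp
  have "lift3 R M C C P g (sw R M C ?T (co m) (\<lambda>m0 m1. sw R M C ?T (co m0) (\<lambda>m00 m01. tens3 R M C C m00 m01 (iaut C m1))))
     = lift3 R M C C P g (sw R M C ?T (co m) (\<lambda>m0 m1. tens R M (tensor R C C) (iaut M m0) (comul C m1)))"
    using coact_coassoc[OF m] m by (simp add: co_sweedler)
  then show ?thesis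
    using m P g trilin_mapsD[OF g] trilin_mapsD[OF f] by (simp add: lift3_sw lift3_tens g_def)
qed

end


section \<open>Doi Hom-Hopf data and modules\<close>

locale Doi_data = monoidal_Doi_datum R H S A rA C hC
  for R :: "('k,'r) ring_scheme" and H :: "('k,'h,'x) hom_structure_scheme" and S :: "'h \<Rightarrow> 'h"
    and A :: "('k,'a,'y) hom_structure_scheme" and rA :: "'a \<Rightarrow> ('k,'a,'h) tens"
    and C :: "('k,'c,'z) hom_structure_scheme" and hC :: "'h \<Rightarrow> 'c \<Rightarrow> 'c"
begin

sublocale H: hom_bialgebra R H
  using datum by (simp add: Doi_datum_def hom_Hopf_algebra_def)
sublocale A: hom_bialgebra R A by (rule bialgebra_A)
sublocale C: hom_bialgebra R C by (rule bialgebra_C)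
sublocale rA: hom_comodule R H A rA
  using datum by (simp add: Doi_datum_def hom_comodule_algebra_def)
sublocale hC: hom_module R H C hC
  using datum by (simp add: Doi_datum_def hom_module_coalgebra_def)

lemma rA_mult [simp]: "\<lbrakk>a \<in> carrier A; b \<in> carrier A\<rbrakk> \<Longrightarrow> rA (a \<otimes>\<^bsub>A\<^esub> b) =
      sw R A H (tensor R A H) (rA a) (\<lambda>a0 a1. sw R A H (tensor R A H) (rA b) (\<lambda>b0 b1.
        tens R A H (a0 \<otimes>\<^bsub>A\<^esub> b0) (a1 \<otimes>\<^bsub>H\<^esub> b1)))"
  using hom_comodule_algebra.coact_mult[OF Doi_datum.comodule_algebra[OF datum], of a b]
  by (simp add: rA.co_sweedler)

lemma comul_hC [simp]: "\<lbrakk>h \<in> carrier H; c \<in> carrier C\<rbrakk> \<Longrightarrow> comul C (hC h c) =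
      sw R H H (tensor R C C) (comul H h) (\<lambda>h1 h2. sw R C C (tensor R C C) (comul C c) (\<lambda>c1 c2.
        tens R C C (hC h1 c1) (hC h2 c2)))"
  using hom_module_coalgebra.comul_act[OF Doi_datum.module_coalgebra[OF datum], of h c]
  by (simp add: H.comul_sweedler C.comul_sweedler)

lemma counit_hC [simp]: "\<lbrakk>h \<in> carrier H; c \<in> carrier C\<rbrakk> \<Longrightarrow>
      counit C (hC h c) = counit H h \<otimes>\<^bsub>R\<^esub> counit C c"
  by (rule hom_module_coalgebra.counit_act[OF Doi_datum.module_coalgebra[OF datum]])

end

locale Doi_mod = Doi_data R H S A rA C hC + Doi_module R A rA C hC M
  for R :: "('k,'r) ring_scheme" and H :: "('k,'h,'x) hom_structure_scheme" and S :: "'h \<Rightarrow> 'h"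
    and A :: "('k,'a,'y) hom_structure_scheme" and rA :: "'a \<Rightarrow> ('k,'a,'h) tens"
    and C :: "('k,'c,'z) hom_structure_scheme" and hC :: "'h \<Rightarrow> 'c \<Rightarrow> 'c"
    and M :: "('k,'a,'c,'m) Doi_obj"
begin

sublocale M: hom_module R A M "act M" by (rule module)
sublocale M: hom_comodule R C M "coact M" by (rule comodule)

lemma coact_act_sw [simp]: "\<lbrakk>a \<in> carrier A; m \<in> carrier M\<rbrakk> \<Longrightarrow> coact M (act M a m) =
      sw R A H (tensor R M C) (rA a) (\<lambda>a0 a1. sw R M C (tensor R M C) (coact M m) (\<lambda>m0 m1.
        tens R M C (act M a0 m0) (hC a1 m1)))"
  using coact_act[of a m] by (simp add: rA.co_sweedler M.co_sweedler)

end


section \<open>Induced modules\<close>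

locale Doi_ind_setting =
  Doi_mod R H S A rA C hC M + B: Doi_data R H S B rB C hC + monoidal_datum_map R H A rA B rB \<psi>
  for R :: "('k,'r) ring_scheme" and H :: "('k,'h,'x) hom_structure_scheme" and S :: "'h \<Rightarrow> 'h"
    and A :: "('k,'a,'y) hom_structure_scheme" and rA :: "'a \<Rightarrow> ('k,'a,'h) tens"
    and B :: "('k,'b,'w) hom_structure_scheme" and rB :: "'b \<Rightarrow> ('k,'b,'h) tens"
    and C :: "('k,'c,'z) hom_structure_scheme" and hC :: "'h \<Rightarrow> 'c \<Rightarrow> 'c"
    and \<psi> :: "'a \<Rightarrow> 'b" and M :: "('k,'a,'c,'m) Doi_obj"
begin

sublocale \<psi>: hom_bialgebra_map R A B \<psi> by (rule bialgebra_map)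

lemma \<psi>_lin [simp]: "\<psi> \<in> lin_maps R A B" "f \<in> lin_maps R X A \<Longrightarrow> (\<lambda>x. \<psi> (f x)) \<in> lin_maps R X B"
  by (rule \<psi>.lin lin_maps_comp[OF \<psi>.lin]; assumption?)+

lemma \<psi>_closed [simp]: "a \<in> carrier A \<Longrightarrow> \<psi> a \<in> carrier B"
  by (rule lin_maps_closed[OF \<psi>.lin])

text \<open>The automorphisms are moved inside \<open>\<psi>\<close>, so that the left hand side of the balancing
  relation matches.\<close>

lemma aut_\<psi> [simp]: "a \<in> carrier A \<Longrightarrow> aut B (\<psi> a) = \<psi> (aut A a)"
  by (rule \<psi>.aut[symmetric])

lemma iaut_\<psi> [simp]: "a \<in> carrier A \<Longrightarrow> iaut B (\<psi> a) = \<psi> (iaut A a)"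
  by (subst B.A.iaut_eq_iff) auto

lemma comul_\<psi> [simp]: "a \<in> carrier A \<Longrightarrow>
    comul B (\<psi> a) = sw R A A (tensor R B B) (comul A a) (\<lambda>a1 a2. tens R B B (\<psi> a1) (\<psi> a2))"
  using \<psi>.comul[of a] by (simp add: A.comul_sweedler)

lemma rB_\<psi> [simp]: "a \<in> carrier A \<Longrightarrow>
    rB (\<psi> a) = sw R A H (tensor R B H) (rA a) (\<lambda>a0 a1. tens R B H (\<psi> a0) a1)"
  using coact[of a] by (simp add: rA.co_sweedler)

sublocale balanced R A B \<psi> M
  by (rule balanced.intro) (auto intro: module)

abbreviation "FM \<equiv> Doi_ind R A B rB C hC \<psi> M"

lemma same_FM: "same_module FM BM"
  by (simp add: same_module_def Doi_ind_def Let_def)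

lemmas to_BM = same_module_rules[OF same_FM]

lemma FM_module [simp]: "module R FM"
  unfolding to_BM by (rule module_bal)

lemma FM_bt_closed [simp]: "\<lbrakk>b \<in> carrier B; m \<in> carrier M\<rbrakk> \<Longrightarrow> bt b m \<in> carrier FM"
  unfolding to_BM by (rule bt_closed)

lemma FM_bt_lin [simp]:
  "\<lbrakk>f \<in> lin_maps R X B; m \<in> carrier M\<rbrakk> \<Longrightarrow> (\<lambda>x. bt (f x) m) \<in> lin_maps R X FM"
  "\<lbrakk>g \<in> lin_maps R X M; b \<in> carrier B\<rbrakk> \<Longrightarrow> (\<lambda>x. bt b (g x)) \<in> lin_maps R X FM"
  "b \<in> carrier B \<Longrightarrow> bt b \<in> lin_maps R M FM"
  unfolding to_BM by (rule bt_lin1 bt_lin2 bt_lin2'; assumption)+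

declare bt_rel [simp]

lemma FM_ext:
  assumes "module R P" "f \<in> lin_maps R FM P" "g \<in> lin_maps R FM P"
    "\<And>b m. \<lbrakk>b \<in> carrier B; m \<in> carrier M\<rbrakk> \<Longrightarrow> f (bt b m) = g (bt b m)"
  shows "\<forall>x\<in>carrier FM. f x = g x"
  using assms bal_ext[of P f g] unfolding to_BM by blast

lemma FM_sweedler_lin:
  "\<lbrakk>module R P; f \<in> bal_maps P\<rbrakk> \<Longrightarrow> (\<lambda>x. bal_sweedler R P x f) \<in> lin_maps R FM P"
  unfolding to_BM by (rule bal_sweedler_lin)

lemma FM_aut: "aut FM = (\<lambda>x. bal_sweedler R FM x (\<lambda>b m. bt (aut B b) (aut M m)))"
  unfolding to_BM by (rule ext) (simp add: Doi_ind_def Let_def)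

lemma FM_act: "act FM b' = (\<lambda>x. bal_sweedler R FM x (\<lambda>b m. bt (iaut B b' \<otimes>\<^bsub>B\<^esub> b) (aut M m)))"
  unfolding to_BM by (rule ext) (simp add: Doi_ind_def Let_def)

lemma FM_coact: "coact FM = (\<lambda>x. bal_sweedler R (tensor R FM C) x (\<lambda>b m.
      sweedler R (tensor R FM C) (rB b) (\<lambda>b0 b1.
        sweedler R (tensor R FM C) (coact M m) (\<lambda>m0 m1.
          tens R FM C (bt b0 m0) (hC b1 m1)))))"
  unfolding to_BM by (rule ext) (simp add: Doi_ind_def Let_def)

lemma bal_aut: "(\<lambda>b m. bt (aut B b) (aut M m)) \<in> bal_maps FM"
  by (rule bal_mapsI) simp_all

lemma bal_iaut: "(\<lambda>b m. bt (iaut B b) (iaut M m)) \<in> bal_maps FM"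
  by (rule bal_mapsI) simp_all

text \<open>Hom-associativity turns the product of \<open>iaut B b'\<close> with b psi(a) into one
  whose last factor is \<open>\<psi> (aut A a)\<close>, and the balancing relation applies to
  that.\<close>

lemma bal_act: "b' \<in> carrier B \<Longrightarrow> (\<lambda>b m. bt (iaut B b' \<otimes>\<^bsub>B\<^esub> b) (aut M m)) \<in> bal_maps FM"
  by (rule bal_mapsI) (simp_all add: B.A.mult_mult)

text \<open>The coaction of b psi(a) has components b_0 psi(a_0) and b_1 a_1. Balancing hands a_0 to
  m_0 and the module law of C hands a_1 to m_1, which together form the coaction of a acting on
  m.\<close>

lemma bal_coact: "(\<lambda>b m. sw R B H (tensor R FM C) (rB b) (\<lambda>b0 b1.
        sw R M C (tensor R FM C) (coact M m) (\<lambda>m0 m1.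
          tens R FM C (bt b0 m0) (hC b1 m1)))) \<in> bal_maps (tensor R FM C)"
  by (rule bal_mapsI) (simp_all add: hC.act_act)

lemma FM_aut_lin [simp]: "aut FM \<in> lin_maps R FM FM"
  unfolding FM_aut by (rule FM_sweedler_lin[OF FM_module bal_aut])

lemma FM_aut_bt [simp]: "\<lbrakk>b \<in> carrier B; m \<in> carrier M\<rbrakk> \<Longrightarrow> aut FM (bt b m) = bt (aut B b) (aut M m)"
  unfolding FM_aut by (rule bal_sweedler_bt[OF FM_module bal_aut])

lemma FM_obj: "hom_obj R FM"
  and FM_iaut_bt [simp]: "\<lbrakk>b \<in> carrier B; m \<in> carrier M\<rbrakk> \<Longrightarrow> iaut FM (bt b m) = bt (iaut B b) (iaut M m)"
proof -
  let ?g = "\<lambda>x. bal_sweedler R FM x (\<lambda>b m. bt (iaut B b) (iaut M m))"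
  note lin = FM_sweedler_lin[OF FM_module bal_iaut]
  have g: "?g (bt b m) = bt (iaut B b) (iaut M m)" if "b \<in> carrier B" "m \<in> carrier M" for b m
    using that by (rule bal_sweedler_bt[OF FM_module bal_iaut])
  have 1: "\<forall>x\<in>carrier FM. aut FM (?g x) = x"
    by (rule FM_ext[OF FM_module lin_maps_comp[OF FM_aut_lin lin]]) (simp_all add: g)
  have 2: "\<forall>x\<in>carrier FM. ?g (aut FM x) = x"
    by (rule FM_ext[OF FM_module lin_maps_comp[OF lin FM_aut_lin]]) (simp_all add: g)
  show "hom_obj R FM"
    by (rule hom_objI(1)[OF FM_module FM_aut_lin lin]) (use 1 2 in auto)
  show "iaut FM (bt b m) = bt (iaut B b) (iaut M m)" if "b \<in> carrier B" "m \<in> carrier M"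
    by (subst hom_objI(2)[OF FM_module FM_aut_lin lin]) (use 1 2 g that in auto)
qed

sublocale FM: hom_obj R FM by (rule FM_obj)

lemma FM_act_lin2 [simp]: "b \<in> carrier B \<Longrightarrow> act FM b \<in> lin_maps R FM FM"
  unfolding FM_act by (rule FM_sweedler_lin[OF FM_module bal_act])

lemma FM_act_bt [simp]: "\<lbrakk>b' \<in> carrier B; b \<in> carrier B; m \<in> carrier M\<rbrakk> \<Longrightarrow>
    act FM b' (bt b m) = bt (iaut B b' \<otimes>\<^bsub>B\<^esub> b) (aut M m)"
  unfolding FM_act by (rule bal_sweedler_bt[OF FM_module bal_act])

lemma FM_act_lin2' [simp]: 
  "\<lbrakk>f \<in> lin_maps R X FM; b \<in> carrier B\<rbrakk> \<Longrightarrow> (\<lambda>x. act FM b (f x)) \<in> lin_maps R X FM"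
  by (rule lin_maps_comp[OF FM_act_lin2])

lemma FM_act_closed [simp]: "\<lbrakk>b \<in> carrier B; x \<in> carrier FM\<rbrakk> \<Longrightarrow> act FM b x \<in> carrier FM"
  by (rule lin_maps_closed[OF FM_act_lin2])

text \<open>For fixed z the two sides of additivity (or homogeneity) are linear in x, so they may be
  compared at pure elements, where linearity in z is visible. It is used for the action in its
  \<open>B\<close>-argument and for \<open>\<eta>\<close> in its \<open>N\<close>-argument.\<close>

lemma FM_param_lin:
  assumes P: "module R P" and Z: "module R Z" and x: "x \<in> carrier FM"
    and lin: "\<And>z. z \<in> carrier Z \<Longrightarrow> (\<lambda>x. h z x) \<in> lin_maps R FM P"
    and par: "\<And>b m. \<lbrakk>b \<in> carrier B; m \<in> carrier M\<rbrakk> \<Longrightarrow> (\<lambda>z. h z (bt b m)) \<in> lin_maps R Z P"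
  shows "(\<lambda>z. h z x) \<in> lin_maps R Z P"
proof (rule lin_mapsI)
  interpret Z: module R Z by fact
  show "h z x \<in> carrier P" if "z \<in> carrier Z" for z
    by (rule lin_maps_closed[OF lin[OF that] x])
  show "h (z \<oplus>\<^bsub>Z\<^esub> z') x = h z x \<oplus>\<^bsub>P\<^esub> h z' x" if "z \<in> carrier Z" "z' \<in> carrier Z" for z z'
    by (rule bspec[OF FM_ext[OF P lin lin_maps_plus[OF FM_module P lin lin]] x])
      (use that lin_maps_add[OF par] in auto)
  show "h (r \<odot>\<^bsub>Z\<^esub> z) x = r \<odot>\<^bsub>P\<^esub> h z x" if "z \<in> carrier Z" "r \<in> carrier R" for z r
    by (rule bspec[OF FM_ext[OF P lin lin_smult2[OF P FM_module _ lin]] x])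
      (use that lin_maps_smult[OF par] in auto)
qed

lemma FM_act_lin1: "x \<in> carrier FM \<Longrightarrow> (\<lambda>b. act FM b x) \<in> lin_maps R B FM"
proof (rule FM_param_lin[where h = "act FM"])
  show "(\<lambda>b'. act FM b' (bt b m)) \<in> lin_maps R B FM" if "b \<in> carrier B" "m \<in> carrier M" for b m
    by (rule iffD2[OF lin_maps_cong, of _ _ "\<lambda>b'. bt (iaut B b' \<otimes>\<^bsub>B\<^esub> b) (aut M m)"]) (use that in simp_all)
qed simp_all

lemma FM_hom_module: "hom_module R B FM (act FM)"
proof (rule hom_module.intro)
  show "act FM \<in> bilin_maps R B FM FM" using FM_act_lin1 by simp
  fix a b x assume ab: "a \<in> carrier B" "b \<in> carrier B" and x: "x \<in> carrier FM"
  have "\<forall>x\<in>carrier FM. act FM (aut B a) (act FM b x) = act FM (a \<otimes>\<^bsub>B\<^esub> b) (aut FM x)"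
    by (rule FM_ext[OF FM_module]) (use ab in \<open>simp_all add: B.A.mult_mult\<close>)
  then show "act FM (aut B a) (act FM b x) = act FM (a \<otimes>\<^bsub>B\<^esub> b) (aut FM x)" using x by blast
next
  fix x assume x: "x \<in> carrier FM"
  have "\<forall>x\<in>carrier FM. act FM \<one>\<^bsub>B\<^esub> x = aut FM x"
    by (rule FM_ext[OF FM_module]) simp_all
  then show "act FM \<one>\<^bsub>B\<^esub> x = aut FM x" using x by blast
next
  fix a x assume a: "a \<in> carrier B" and x: "x \<in> carrier FM"
  have "\<forall>x\<in>carrier FM. aut FM (act FM a x) = act FM (aut B a) (aut FM x)"
    by (rule FM_ext[OF FM_module]) (use a in simp_all)
  then show "aut FM (act FM a x) = act FM (aut B a) (aut FM x)" using x by blast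
qed simp_all

sublocale FM: hom_module R B FM "act FM" by (rule FM_hom_module)

lemma FM_coact_sw: "x \<in> carrier FM \<Longrightarrow> coact FM x = bal_sweedler R (tensor R FM C) x
    (\<lambda>b m. sw R B H (tensor R FM C) (rB b) (\<lambda>b0 b1.
        sw R M C (tensor R FM C) (coact M m) (\<lambda>m0 m1.
          tens R FM C (bt b0 m0) (hC b1 m1))))"
  unfolding FM_coact
  by (rule bal_sweedler_cong) (simp_all add: B.rA.co_sweedler M.co_sweedler flip: to_BM)

lemma FM_coact_lin: "coact FM \<in> lin_maps R FM (tensor R FM C)"
  by (rule iffD2[OF lin_maps_cong[OF FM_coact_sw FM_module] FM_sweedler_lin[OF _ bal_coact]]) simp_all

lemma FM_coact_bt [simp]: "\<lbrakk>b \<in> carrier B; m \<in> carrier M\<rbrakk> \<Longrightarrow> coact FM (bt b m) =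
    sw R B H (tensor R FM C) (rB b) (\<lambda>b0 b1.
        sw R M C (tensor R FM C) (coact M m) (\<lambda>m0 m1.
          tens R FM C (bt b0 m0) (hC b1 m1)))"
  by (simp add: FM_coact_sw bal_sweedler_bt[OF _ bal_coact])

lemma FM_coact_lin' [simp]: "f \<in> lin_maps R X FM \<Longrightarrow> (\<lambda>x. coact FM (f x)) \<in> lin_maps R X (tensor R FM C)"
  by (rule lin_maps_comp[OF FM_coact_lin])

lemma FM_coact_closed [simp]: "x \<in> carrier FM \<Longrightarrow> coact FM x \<in> carrier (tensor R FM C)"
  by (rule lin_maps_closed[OF FM_coact_lin])

lemma FM_coact_sweedler: "x \<in> carrier FM \<Longrightarrow> sweedler R P (coact FM x) f = sw R FM C P (coact FM x) f"
  by (rule sweedler_sw) simp_all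

lemma FM_hom_comodule: "hom_comodule R C FM (coact FM)"
proof (rule hom_comodule.intro)
  show "coact FM \<in> lin_maps R FM (tensor R FM C)" by (rule FM_coact_lin)
  fix x assume x: "x \<in> carrier FM"
  let ?T = "tensor R FM (tensor R C C)"
  have "\<forall>x\<in>carrier FM. sw R FM C ?T (coact FM x) (\<lambda>x0 x1. sw R FM C ?T (coact FM x0) (\<lambda>x00 x01.
          tens3 R FM C C x00 x01 (iaut C x1)))
      = sw R FM C ?T (coact FM x) (\<lambda>x0 x1. tens R FM (tensor R C C) (iaut FM x0) (comul C x1))"
    \<comment> \<open>The coproduct of \<open>hC b1 m1\<close> splits by \<open>comul_hC\<close>.
      Coassociativity of \<open>rB\<close> and of \<open>coact M\<close> then leaves iterated
      coactions of b and m on both sides, nested alike after the swaps.\<close>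
    by (rule FM_ext[where P = ?T])
      (simp_all add: M.co_coassoc B.rA.co_coassoc
        sw_swap[where M = M and N = C and M' = H and N' = H] sw_swap[where M = M and N = C and M' = B and N' = H])
  then show "sweedler R ?T (coact FM x) (\<lambda>x0 x1. sweedler R ?T (coact FM x0) (\<lambda>x00 x01.
          tens3 R FM C C x00 x01 (iaut C x1)))
      = sweedler R ?T (coact FM x) (\<lambda>x0 x1. tens R FM (tensor R C C) (iaut FM x0) (comul C x1))"
    using x by (simp add: FM_coact_sweedler)
next
  fix x assume x: "x \<in> carrier FM"
  have "\<forall>x\<in>carrier FM. sw R FM C FM (coact FM x) (\<lambda>x0 x1. counit C x1 \<odot>\<^bsub>FM\<^esub> x0) = iaut FM x"
    by (rule FM_ext[where P = FM]) (simp_all add: module.smult_assoc1)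
  then show "sweedler R FM (coact FM x) (\<lambda>x0 x1. counit C x1 \<odot>\<^bsub>FM\<^esub> x0) = iaut FM x"
    using x by (simp add: FM_coact_sweedler)
next
  fix x assume x: "x \<in> carrier FM"
  have "\<forall>x\<in>carrier FM. coact FM (aut FM x) = sw R FM C (tensor R FM C) (coact FM x) (\<lambda>m0 m1. tens R FM C (aut FM m0) (aut C m1))"
    by (rule FM_ext[where P = "tensor R FM C"]) simp_all
  then show "coact FM (aut FM x) = sweedler R (tensor R FM C) (coact FM x) (\<lambda>m0 m1. tens R FM C (aut FM m0) (aut C m1))"
    using x by (simp add: FM_coact_sweedler)
qed simp_all

theorem FM_Doi_module: "Doi_module R B rB C hC FM"
proof (rule Doi_module.intro[OF FM_hom_module FM_hom_comodule])
  fix a x assume a: "a \<in> carrier B" and x: "x \<in> carrier FM"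
  have "\<forall>x\<in>carrier FM. coact FM (act FM a x) =
      sw R B H (tensor R FM C) (rB a) (\<lambda>a0 a1.
        sw R FM C (tensor R FM C) (coact FM x) (\<lambda>m0 m1. tens R FM C (act FM a0 m0) (hC a1 m1)))"
    by (rule FM_ext[where P = "tensor R FM C"]) (use a in \<open>simp_all add: hC.act_act\<close>)
  then show "coact FM (act FM a x) =
      sweedler R (tensor R FM C) (rB a) (\<lambda>a0 a1.
        sweedler R (tensor R FM C) (coact FM x) (\<lambda>m0 m1. tens R FM C (act FM a0 m0) (hC a1 m1)))"
    using x a by (simp add: FM_coact_sweedler B.rA.co_sweedler)
qed

end


section \<open>Tensor products of Doi Hom-Hopf modules\<close>

context Doi_data
begin

text \<open>Trilinear form of the datum's compatibility condition. It makes the diagonal action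
  compatible with the tensor coaction, and it also settles the colinearity of
  \<open>\<theta>\<close>.\<close>

lemma compat_comul_sw:
  assumes P: "module R P" and a: "a \<in> carrier A" "c \<in> carrier C" "d \<in> carrier C" and f: "f \<in> trilin_maps R A A C P"
  shows "sw R A A P (comul A a) (\<lambda>a1 a2. sw R A H P (rA a1) (\<lambda>a10 a11. sw R A H P (rA a2) (\<lambda>a20 a21.
            f a10 a20 (hC a11 c \<otimes>\<^bsub>C\<^esub> hC a21 d))))
      = sw R A H P (rA a) (\<lambda>a0 a1. sw R A A P (comul A a0) (\<lambda>a01 a02. f a01 a02 (hC a1 (c \<otimes>\<^bsub>C\<^esub> d))))"
proof -
  let ?T = "tensor R A (tensor R A C)"
  have "lift3 R A A C P f (sw R A A ?T (comul A a) (\<lambda>a1 a2. sw R A H ?T (rA a1) (\<lambda>a10 a11. sw R A H ?T (rA a2) (\<lambda>a20 a21.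
            tens3 R A A C a10 a20 (hC a11 c \<otimes>\<^bsub>C\<^esub> hC a21 d)))))
      = lift3 R A A C P f (sw R A H ?T (rA a) (\<lambda>a0 a1. sw R A A ?T (comul A a0) (\<lambda>a01 a02.
            tens3 R A A C a01 a02 (hC a1 (c \<otimes>\<^bsub>C\<^esub> d)))))"
    using compat_comul[OF a] a by (simp add: A.comul_sweedler rA.co_sweedler)
  then show ?thesis
    using a P f trilin_mapsD[OF f] by (simp add: lift3_sw lift3_tens)
qed

end

locale Doi_pair = Doi_mod R H S A rA C hC M + N: Doi_mod R H S A rA C hC N
  for R :: "('k,'r) ring_scheme" and H :: "('k,'h,'x) hom_structure_scheme" and S :: "'h \<Rightarrow> 'h"
    and A :: "('k,'a,'y) hom_structure_scheme" and rA :: "'a \<Rightarrow> ('k,'a,'h) tens"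
    and C :: "('k,'c,'z) hom_structure_scheme" and hC :: "'h \<Rightarrow> 'c \<Rightarrow> 'c"
    and M :: "('k,'a,'c,'m) Doi_obj" and N :: "('k,'a,'c,'n) Doi_obj"
begin

abbreviation "MN \<equiv> Doi_tensor R A C M N"

lemma same_MN: "same_module MN (tensor R M N)"
  by (simp add: same_module_def Doi_tensor_def Let_def)

lemmas to_tensor [simp] = same_module_rules[OF same_MN]

lemma MN_ext:
  assumes "module R P" "f \<in> lin_maps R (tensor R M N) P" "g \<in> lin_maps R (tensor R M N) P"
    "\<And>x y. \<lbrakk>x \<in> carrier M; y \<in> carrier N\<rbrakk> \<Longrightarrow> f (tens R M N x y) = g (tens R M N x y)"
  shows "\<forall>t\<in>carrier (tensor R M N). f t = g t"
  by (rule tensor_ext_ball[OF _ _ assms]) simp_all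

lemma MN_sweedler: "t \<in> carrier (tensor R M N) \<Longrightarrow> sweedler R P t f = sw R M N P t f"
  by (rule sweedler_sw) simp_all

lemma MN_aut: "t \<in> carrier (tensor R M N) \<Longrightarrow>
    aut MN t = sw R M N (tensor R M N) t (\<lambda>m n. tens R M N (aut M m) (aut N n))"
  by (simp add: Doi_tensor_def Let_def MN_sweedler)

lemma MN_act: "\<lbrakk>t \<in> carrier (tensor R M N); a \<in> carrier A\<rbrakk> \<Longrightarrow>
    act MN a t = sw R A A (tensor R M N) (comul A a) (\<lambda>a1 a2. sw R M N (tensor R M N) t (\<lambda>m n.
      tens R M N (act M a1 m) (act N a2 n)))"
  by (simp add: Doi_tensor_def Let_def MN_sweedler A.comul_sweedler)

lemma MN_coact: "t \<in> carrier (tensor R M N) \<Longrightarrow>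
    coact MN t = sw R M N (tensor R (tensor R M N) C) t (\<lambda>m n.
      sw R M C (tensor R (tensor R M N) C) (coact M m) (\<lambda>m0 m1.
        sw R N C (tensor R (tensor R M N) C) (coact N n) (\<lambda>n0 n1.
          tens R (tensor R M N) C (tens R M N m0 n0) (m1 \<otimes>\<^bsub>C\<^esub> n1))))"
  by (simp add: Doi_tensor_def Let_def MN_sweedler M.co_sweedler N.M.co_sweedler)

lemma MN_aut_lin [simp]: "aut MN \<in> lin_maps R (tensor R M N) (tensor R M N)"
  by (rule iffD2[OF lin_maps_cong[OF MN_aut]]) simp_all

lemma MN_obj: "hom_obj R MN"
  and MN_iaut: "t \<in> carrier (tensor R M N) \<Longrightarrow>
    iaut MN t = sw R M N (tensor R M N) t (\<lambda>m n. tens R M N (iaut M m) (iaut N n))"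
proof -
  let ?g = "\<lambda>t. sw R M N (tensor R M N) t (\<lambda>m n. tens R M N (iaut M m) (iaut N n))"
  have lin: "?g \<in> lin_maps R (tensor R M N) (tensor R M N)" by simp
  have 1: "\<forall>t\<in>carrier (tensor R M N). aut MN (?g t) = t"
    by (rule MN_ext[OF _ lin_maps_comp[OF MN_aut_lin lin]]) (simp_all add: MN_aut)
  have 2: "\<forall>t\<in>carrier (tensor R M N). ?g (aut MN t) = t"
    by (rule MN_ext[OF _ lin_maps_comp[OF lin MN_aut_lin]]) (simp_all add: MN_aut)
  show "hom_obj R MN"
    by (rule hom_objI(1)[of R MN ?g]) (use 1 2 in simp_all)
  show "iaut MN t = ?g t" if "t \<in> carrier (tensor R M N)"
    by (rule hom_objI(2)[of R MN ?g]) (use 1 2 that in simp_all)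
qed

lemma MN_iaut_lin [simp]: "iaut MN \<in> lin_maps R (tensor R M N) (tensor R M N)"
  by (rule iffD2[OF lin_maps_cong[OF MN_iaut]]) simp_all

lemma MN_lin [simp]:
  "f \<in> lin_maps R X (tensor R M N) \<Longrightarrow> (\<lambda>x. aut MN (f x)) \<in> lin_maps R X (tensor R M N)"
  "f \<in> lin_maps R X (tensor R M N) \<Longrightarrow> (\<lambda>x. iaut MN (f x)) \<in> lin_maps R X (tensor R M N)"
  by (rule lin_maps_comp[OF MN_aut_lin] lin_maps_comp[OF MN_iaut_lin]; assumption)+

lemma MN_closed [simp]:
  "t \<in> carrier (tensor R M N) \<Longrightarrow> aut MN t \<in> carrier (tensor R M N)"
  "t \<in> carrier (tensor R M N) \<Longrightarrow> iaut MN t \<in> carrier (tensor R M N)"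
  by (rule lin_maps_closed[OF MN_aut_lin] lin_maps_closed[OF MN_iaut_lin]; assumption)+

lemma MN_act_lin2 [simp]: "a \<in> carrier A \<Longrightarrow> act MN a \<in> lin_maps R (tensor R M N) (tensor R M N)"
  by (rule iffD2[OF lin_maps_cong[OF MN_act]]) simp_all

lemma MN_act_lin1 [simp]: "t \<in> carrier (tensor R M N) \<Longrightarrow> (\<lambda>a. act MN a t) \<in> lin_maps R A (tensor R M N)"
  by (rule iffD2[OF lin_maps_cong[OF MN_act]]) simp_all

lemma MN_act_closed [simp]:
  "\<lbrakk>a \<in> carrier A; t \<in> carrier (tensor R M N)\<rbrakk> \<Longrightarrow> act MN a t \<in> carrier (tensor R M N)"
  by (rule lin_maps_closed[OF MN_act_lin2])

lemma MN_act_lin [simp]: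
  "\<lbrakk>f \<in> lin_maps R X (tensor R M N); a \<in> carrier A\<rbrakk> \<Longrightarrow> (\<lambda>x. act MN a (f x)) \<in> lin_maps R X (tensor R M N)"
  by (rule lin_maps_comp[OF MN_act_lin2])

lemma MN_coact_lin [simp]: "coact MN \<in> lin_maps R (tensor R M N) (tensor R (tensor R M N) C)"
  by (rule iffD2[OF lin_maps_cong[OF MN_coact]]) simp_all

lemma MN_coact_lin' [simp]:
  "f \<in> lin_maps R X (tensor R M N) \<Longrightarrow> (\<lambda>x. coact MN (f x)) \<in> lin_maps R X (tensor R (tensor R M N) C)"
  by (rule lin_maps_comp[OF MN_coact_lin])

lemma MN_coact_closed [simp]:
  "t \<in> carrier (tensor R M N) \<Longrightarrow> coact MN t \<in> carrier (tensor R (tensor R M N) C)"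
  by (rule lin_maps_closed[OF MN_coact_lin])

lemma MN_coact_sweedler:
  "t \<in> carrier (tensor R M N) \<Longrightarrow> sweedler R P (coact MN t) f = sw R (tensor R M N) C P (coact MN t) f"
  by (rule sweedler_sw) simp_all

lemma MN_hom_module: "hom_module R A MN (act MN)"
proof (rule hom_module.intro)
  show "hom_obj R MN" by (rule MN_obj)
  show "act MN \<in> bilin_maps R A MN MN" by (rule bilin_mapsI) simp_all
next
  fix a b t assume ab: "a \<in> carrier A" "b \<in> carrier A" and t: "t \<in> carrier MN"
  have "\<forall>t\<in>carrier (tensor R M N). act MN (aut A a) (act MN b t) = act MN (a \<otimes>\<^bsub>A\<^esub> b) (aut MN t)"
    by (rule MN_ext[where P = "tensor R M N"])
      (use ab in \<open>simp_all add: MN_act MN_aut M.act_act N.M.act_act sw_swap[where M = A and N = A and t = "comul A b"]\<close>)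
  then show "act MN (aut A a) (act MN b t) = act MN (a \<otimes>\<^bsub>A\<^esub> b) (aut MN t)" using t by simp
next
  fix t assume t: "t \<in> carrier MN"
  have "\<forall>t\<in>carrier (tensor R M N). act MN \<one>\<^bsub>A\<^esub> t = aut MN t"
    by (rule MN_ext[where P = "tensor R M N"]) (simp_all add: MN_act MN_aut)
  then show "act MN \<one>\<^bsub>A\<^esub> t = aut MN t" using t by simp
next
  fix a t assume a: "a \<in> carrier A" and t: "t \<in> carrier MN"
  have "\<forall>t\<in>carrier (tensor R M N). aut MN (act MN a t) = act MN (aut A a) (aut MN t)"
    by (rule MN_ext[where P = "tensor R M N"]) (use a in \<open>simp_all add: MN_act MN_aut\<close>)
  then show "aut MN (act MN a t) = act MN (aut A a) (aut MN t)" using t by simp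
qed simp_all

lemma MN_hom_comodule: "hom_comodule R C MN (coact MN)"
proof (rule hom_comodule.intro)
  show "hom_obj R MN" by (rule MN_obj)
next
  fix t assume t: "t \<in> carrier MN"
  let ?MN = "tensor R M N"
  let ?T = "tensor R ?MN (tensor R C C)"
  have "\<forall>t\<in>carrier ?MN. sw R ?MN C ?T (coact MN t) (\<lambda>x0 x1. sw R ?MN C ?T (coact MN x0) (\<lambda>x00 x01.
          tens3 R ?MN C C x00 x01 (iaut C x1)))
      = sw R ?MN C ?T (coact MN t) (\<lambda>x0 x1. tens R ?MN (tensor R C C) (iaut MN x0) (comul C x1))"
    by (rule MN_ext[where P = ?T])
      (simp_all add: MN_coact MN_iaut M.co_coassoc N.M.co_coassoc
        sw_swap[where M = N and N = C and M' = C and N' = C] sw_swap[where M = N and N = C and M' = M and N' = C])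
  then show "sweedler R (tensor R MN (tensor R C C)) (coact MN t) (\<lambda>x0 x1.
      sweedler R (tensor R MN (tensor R C C)) (coact MN x0) (\<lambda>x00 x01. tens3 R MN C C x00 x01 (iaut C x1)))
      = sweedler R (tensor R MN (tensor R C C)) (coact MN t) (\<lambda>x0 x1. tens R MN (tensor R C C) (iaut MN x0) (comul C x1))"
    using t by (simp add: MN_coact_sweedler)
next
  fix t assume t: "t \<in> carrier MN"
  let ?MN = "tensor R M N"
  have "\<forall>t\<in>carrier ?MN. sw R ?MN C ?MN (coact MN t) (\<lambda>x0 x1. counit C x1 \<odot>\<^bsub>?MN\<^esub> x0) = iaut MN t"
    by (rule MN_ext[where P = ?MN]) (simp_all add: MN_coact MN_iaut module.smult_assoc1)
  then show "sweedler R MN (coact MN t) (\<lambda>x0 x1. counit C x1 \<odot>\<^bsub>MN\<^esub> x0) = iaut MN t"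
    using t by (simp add: MN_coact_sweedler)
next
  fix t assume t: "t \<in> carrier MN"
  let ?MN = "tensor R M N"
  have "\<forall>t\<in>carrier ?MN. coact MN (aut MN t) = sw R ?MN C (tensor R ?MN C) (coact MN t) (\<lambda>m0 m1. tens R ?MN C (aut MN m0) (aut C m1))"
    by (rule MN_ext[where P = "tensor R ?MN C"]) (simp_all add: MN_coact MN_aut)
  then show "coact MN (aut MN t) = sweedler R (tensor R MN C) (coact MN t) (\<lambda>m0 m1. tens R MN C (aut MN m0) (aut C m1))"
    using t by (simp add: MN_coact_sweedler)
qed simp_all

theorem MN_Doi_module: "Doi_module R A rA C hC MN"
proof (rule Doi_module.intro[OF MN_hom_module MN_hom_comodule])
  fix a t assume a: "a \<in> carrier A" and t: "t \<in> carrier MN"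
  let ?MN = "tensor R M N"
  let ?T = "tensor R ?MN C"
  \<comment> \<open>Here m and n stay schematic: they will be coaction components. The swaps move
    the coaction sums outside those over the components of a, and the remaining inner sums match the
    condition.\<close>
  note compat = compat_comul_sw[where f = "\<lambda>u v w. tens R ?MN C (tens R M N (act M u m) (act N v n)) w" for m n]
  have "\<forall>t\<in>carrier ?MN. coact MN (act MN a t) =
      sw R A H ?T (rA a) (\<lambda>a0 a1. sw R ?MN C ?T (coact MN t) (\<lambda>m0 m1. tens R ?MN C (act MN a0 m0) (hC a1 m1)))"
    by (rule MN_ext[where P = ?T])
      (use a in \<open>simp_all add: MN_coact MN_act compat
        sw_swap[where M = A and M' = M] sw_swap[where M = A and M' = N]\<close>)
  then show "coact MN (act MN a t) =
      sweedler R (tensor R MN C) (rA a) (\<lambda>a0 a1.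
        sweedler R (tensor R MN C) (coact MN t) (\<lambda>m0 m1. tens R MN C (act MN a0 m0) (hC a1 m1)))"
    using t a by (simp add: MN_coact_sweedler rA.co_sweedler)
qed

end


section \<open>The regular module\<close>

text \<open>The inverse of a bijective morphism is a morphism: each law for g at n is the law for f
  at \<open>g n\<close>, transported by g. Structure therefore has to be checked in one direction
  only.\<close>

lemma Doi_isoI:
  assumes M: "Doi_module R A rA C hC M" and N: "Doi_module R A rA C hC N"
    and f: "f \<in> Doi_maps R A C M N"
    and g: "\<And>n. n \<in> carrier N \<Longrightarrow> g n \<in> carrier M" "\<And>n. n \<in> carrier N \<Longrightarrow> f (g n) = n"
      "\<And>m. m \<in> carrier M \<Longrightarrow> g (f m) = m"
  shows "Doi_iso R A rA C hC M N f"
proof -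
  interpret M: hom_module R A M "act M" using M by (rule Doi_module.module)
  interpret N: hom_module R A N "act N" using N by (rule Doi_module.module)
  interpret M: hom_comodule R C M "coact M" using M by (rule Doi_module.comodule)
  interpret N: hom_comodule R C N "coact N" using N by (rule Doi_module.comodule)
  have f_lin: "f \<in> lin_maps R M N" using f by (simp add: Doi_maps_def)
  have g_lin: "g \<in> lin_maps R N M"
    by (rule lin_maps_inv[OF f_lin]) (use g in simp_all)
  have f_cl: "f m \<in> carrier N" if "m \<in> carrier M" for m
    by (rule lin_maps_closed[OF f_lin that])
  have f_eq: "f (aut M m) = aut N (f m)" "a \<in> carrier A \<Longrightarrow> f (act M a m) = act N a (f m)"
    "coact N (f m) = sw R M C (tensor R N C) (coact M m) (\<lambda>m0 m1. tens R N C (f m0) m1)"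
    if "m \<in> carrier M" for m a
    using f that by (simp_all add: Doi_maps_def M.co_sweedler)
  have "g \<in> Doi_maps R A C N M"
    unfolding Doi_maps_def
  proof (intro CollectI conjI ballI)
    fix n assume n: "n \<in> carrier N"
    show "g (aut N n) = aut M (g n)" using f_eq(1)[of "g n"] g n by (metis M.aut_closed)
    have "sw R N C (tensor R M C) (coact N (f (g n))) (\<lambda>n0 n1. tens R M C (g n0) n1)
      = sw R M C (tensor R M C) (coact M (g n)) (\<lambda>m0 m1. tens R M C (g (f m0)) m1)"
      unfolding f_eq(3)[OF g(1)[OF n]] using g n f_lin g_lin f_cl by simp
    then show "coact M (g n) = sweedler R (tensor R M C) (coact N n) (\<lambda>m0 m1. tens R M C (g m0) m1)"
      using g n by (simp add: N.co_sweedler)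
  next
    fix a n assume "a \<in> carrier A" "n \<in> carrier N"
    then show "g (act N a n) = act M a (g n)" using f_eq(2)[of "g n"] g by (metis M.ac_closed)
  qed (use g_lin in simp)
  then show ?thesis using M N f g by (auto simp: Doi_iso_def)
qed

context Doi_data
begin

abbreviation "Areg \<equiv> Doi_regular R H A rA C hC"

lemma same_Areg: "same_module Areg A"
  by (simp add: same_module_def Doi_regular_def)

lemmas to_A [simp] = same_module_rules[OF same_Areg]

lemma Areg_sel [simp]: "aut Areg = aut A" "iaut Areg = iaut A" "act Areg = mult A"
  by (simp_all add: Doi_regular_def iaut_def)

lemma Areg_coact: "a \<in> carrier A \<Longrightarrow> coact Areg a =
    sw R A H (tensor R A C) (rA a) (\<lambda>a0 a1. tens R A C a0 (hC (iaut H a1) \<one>\<^bsub>C\<^esub>))"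
  by (simp add: Doi_regular_def rA.co_sweedler)

lemma Areg_coact_lin [simp]: "coact Areg \<in> lin_maps R A (tensor R A C)"
  by (rule iffD2[OF lin_maps_cong[OF Areg_coact]]) simp_all

lemma Areg_coact_lin' [simp]: "f \<in> lin_maps R X A \<Longrightarrow> (\<lambda>x. coact Areg (f x)) \<in> lin_maps R X (tensor R A C)"
  by (rule lin_maps_comp[OF Areg_coact_lin])

lemma Areg_coact_closed [simp]: "a \<in> carrier A \<Longrightarrow> coact Areg a \<in> carrier (tensor R A C)"
  by (rule lin_maps_closed[OF Areg_coact_lin])

lemma Areg_coact_sweedler: "a \<in> carrier A \<Longrightarrow> sweedler R P (coact Areg a) f = sw R A C P (coact Areg a) f"
  by (rule sweedler_sw) simp_all

lemma Areg_obj: "hom_obj R Areg"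
  by (rule hom_obj.intro) (use A.aut_bij in simp_all)

lemma Areg_Doi_module: "Doi_module R A rA C hC Areg"
proof (rule Doi_module.intro)
  show "hom_module R A Areg (act Areg)"
  proof (rule hom_module.intro[OF _ Areg_obj])
    show "act Areg \<in> bilin_maps R A Areg Areg" by (rule bilin_mapsI) simp_all
  qed (simp_all add: A.hom_assoc)
  show "hom_comodule R C Areg (coact Areg)"
    by (rule hom_comodule.intro[OF _ Areg_obj]; simp add: Areg_coact_sweedler;
        simp add: Areg_coact rA.co_coassoc module.smult_assoc1)
  fix a m assume "a \<in> carrier A" "m \<in> carrier Areg"
  then show "coact Areg (act Areg a m) = sweedler R (tensor R Areg C) (rA a) (\<lambda>a0 a1.
        sweedler R (tensor R Areg C) (coact Areg m) (\<lambda>m0 m1. tens R Areg C (act Areg a0 m0) (hC a1 m1)))"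
    \<comment> \<open>This is where the \<open>iaut H\<close> in the regular coaction is forced: by
      \<open>hC.act_act\<close>, acting with h on the result of k acting on the unit of
      \<open>C\<close> is acting with \<open>iaut H h\<close> times k on that unit.\<close>
    by (simp add: Areg_coact_sweedler rA.co_sweedler) (simp add: Areg_coact hC.act_act)
qed

end

locale Doi_map =
  Doi_data R H S A rA C hC + B: Doi_data R H S B rB C hC + monoidal_datum_map R H A rA B rB \<psi>
  for R :: "('k,'r) ring_scheme" and H :: "('k,'h,'x) hom_structure_scheme" and S :: "'h \<Rightarrow> 'h"
    and A :: "('k,'a,'y) hom_structure_scheme" and rA :: "'a \<Rightarrow> ('k,'a,'h) tens"
    and B :: "('k,'b,'w) hom_structure_scheme" and rB :: "'b \<Rightarrow> ('k,'b,'h) tens"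
    and C :: "('k,'c,'z) hom_structure_scheme" and hC :: "'h \<Rightarrow> 'c \<Rightarrow> 'c"
    and \<psi> :: "'a \<Rightarrow> 'b"
begin

sublocale reg: Doi_ind_setting R H S A rA B rB C hC \<psi> Areg
  by (intro Doi_ind_setting.intro Doi_mod.intro Doi_data_axioms Areg_Doi_module
      B.Doi_data_axioms monoidal_datum_map_axioms)

lemma regular_iso:
  "\<exists>\<phi>. Doi_iso R B rB C hC reg.FM B.Areg \<phi> \<and>
    (\<forall>b\<in>carrier B. \<forall>a\<in>carrier A. \<phi> (reg.bt b a) = b \<otimes>\<^bsub>B\<^esub> \<psi> a)"
proof -
  let ?f = "\<lambda>b a. b \<otimes>\<^bsub>B\<^esub> \<psi> a"
  let ?\<phi> = "\<lambda>x. bal_sweedler R B x ?f"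
  \<comment> \<open>The \<open>iaut B\<close> compensates \<open>mult_one\<close>, by which
    multiplying with the unit applies the automorphism.\<close>
  let ?g = "\<lambda>b. reg.bt (iaut B b) \<one>\<^bsub>A\<^esub>"
  have bal: "?f \<in> reg.bal_maps B"
    by (rule reg.bal_mapsI, rule bilin_mapsI) (simp_all add: reg.\<psi>.mult B.A.mult_mult)
  have \<phi>_lin: "?\<phi> \<in> lin_maps R reg.FM B"
    by (rule reg.FM_sweedler_lin[OF _ bal]) simp
  have \<phi>_lin': "(\<lambda>x. ?\<phi> (f x)) \<in> lin_maps R X B" if "f \<in> lin_maps R X reg.FM" for f X
    by (rule lin_maps_comp[OF \<phi>_lin that])
  have \<phi>_bt: "?\<phi> (reg.bt b a) = b \<otimes>\<^bsub>B\<^esub> \<psi> a" if "b \<in> carrier B" "a \<in> carrier A" for b a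
    by (rule reg.bal_sweedler_bt[OF _ bal]) (use that in simp_all)
  have \<phi>_cl: "?\<phi> x \<in> carrier B" if "x \<in> carrier reg.FM" for x
    by (rule lin_maps_closed[OF \<phi>_lin that])
  have aut: "\<forall>x\<in>carrier reg.FM. ?\<phi> (aut reg.FM x) = aut B (?\<phi> x)"
    by (rule reg.FM_ext[where P = B]) (simp_all add: \<phi>_lin \<phi>_lin' \<phi>_bt)
  have act: "\<forall>x\<in>carrier reg.FM. ?\<phi> (act reg.FM b x) = b \<otimes>\<^bsub>B\<^esub> ?\<phi> x" if "b \<in> carrier B" for b
    by (rule reg.FM_ext[where P = B]) (use that in \<open>simp_all add: \<phi>_lin \<phi>_lin' \<phi>_bt B.A.mult_mult\<close>)
  have coact: "\<forall>x\<in>carrier reg.FM. coact B.Areg (?\<phi> x) =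
      sw R reg.FM C (tensor R B C) (coact reg.FM x) (\<lambda>m0 m1. tens R B C (?\<phi> m0) m1)"
    by (rule reg.FM_ext[where P = "tensor R B C"])
      (simp_all add: \<phi>_lin \<phi>_lin' \<phi>_bt \<phi>_cl Areg_coact B.Areg_coact hC.act_act)
  have inv: "\<forall>x\<in>carrier reg.FM. ?g (?\<phi> x) = x"
    by (rule reg.FM_ext[where P = reg.FM]) (simp_all add: \<phi>_lin \<phi>_lin' \<phi>_bt)
  have "Doi_iso R B rB C hC reg.FM B.Areg ?\<phi>"
  proof (rule Doi_isoI[where g = ?g])
    show "?\<phi> \<in> Doi_maps R B C reg.FM B.Areg"
      using \<phi>_lin aut act coact by (simp add: Doi_maps_def reg.FM_coact_sweedler)
  qed (use reg.FM_Doi_module B.Areg_Doi_module inv in \<open>simp_all add: \<phi>_bt reg.\<psi>.one\<close>)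
  then show ?thesis using \<phi>_bt by blast
qed

end


section \<open>Projection formulas\<close>

locale Doi_res_setting =
  Doi_ind_setting R H S A rA B rB C hC \<psi> M + N: Doi_mod R H S B rB C hC N
  for R :: "('k,'r) ring_scheme" and H :: "('k,'h,'x) hom_structure_scheme" and S :: "'h \<Rightarrow> 'h"
    and A :: "('k,'a,'y) hom_structure_scheme" and rA :: "'a \<Rightarrow> ('k,'a,'h) tens"
    and B :: "('k,'b,'w) hom_structure_scheme" and rB :: "'b \<Rightarrow> ('k,'b,'h) tens"
    and C :: "('k,'c,'z) hom_structure_scheme" and hC :: "'h \<Rightarrow> 'c \<Rightarrow> 'c"
    and \<psi> :: "'a \<Rightarrow> 'b" and M :: "('k,'a,'c,'m) Doi_obj" and N :: "('k,'b,'c,'n) Doi_obj"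
begin

abbreviation "GN \<equiv> Doi_res \<psi> N"

lemma same_GN: "same_module GN N"
  by (simp add: same_module_def Doi_res_def)

lemmas to_N = same_module_rules[OF same_GN]

lemma GN_sel [simp]: "aut GN = aut N" "iaut GN = iaut N" "act GN a = act N (\<psi> a)" "coact GN = coact N"
  by (simp_all add: Doi_res_def iaut_def)

text \<open>By \<open>rB_\<psi>\<close> the coaction of psi(a) is that of a with psi on the first
  factor, so the compatibility law of N over \<open>B\<close> restricts to one over
  \<open>A\<close>.\<close>

lemma GN_Doi_module: "Doi_module R A rA C hC GN"
proof (rule Doi_module.intro)
  have obj: "hom_obj R GN"
    by (rule hom_obj.intro) (use N.M.aut_bij in \<open>simp_all add: to_N\<close>)
  show "hom_module R A GN (act GN)"
  proof (rule hom_module.intro[OF _ obj])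
    show "act GN \<in> bilin_maps R A GN GN"
      by (rule bilin_mapsI) (simp_all add: to_N)
  qed (simp_all add: to_N N.M.act_act \<psi>.mult \<psi>.one)
  show "hom_comodule R C GN (coact GN)"
    by (rule hom_comodule.intro[OF _ obj])
      (use N.M.coact_lin N.M.coact_coassoc N.M.coact_counit N.M.coact_aut in \<open>simp_all add: to_N\<close>)
  fix a n assume "a \<in> carrier A" "n \<in> carrier GN"
  then show "coact GN (act GN a n) = sweedler R (tensor R GN C) (rA a) (\<lambda>a0 a1.
        sweedler R (tensor R GN C) (coact GN n) (\<lambda>m0 m1. tens R GN C (act GN a0 m0) (hC a1 m1)))"
    by (simp add: to_N rA.co_sweedler N.M.co_sweedler)
qed

declare to_N [simp]

sublocale GN: Doi_mod R H S A rA C hC GN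
  by (intro Doi_mod.intro Doi_data_axioms GN_Doi_module)

sublocale FM: Doi_mod R H S B rB C hC FM
  by (intro Doi_mod.intro B.Doi_data_axioms FM_Doi_module)

end

section \<open>The comparison morphism for the tensor product with N on the right\<close>

locale Doi_right = Doi_res_setting R H S A rA B rB C hC \<psi> M N
  for R :: "('k,'r) ring_scheme" and H :: "('k,'h,'x) hom_structure_scheme" and S :: "'h \<Rightarrow> 'h"
    and A :: "('k,'a,'y) hom_structure_scheme" and rA :: "'a \<Rightarrow> ('k,'a,'h) tens"
    and B :: "('k,'b,'w) hom_structure_scheme" and rB :: "'b \<Rightarrow> ('k,'b,'h) tens"
    and C :: "('k,'c,'z) hom_structure_scheme" and hC :: "'h \<Rightarrow> 'c \<Rightarrow> 'c"
    and \<psi> :: "'a \<Rightarrow> 'b" and M :: "('k,'a,'c,'m) Doi_obj" and N :: "('k,'b,'c,'n) Doi_obj"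
begin

sublocale L: Doi_pair R H S B rB C hC FM N
  by (intro Doi_pair.intro FM.Doi_mod_axioms N.Doi_mod_axioms)

sublocale P: Doi_pair R H S A rA C hC M GN
  by (intro Doi_pair.intro Doi_mod_axioms GN.Doi_mod_axioms)

sublocale I: Doi_ind_setting R H S A rA B rB C hC \<psi> P.MN
  by (intro Doi_ind_setting.intro Doi_mod.intro Doi_data_axioms P.MN_Doi_module
      B.Doi_data_axioms monoidal_datum_map_axioms)

text \<open>\<open>GN\<close> is rewritten to \<open>N\<close> inside tensor products, so the rules that mention
  \<open>M \<otimes> GN\<close> on their left hand sides have to be rewritten as well.\<close>

lemmas P_rules [simp] = P.MN_aut_lin[unfolded to_N] P.MN_iaut_lin[unfolded to_N] P.MN_lin[unfolded to_N]
  P.MN_closed[unfolded to_N] P.MN_act_lin2[unfolded to_N] P.MN_act_lin1[unfolded to_N] P.MN_act_closed[unfolded to_N]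
  P.MN_act_lin[unfolded to_N] P.MN_coact_lin[unfolded to_N] P.MN_coact_lin'[unfolded to_N]
  P.MN_coact_closed[unfolded to_N]

lemmas P_ext = P.MN_ext[unfolded to_N]
lemmas P_eval = P.MN_aut[unfolded to_N] P.MN_iaut[unfolded to_N] P.MN_act[unfolded to_N, unfolded GN_sel]
  P.MN_coact[unfolded to_N]

lemma I_ext:
  assumes "module R P" "f \<in> lin_maps R I.FM P" "g \<in> lin_maps R I.FM P"
    "\<And>b m n. \<lbrakk>b \<in> carrier B; m \<in> carrier M; n \<in> carrier N\<rbrakk> \<Longrightarrow>
      f (I.bt b (tens R M N m n)) = g (I.bt b (tens R M N m n))"
  shows "\<forall>x\<in>carrier I.FM. f x = g x"
proof (rule I.FM_ext[OF assms(1-3)])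
  fix b t assume b: "b \<in> carrier B" and t: "t \<in> carrier P.MN"
  have "I.bt b \<in> lin_maps R (tensor R M N) I.FM"
    using I.FM_bt_lin(3)[OF b] by simp
  from P_ext[OF assms(1) lin_maps_comp[OF assms(2) this] lin_maps_comp[OF assms(3) this]]
  show "f (I.bt b t) = g (I.bt b t)" using assms(4) b t by simp
qed

definition \<Theta> :: "'b \<Rightarrow> ('k,'m,'n) tens \<Rightarrow> ('k,('k,'b,'m) btens,'n) tens" where
  "\<Theta> b t = sw R B B (tensor R FM N) (comul B b) (\<lambda>b1 b2. sw R M N (tensor R FM N) t (\<lambda>m n.
     tens R FM N (bt b1 m) (act N b2 n)))"

definition "\<theta> x = bal_sweedler R (tensor R FM N) x \<Theta>"

text \<open>The coproduct of b psi(a) has factors b_1 psi(a_1) and b_2 psi(a_2). Balancing moves a_1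
  to m, the module law moves psi(a_2) to n, and this is the diagonal action of a.\<close>

lemma \<Theta>_bal: "\<Theta> \<in> I.bal_maps (tensor R FM N)"
proof (rule I.bal_mapsI)
  show "\<Theta> \<in> bilin_maps R B P.MN (tensor R FM N)"
    unfolding \<Theta>_def by (rule bilin_mapsI) simp_all
  fix b a t assume *: "b \<in> carrier B" "a \<in> carrier A" and t: "t \<in> carrier P.MN"
  have "\<forall>t\<in>carrier (tensor R M N). \<Theta> (b \<otimes>\<^bsub>B\<^esub> \<psi> a) t = \<Theta> (aut B b) (act P.MN a (iaut P.MN t))"
    unfolding \<Theta>_def
    by (rule P_ext[where P = "tensor R FM N"]) (use * in \<open>simp_all add: P_eval N.M.act_act\<close>)
  then show "\<Theta> (b \<otimes>\<^bsub>B\<^esub> \<psi> a) t = \<Theta> (aut B b) (act P.MN a (iaut P.MN t))" using t by simp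
qed

lemma \<theta>_lin [simp]: "\<theta> \<in> lin_maps R I.FM (tensor R FM N)"
  unfolding \<theta>_def[abs_def] by (rule I.FM_sweedler_lin[OF _ \<Theta>_bal]) simp

lemma \<theta>_lin' [simp]: "f \<in> lin_maps R X I.FM \<Longrightarrow> (\<lambda>x. \<theta> (f x)) \<in> lin_maps R X (tensor R FM N)"
  by (rule lin_maps_comp[OF \<theta>_lin])

lemma \<theta>_closed [simp]: "x \<in> carrier I.FM \<Longrightarrow> \<theta> x \<in> carrier (tensor R FM N)"
  by (rule lin_maps_closed[OF \<theta>_lin])

lemma \<theta>_bt [simp]: "\<lbrakk>b \<in> carrier B; t \<in> carrier (tensor R M N)\<rbrakk> \<Longrightarrow> \<theta> (I.bt b t) =
    sw R B B (tensor R FM N) (comul B b) (\<lambda>b1 b2. sw R M N (tensor R FM N) t (\<lambda>m n.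
     tens R FM N (bt b1 m) (act N b2 n)))"
  unfolding \<theta>_def by (subst I.bal_sweedler_bt[OF _ \<Theta>_bal]) (simp_all add: \<Theta>_def)

lemma \<theta>_Doi_map: "\<theta> \<in> Doi_maps R B C I.FM L.MN"
proof -
  let ?L = "tensor R FM N"
  let ?T = "tensor R ?L C"
  have aut: "\<forall>x\<in>carrier I.FM. \<theta> (aut I.FM x) = aut L.MN (\<theta> x)"
    by (rule I_ext[where P = ?L]) (simp_all add: P_eval L.MN_aut)
  have act: "\<forall>x\<in>carrier I.FM. \<theta> (act I.FM b x) = act L.MN b (\<theta> x)" if "b \<in> carrier B" for b
    by (rule I_ext[where P = ?L]) (use that in \<open>simp_all add: P_eval L.MN_act N.M.act_act\<close>)
  note compat = B.compat_comul_sw[where f = "\<lambda>u v w. tens R ?L C (tens R FM N (bt u m) (act N v n)) w" for m n]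
  have coact: "\<forall>x\<in>carrier I.FM. coact L.MN (\<theta> x) = sw R I.FM C ?T (coact I.FM x) (\<lambda>m0 m1. tens R ?L C (\<theta> m0) m1)"
    by (rule I_ext[where P = ?T])
      (simp_all add: P_eval L.MN_coact compat sw_swap[where M = B and M' = M] sw_swap[where M = B and M' = N])
  show ?thesis
    using aut act coact by (simp add: Doi_maps_def I.FM_coact_sweedler)
qed

end

text \<open>Coassociativity puts v and d2 into one coproduct, where the convolution of p with q is
  the unit by \<open>pq\<close>. Keeping the exponents explicit in the conclusion shows how any
  later use must be pre-twisted.\<close>

lemma (in hom_module) collapse_right:
  fixes D :: "('k,'d,'w) hom_structure_scheme" and P :: "('k,'p,'z) module_scheme"
  assumes D: "hom_coalgebra R D" and P: "module R P"
    and p: "p \<in> lin_maps R D A" "\<And>d. d \<in> carrier D \<Longrightarrow> p (aut D d) = aut A (p d)"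
    and q: "q \<in> lin_maps R D A" "\<And>d. d \<in> carrier D \<Longrightarrow> q (aut D d) = aut A (q d)"
    and pq: "\<And>d. d \<in> carrier D \<Longrightarrow>
      sw R D D A (comul D d) (\<lambda>u v. p u \<otimes>\<^bsub>A\<^esub> q v) = counit D d \<odot>\<^bsub>A\<^esub> \<one>\<^bsub>A\<^esub>"
    and f: "\<And>u. u \<in> carrier D \<Longrightarrow> f u \<in> lin_maps R M P" "\<And>m. m \<in> carrier M \<Longrightarrow> (\<lambda>u. f u m) \<in> lin_maps R D P"
    and d: "d \<in> carrier D" and m: "m \<in> carrier M"
  shows "sw R D D P (comul D d) (\<lambda>d1 d2. sw R D D P (comul D d1) (\<lambda>u v.
      f u (ac (aut A (aut A (p v))) (ac (q d2) m)))) = f (iaut D (iaut D d)) (aut M (aut M m))"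
proof -
  interpret D: hom_coalgebra R D by (rule D)
  note [simp] = lin_maps_comp[OF p(1)] lin_maps_comp[OF q(1)] lin_maps_comp[OF f(1)] lin_maps_comp[OF f(2)]
    lin_maps_closed[OF p(1)] lin_maps_closed[OF q(1)] lin_maps_closed[OF f(1)] p q f P d m
  \<comment> \<open>Chosen so that the arguments prescribed by \<open>coassoc_sw\<close>, namely
    \<open>aut D u\<close>, v and \<open>iaut D d2\<close>, give back the summand of the
    claim.\<close>
  let ?F = "\<lambda>d1 u v. f (iaut D d1) (ac (aut A (aut A (p u))) (ac (q (aut D v)) m))"
  let ?L = "\<lambda>d1 z. f (iaut D d1) (ac (aut A z) (aut M m))"
  have L: "sw R D D P (comul D d2) (\<lambda>u v. ?F d1 u v) = counit D d2 \<odot>\<^bsub>P\<^esub> f (iaut D d1) (aut M (aut M m))"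
    if d12: "d1 \<in> carrier D" "d2 \<in> carrier D" for d1 d2
  proof -
    have "sw R D D P (comul D d2) (\<lambda>u v. ?F d1 u v) = sw R D D P (comul D d2) (\<lambda>u v. ?L d1 (p u \<otimes>\<^bsub>A\<^esub> q v))"
      using d12 by (simp add: act_act)
    also have "\<dots> = ?L d1 (sw R D D A (comul D d2) (\<lambda>u v. p u \<otimes>\<^bsub>A\<^esub> q v))"
      by (rule lin_sw[where g = "?L d1", symmetric]) (use d12 in simp_all)
    also have "\<dots> = counit D d2 \<odot>\<^bsub>P\<^esub> f (iaut D d1) (aut M (aut M m))"
      using d12 by (simp add: pq lin_maps_smult[OF f(1)])
    finally show ?thesis .
  qed
  have "sw R D D P (comul D d) (\<lambda>d1 d2. sw R D D P (comul D d1) (\<lambda>u v.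
      f u (ac (aut A (aut A (p v))) (ac (q d2) m))))
      = sw R D D P (comul D d) (\<lambda>d1 d2. sw R D D P (comul D d2) (\<lambda>u v. ?F d1 u v))"
    by (subst D.coassoc_sw[where f = ?F]) (simp_all del: q(2))
  also have "\<dots> = sw R D D P (comul D d) (\<lambda>d1 d2. counit D d2 \<odot>\<^bsub>P\<^esub> f (iaut D d1) (aut M (aut M m)))"
    by (rule sw_cong[OF refl L])
  also have "\<dots> = f (iaut D (iaut D d)) (aut M (aut M m))"
    by (rule D.counit_right_sw[where f = "\<lambda>d1. f (iaut D d1) (aut M (aut M m))"]) simp_all
  finally show ?thesis .
qed

section \<open>The inverse morphism built from an antipode\<close>

locale Doi_right_Hopf = Doi_right R H S A rA B rB C hC \<psi> M N + T: antipode R B T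
  for R :: "('k,'r) ring_scheme" and H :: "('k,'h,'x) hom_structure_scheme" and S :: "'h \<Rightarrow> 'h"
    and A :: "('k,'a,'y) hom_structure_scheme" and rA :: "'a \<Rightarrow> ('k,'a,'h) tens"
    and B :: "('k,'b,'w) hom_structure_scheme" and rB :: "'b \<Rightarrow> ('k,'b,'h) tens"
    and C :: "('k,'c,'z) hom_structure_scheme" and hC :: "'h \<Rightarrow> 'c \<Rightarrow> 'c"
    and \<psi> :: "'a \<Rightarrow> 'b" and M :: "('k,'a,'c,'m) Doi_obj" and N :: "('k,'b,'c,'n) Doi_obj" and T :: "'b \<Rightarrow> 'b"
begin

lemma T_lin [simp]: "T \<in> lin_maps R B B" "f \<in> lin_maps R X B \<Longrightarrow> (\<lambda>x. T (f x)) \<in> lin_maps R X B"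
  by (rule T.lin lin_maps_comp[OF T.lin]; assumption?)+

lemma T_closed [simp]: "b \<in> carrier B \<Longrightarrow> T b \<in> carrier B"
  by (rule lin_maps_closed[OF T.lin])

lemma T_aut [simp]: "b \<in> carrier B \<Longrightarrow> T (aut B b) = aut B (T b)"
  by (rule T.aut)

lemma T_\<psi>_aut [simp]: "a \<in> carrier A \<Longrightarrow> T (\<psi> (aut A a)) = aut B (T (\<psi> a))"
  using T_aut[of "\<psi> a"] by (simp del: T_aut)

lemma T_right [simp]: "b \<in> carrier B \<Longrightarrow>
    sw R B B B (comul B b) (\<lambda>b1 b2. b1 \<otimes>\<^bsub>B\<^esub> T b2) = counit B b \<odot>\<^bsub>B\<^esub> \<one>\<^bsub>B\<^esub>"
  using T.right[of b] by (simp add: B.A.comul_sweedler)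

lemma T_left [simp]: "b \<in> carrier B \<Longrightarrow>
    sw R B B B (comul B b) (\<lambda>b1 b2. T b1 \<otimes>\<^bsub>B\<^esub> b2) = counit B b \<odot>\<^bsub>B\<^esub> \<one>\<^bsub>B\<^esub>"
  using T.left[of b] by (simp add: B.A.comul_sweedler)

lemma T_right_\<psi> [simp]: "a \<in> carrier A \<Longrightarrow>
    sw R A A B (comul A a) (\<lambda>a1 a2. \<psi> a1 \<otimes>\<^bsub>B\<^esub> T (\<psi> a2)) = counit A a \<odot>\<^bsub>B\<^esub> \<one>\<^bsub>B\<^esub>"
  using T_right[of "\<psi> a"] by (simp add: \<psi>.counit del: T_right)

text \<open>The first two instances serve the two composites of \<open>\<theta>\<close> and
  \<open>\<eta>\<close>. The third, over the coproduct of \<open>A\<close>, serves the balancing of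
  \<open>E\<close>, since \<open>comul_\<psi>\<close> computes the coproduct of psi(a)
  there.\<close>

lemmas collapse_id_T = N.M.collapse_right[OF B.A.hom_coalgebra, where p = "\<lambda>b. b" and q = T, simplified]
lemmas collapse_T_id = N.M.collapse_right[OF B.A.hom_coalgebra, where p = T and q = "\<lambda>b. b", simplified]
lemmas collapse_\<psi>_T = N.M.collapse_right[OF A.hom_coalgebra, where p = \<psi> and q = "\<lambda>a. T (\<psi> a)", simplified]

text \<open>A Galois-type map: \<open>\<theta>\<close> with M and the balancing dropped.\<close>

definition "\<theta>0 t = sw R B N (tensor R B N) t (\<lambda>b n. sw R B B (tensor R B N) (comul B b) (\<lambda>b1 b2.
   tens R B N b1 (act N b2 n)))"

definition "\<eta>0 t = sw R B N (tensor R B N) t (\<lambda>b n. sw R B B (tensor R B N) (comul B b) (\<lambda>b1 b2.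
   tens R B N (aut B (aut B b1)) (act N (T b2) (iaut N (iaut N n)))))"

text \<open>The law T(x_1) x_2 = eps(x) 1 cancels T(b_12) against b_2, once the two
  \<open>iaut N\<close> are pulled in front of both actions. It makes \<open>\<theta>0\<close>
  injective.\<close>

lemma \<eta>0_\<theta>0: "\<forall>t\<in>carrier (tensor R B N). \<eta>0 (\<theta>0 t) = t"
proof (rule tensor_ext_ball[where P = "tensor R B N"])
  fix b n assume *: "b \<in> carrier B" "n \<in> carrier N"
  show "\<eta>0 (\<theta>0 (tens R B N b n)) = tens R B N b n"
    using * collapse_T_id[where f = "\<lambda>u z. tens R B N (aut B (aut B u)) (iaut N (iaut N z))" and d = b and m = n and P = "tensor R B N"]
    by (simp add: \<eta>0_def \<theta>0_def)
qed (simp_all add: \<eta>0_def \<theta>0_def)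

text \<open>Stands in for the antimultiplicativity of the antipode. Both sides have the same image
  under the injective map \<open>\<theta>0\<close>.\<close>

lemma \<eta>0_mult:
  assumes x: "x \<in> carrier B" and y: "y \<in> carrier B" and n: "n \<in> carrier N"
  shows "\<eta>0 (tens R B N (x \<otimes>\<^bsub>B\<^esub> y) n) = sw R B B (tensor R B N) (comul B x) (\<lambda>x1 x2.
    sw R B B (tensor R B N) (comul B y) (\<lambda>y1 y2.
      tens R B N (aut B (aut B x1) \<otimes>\<^bsub>B\<^esub> aut B (aut B y1))
        (act N (aut B (T y2)) (act N (T x2) (iaut N (iaut N (iaut N n)))))))" (is "_ = ?E")
proof -
  \<comment> \<open>After the actions are split, y_12 and T(y_2) are neighbours while the factors of
    x still enclose them. So y cancels first, and only then can \<open>cx\<close> apply.\<close>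
  note cy = collapse_id_T[where f = "\<lambda>u z. tens R B N (aut B (aut B x1) \<otimes>\<^bsub>B\<^esub> aut B (aut B u)) (act N (aut B (aut B (aut B x2))) z)"
      and P = "tensor R B N" and d = y for x1 x2]
  \<comment> \<open>The left action carries one automorphism more than \<open>collapse_id_T\<close>
    expects. An \<open>aut N\<close> is pulled in front of both actions, whence
    \<open>aut N z\<close> and the third \<open>iaut N\<close> on n.\<close>
  have cx: "sw R B B (tensor R B N) (comul B x) (\<lambda>d1 d2. sw R B B (tensor R B N) (comul B d1) (\<lambda>u v.
      tens R B N (aut B (aut B u) \<otimes>\<^bsub>B\<^esub> y) (act N (aut B (aut B (aut B v))) (act N (aut B (T d2)) (iaut N (iaut N n))))))
      = tens R B N (x \<otimes>\<^bsub>B\<^esub> y) n"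
    using x y n collapse_id_T[where f = "\<lambda>u z. tens R B N (aut B (aut B u) \<otimes>\<^bsub>B\<^esub> y) (aut N z)"
      and P = "tensor R B N" and d = x and m = "iaut N (iaut N (iaut N n))"] by simp
  have "\<theta>0 ?E = tens R B N (x \<otimes>\<^bsub>B\<^esub> y) n"
    using x y n cx by (simp add: \<theta>0_def N.M.act_mult sw_swap[where t = "comul B y"] cy)
  moreover have "\<eta>0 (\<theta>0 ?E) = ?E" using \<eta>0_\<theta>0 x y n by simp
  ultimately show ?thesis by simp
qed

text \<open>The intended value of \<open>\<eta>\<close> at \<open>bt b m\<close> tensor n, taken
  before it is known to depend on b and m only through \<open>bt b m\<close>.\<close>

definition E :: "'b \<Rightarrow> 'm \<Rightarrow> 'n \<Rightarrow> ('k,'b,('k,'m,'n) tens) btens" where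
  "E b m n = sw R B B I.FM (comul B b) (\<lambda>b1 b2.
     I.bt (aut B (aut B b1)) (tens R M N m (act N (T b2) (iaut N (iaut N n)))))"

text \<open>Transports \<open>\<eta>0_mult\<close> to \<open>E\<close> along the bilinear assignment
  of \<open>I.bt b (tens R M N m n)\<close> to b and n.\<close>

lemma E_\<eta>0: "\<lbrakk>b \<in> carrier B; m \<in> carrier M; n \<in> carrier N\<rbrakk> \<Longrightarrow>
    E b m n = sw R B N I.FM (\<eta>0 (tens R B N b n)) (\<lambda>b n. I.bt b (tens R M N m n))"
  by (simp add: E_def \<eta>0_def)

lemma I_bt_sw: "\<lbrakk>module R X; module R Y; t \<in> carrier (tensor R X Y); b \<in> carrier B;
    \<And>u v. \<lbrakk>u \<in> carrier X; v \<in> carrier Y\<rbrakk> \<Longrightarrow> f u v \<in> carrier (tensor R M N)\<rbrakk> \<Longrightarrow>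
    I.bt b (sw R X Y (tensor R M N) t f) = sw R X Y I.FM t (\<lambda>u v. I.bt b (f u v))"
  using I.FM_bt_lin(3)[of b] by (intro lin_sw) simp_all

text \<open>By \<open>\<eta>0_mult\<close> the \<open>B\<close>-factor ends in psi(a_1), which
  balancing turns into a diagonal action: a_11 acts on m, while psi(a_12) meets T(psi(a_2)) on the
  side of N and cancels. Just the action of a on m remains.\<close>

lemma E_bal: "n \<in> carrier N \<Longrightarrow> (\<lambda>b m. E b m n) \<in> bal_maps I.FM"
proof (rule bal_mapsI)
  assume n: "n \<in> carrier N"
  then show "(\<lambda>b m. E b m n) \<in> bilin_maps R B M I.FM" by (simp add: E_def)
  fix b a m assume *: "b \<in> carrier B" "a \<in> carrier A" "m \<in> carrier M"
  note c = collapse_\<psi>_T[where f = "\<lambda>u z. I.bt b1 (tens R M N (act M (aut A (aut A u)) (iaut M m)) z)"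
      and P = I.FM and d = a for b1]
  show "E (b \<otimes>\<^bsub>B\<^esub> \<psi> a) m n = E (aut B b) (act M a (iaut M m)) n"
    \<comment> \<open>Only the side with the product is sent through \<open>\<eta>0\<close>.
      Unfolding \<open>E\<close> there directly would expose T at products of coproduct
      factors.\<close>
    using * n by (simp add: E_\<eta>0[of "b \<otimes>\<^bsub>B\<^esub> \<psi> a"] \<eta>0_mult) (simp add: E_def P_eval I_bt_sw c)
qed

definition "\<eta> t = sw R FM N I.FM t (\<lambda>x n. bal_sweedler R I.FM x (\<lambda>b m. E b m n))"

lemma bal_E_lin1: "n \<in> carrier N \<Longrightarrow> (\<lambda>x. bal_sweedler R I.FM x (\<lambda>b m. E b m n)) \<in> lin_maps R FM I.FM"
  by (rule FM_sweedler_lin[OF _ E_bal]) simp_all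

lemma bal_E_bt: "\<lbrakk>b \<in> carrier B; m \<in> carrier M; n \<in> carrier N\<rbrakk> \<Longrightarrow>
    bal_sweedler R I.FM (bt b m) (\<lambda>b m. E b m n) = E b m n"
  by (rule bal_sweedler_bt[OF _ E_bal]) simp_all

lemma bal_E_lin2:
  assumes "x \<in> carrier FM"
  shows "(\<lambda>n. bal_sweedler R I.FM x (\<lambda>b m. E b m n)) \<in> lin_maps R N I.FM"
proof (rule FM_param_lin[where h = "\<lambda>n x. bal_sweedler R I.FM x (\<lambda>b m. E b m n)", OF _ _ assms bal_E_lin1])
  fix b m assume "b \<in> carrier B" "m \<in> carrier M"
  then show "(\<lambda>n. bal_sweedler R I.FM (bt b m) (\<lambda>b m. E b m n)) \<in> lin_maps R N I.FM"
    by (subst lin_maps_cong[OF bal_E_bt]) (simp_all add: E_def[abs_def])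
qed simp_all

lemma \<eta>_lin [simp]: "\<eta> \<in> lin_maps R (tensor R FM N) I.FM"
  unfolding \<eta>_def[abs_def] using bal_E_lin1 bal_E_lin2 by simp

lemma \<eta>_lin' [simp]: "f \<in> lin_maps R X (tensor R FM N) \<Longrightarrow> (\<lambda>x. \<eta> (f x)) \<in> lin_maps R X I.FM"
  by (rule lin_maps_comp[OF \<eta>_lin])

lemma \<eta>_tens [simp]: "\<lbrakk>b \<in> carrier B; m \<in> carrier M; n \<in> carrier N\<rbrakk> \<Longrightarrow> \<eta> (tens R FM N (bt b m) n) = E b m n"
  unfolding \<eta>_def using bal_E_lin1 bal_E_lin2 by (simp add: bal_E_bt)

lemma \<eta>_sw: "\<lbrakk>module R X; module R Y; t \<in> carrier (tensor R X Y);
    \<And>u v. \<lbrakk>u \<in> carrier X; v \<in> carrier Y\<rbrakk> \<Longrightarrow> f u v \<in> carrier (tensor R FM N)\<rbrakk> \<Longrightarrow>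
    \<eta> (sw R X Y (tensor R FM N) t f) = sw R X Y I.FM t (\<lambda>u v. \<eta> (f u v))"
  by (rule lin_sw[OF _ _ _ _ _ \<eta>_lin]) simp_all

lemma \<theta>_sw: "\<lbrakk>module R X; module R Y; t \<in> carrier (tensor R X Y);
    \<And>u v. \<lbrakk>u \<in> carrier X; v \<in> carrier Y\<rbrakk> \<Longrightarrow> f u v \<in> carrier I.FM\<rbrakk> \<Longrightarrow>
    \<theta> (sw R X Y I.FM t f) = sw R X Y (tensor R FM N) t (\<lambda>u v. \<theta> (f u v))"
  by (rule lin_sw[OF _ _ _ _ _ \<theta>_lin]) simp_all

lemma \<eta>_\<theta>: "\<forall>x\<in>carrier I.FM. \<eta> (\<theta> x) = x"
proof (rule I_ext[where P = I.FM])
  fix b m n assume *: "b \<in> carrier B" "m \<in> carrier M" "n \<in> carrier N"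
  show "\<eta> (\<theta> (I.bt b (tens R M N m n))) = I.bt b (tens R M N m n)"
    using * collapse_T_id[where f = "\<lambda>u z. I.bt (aut B (aut B u)) (tens R M N m (iaut N (iaut N z)))"
      and d = b and m = n and P = I.FM] by (simp add: \<eta>_sw E_def)
qed simp_all

lemma \<theta>_\<eta>: "\<forall>t\<in>carrier (tensor R FM N). \<theta> (\<eta> t) = t"
proof (rule L.MN_ext[where P = "tensor R FM N"])
  fix x n assume x: "x \<in> carrier FM" and n: "n \<in> carrier N"
  \<comment> \<open>A second reduction: the elements x of \<open>FM\<close> are themselves sums of
    pure elements, so with n fixed they are tested on those.\<close>
  have "\<forall>x\<in>carrier FM. \<theta> (\<eta> (tens R FM N x n)) = tens R FM N x n"
  proof (rule FM_ext[where P = "tensor R FM N"])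
    fix b m assume *: "b \<in> carrier B" "m \<in> carrier M"
    show "\<theta> (\<eta> (tens R FM N (bt b m) n)) = tens R FM N (bt b m) n"
      using * n collapse_id_T[where f = "\<lambda>u z. tens R FM N (bt (aut B (aut B u)) m) z"
        and d = b and m = "iaut N (iaut N n)" and P = "tensor R FM N"] by (simp add: \<theta>_sw E_def)
  qed (use n in simp_all)
  then show "\<theta> (\<eta> (tens R FM N x n)) = tens R FM N x n" using x by blast
qed simp_all

theorem right_projection_iso: "Doi_iso R B rB C hC I.FM L.MN \<theta>"
proof (rule Doi_isoI[where g = \<eta>, OF I.FM_Doi_module L.MN_Doi_module \<theta>_Doi_map])
  show "\<eta> t \<in> carrier I.FM" if "t \<in> carrier L.MN" for t
    using lin_maps_closed[OF \<eta>_lin] that by simp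
qed (use \<theta>_\<eta> \<eta>_\<theta> in simp_all)

end


subsection \<open>Twisted antipodes\<close>

locale Doi_left = Doi_res_setting R H S A rA B rB C hC \<psi> M N
  for R :: "('k,'r) ring_scheme" and H :: "('k,'h,'x) hom_structure_scheme" and S :: "'h \<Rightarrow> 'h"
    and A :: "('k,'a,'y) hom_structure_scheme" and rA :: "'a \<Rightarrow> ('k,'a,'h) tens"
    and B :: "('k,'b,'w) hom_structure_scheme" and rB :: "'b \<Rightarrow> ('k,'b,'h) tens"
    and C :: "('k,'c,'z) hom_structure_scheme" and hC :: "'h \<Rightarrow> 'c \<Rightarrow> 'c"
    and \<psi> :: "'a \<Rightarrow> 'b" and M :: "('k,'a,'c,'m) Doi_obj" and N :: "('k,'b,'c,'n) Doi_obj"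
begin

sublocale L: Doi_pair R H S B rB C hC N FM
  by (intro Doi_pair.intro N.Doi_mod_axioms FM.Doi_mod_axioms)

sublocale P: Doi_pair R H S A rA C hC GN M
  by (intro Doi_pair.intro GN.Doi_mod_axioms Doi_mod_axioms)

sublocale I: Doi_ind_setting R H S A rA B rB C hC \<psi> P.MN
  by (intro Doi_ind_setting.intro Doi_mod.intro Doi_data_axioms P.MN_Doi_module
      B.Doi_data_axioms monoidal_datum_map_axioms)

lemmas P_rules [simp] = P.MN_aut_lin[unfolded to_N] P.MN_iaut_lin[unfolded to_N] P.MN_lin[unfolded to_N]
  P.MN_closed[unfolded to_N] P.MN_act_lin2[unfolded to_N] P.MN_act_lin1[unfolded to_N] P.MN_act_closed[unfolded to_N]
  P.MN_act_lin[unfolded to_N] P.MN_coact_lin[unfolded to_N] P.MN_coact_lin'[unfolded to_N]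
  P.MN_coact_closed[unfolded to_N]

lemmas P_ext = P.MN_ext[unfolded to_N]
lemmas P_eval = P.MN_aut[unfolded to_N] P.MN_iaut[unfolded to_N] P.MN_act[unfolded to_N, unfolded GN_sel]
  P.MN_coact[unfolded to_N]

lemma I_ext:
  assumes "module R P" "f \<in> lin_maps R I.FM P" "g \<in> lin_maps R I.FM P"
    "\<And>b m n. \<lbrakk>b \<in> carrier B; m \<in> carrier M; n \<in> carrier N\<rbrakk> \<Longrightarrow>
      f (I.bt b (tens R N M n m)) = g (I.bt b (tens R N M n m))"
  shows "\<forall>x\<in>carrier I.FM. f x = g x"
proof (rule I.FM_ext[OF assms(1-3)])
  fix b t assume b: "b \<in> carrier B" and t: "t \<in> carrier P.MN"
  have "I.bt b \<in> lin_maps R (tensor R N M) I.FM"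
    using I.FM_bt_lin(3)[OF b] by simp
  from P_ext[OF assms(1) lin_maps_comp[OF assms(2) this] lin_maps_comp[OF assms(3) this]]
  show "f (I.bt b t) = g (I.bt b t)" using assms(4) b t by simp
qed

definition \<Theta> :: "'b \<Rightarrow> ('k,'n,'m) tens \<Rightarrow> ('k,'n,('k,'b,'m) btens) tens" where
  "\<Theta> b t = sw R B B (tensor R N FM) (comul B b) (\<lambda>b1 b2. sw R N M (tensor R N FM) t (\<lambda>n m.
     tens R N FM (act N b1 n) (bt b2 m)))"

definition "\<theta> x = bal_sweedler R (tensor R N FM) x \<Theta>"

lemma \<Theta>_bal: "\<Theta> \<in> I.bal_maps (tensor R N FM)"
proof (rule I.bal_mapsI)
  show "\<Theta> \<in> bilin_maps R B P.MN (tensor R N FM)"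
    unfolding \<Theta>_def by (rule bilin_mapsI) simp_all
  fix b a t assume *: "b \<in> carrier B" "a \<in> carrier A" and t: "t \<in> carrier P.MN"
  have "\<forall>t\<in>carrier (tensor R N M). \<Theta> (b \<otimes>\<^bsub>B\<^esub> \<psi> a) t = \<Theta> (aut B b) (act P.MN a (iaut P.MN t))"
    unfolding \<Theta>_def
    by (rule P_ext[where P = "tensor R N FM"]) (use * in \<open>simp_all add: P_eval N.M.act_act\<close>)
  then show "\<Theta> (b \<otimes>\<^bsub>B\<^esub> \<psi> a) t = \<Theta> (aut B b) (act P.MN a (iaut P.MN t))" using t by simp
qed

lemma \<theta>_lin [simp]: "\<theta> \<in> lin_maps R I.FM (tensor R N FM)"
  unfolding \<theta>_def[abs_def] by (rule I.FM_sweedler_lin[OF _ \<Theta>_bal]) simp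

lemma \<theta>_lin' [simp]: "f \<in> lin_maps R X I.FM \<Longrightarrow> (\<lambda>x. \<theta> (f x)) \<in> lin_maps R X (tensor R N FM)"
  by (rule lin_maps_comp[OF \<theta>_lin])

lemma \<theta>_closed [simp]: "x \<in> carrier I.FM \<Longrightarrow> \<theta> x \<in> carrier (tensor R N FM)"
  by (rule lin_maps_closed[OF \<theta>_lin])

lemma \<theta>_bt [simp]: "\<lbrakk>b \<in> carrier B; t \<in> carrier (tensor R N M)\<rbrakk> \<Longrightarrow> \<theta> (I.bt b t) =
    sw R B B (tensor R N FM) (comul B b) (\<lambda>b1 b2. sw R N M (tensor R N FM) t (\<lambda>n m.
     tens R N FM (act N b1 n) (bt b2 m)))"
  unfolding \<theta>_def by (subst I.bal_sweedler_bt[OF _ \<Theta>_bal]) (simp_all add: \<Theta>_def)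

lemma \<theta>_Doi_map: "\<theta> \<in> Doi_maps R B C I.FM L.MN"
proof -
  let ?L = "tensor R N FM"
  let ?T = "tensor R ?L C"
  have aut: "\<forall>x\<in>carrier I.FM. \<theta> (aut I.FM x) = aut L.MN (\<theta> x)"
    by (rule I_ext[where P = ?L]) (simp_all add: P_eval L.MN_aut)
  have act: "\<forall>x\<in>carrier I.FM. \<theta> (act I.FM b x) = act L.MN b (\<theta> x)" if "b \<in> carrier B" for b
    by (rule I_ext[where P = ?L]) (use that in \<open>simp_all add: P_eval L.MN_act N.M.act_act\<close>)
  note compat = B.compat_comul_sw[where f = "\<lambda>u v w. tens R ?L C (tens R N FM (act N u n) (bt v m)) w" for m n]
  have coact: "\<forall>x\<in>carrier I.FM. coact L.MN (\<theta> x) = sw R I.FM C ?T (coact I.FM x) (\<lambda>m0 m1. tens R ?L C (\<theta> m0) m1)"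
    by (rule I_ext[where P = ?T])
      (simp_all add: P_eval L.MN_coact compat sw_swap[where M = B and M' = M] sw_swap[where M = B and M' = N])
  show ?thesis
    using aut act coact by (simp add: Doi_maps_def I.FM_coact_sweedler)
qed

end

text \<open>Mirror image of \<open>collapse_right\<close>: the surviving factor is now the last one,
  so coassociativity is applied in the other direction and the left counit law finishes.\<close>

lemma (in hom_module) collapse_left:
  fixes D :: "('k,'d,'w) hom_structure_scheme" and P :: "('k,'p,'z) module_scheme"
  assumes D: "hom_coalgebra R D" and P: "module R P"
    and p: "p \<in> lin_maps R D A" "\<And>d. d \<in> carrier D \<Longrightarrow> p (aut D d) = aut A (p d)"
    and q: "q \<in> lin_maps R D A" "\<And>d. d \<in> carrier D \<Longrightarrow> q (aut D d) = aut A (q d)"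
    and pq: "\<And>d. d \<in> carrier D \<Longrightarrow>
      sw R D D A (comul D d) (\<lambda>u v. p v \<otimes>\<^bsub>A\<^esub> q u) = counit D d \<odot>\<^bsub>A\<^esub> \<one>\<^bsub>A\<^esub>"
    and f: "\<And>u. u \<in> carrier D \<Longrightarrow> f u \<in> lin_maps R M P" "\<And>m. m \<in> carrier M \<Longrightarrow> (\<lambda>u. f u m) \<in> lin_maps R D P"
    and d: "d \<in> carrier D" and m: "m \<in> carrier M"
  shows "sw R D D P (comul D d) (\<lambda>d1 d2. sw R D D P (comul D d2) (\<lambda>u v.
      f v (ac (aut A (aut A (p u))) (ac (q d1) m)))) = f (iaut D (iaut D d)) (aut M (aut M m))"
proof -
  interpret D: hom_coalgebra R D by (rule D)
  note [simp] = lin_maps_comp[OF p(1)] lin_maps_comp[OF q(1)] lin_maps_comp[OF f(1)] lin_maps_comp[OF f(2)]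
    lin_maps_closed[OF p(1)] lin_maps_closed[OF q(1)] lin_maps_closed[OF f(1)] p q f P d m
  let ?F = "\<lambda>d2 u v. f (iaut D d2) (ac (aut A (aut A (p v))) (ac (q (aut D u)) m))"
  let ?L = "\<lambda>d2 z. f (iaut D d2) (ac (aut A z) (aut M m))"
  have L: "sw R D D P (comul D d1) (\<lambda>u v. ?F d2 u v) = counit D d1 \<odot>\<^bsub>P\<^esub> f (iaut D d2) (aut M (aut M m))"
    if d12: "d1 \<in> carrier D" "d2 \<in> carrier D" for d1 d2
  proof -
    have "sw R D D P (comul D d1) (\<lambda>u v. ?F d2 u v) = sw R D D P (comul D d1) (\<lambda>u v. ?L d2 (p v \<otimes>\<^bsub>A\<^esub> q u))"
      using d12 by (simp add: act_act)
    also have "\<dots> = ?L d2 (sw R D D A (comul D d1) (\<lambda>u v. p v \<otimes>\<^bsub>A\<^esub> q u))"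
      by (rule lin_sw[where g = "?L d2", symmetric]) (use d12 in simp_all)
    also have "\<dots> = counit D d1 \<odot>\<^bsub>P\<^esub> f (iaut D d2) (aut M (aut M m))"
      using d12 by (simp add: pq lin_maps_smult[OF f(1)])
    finally show ?thesis .
  qed
  have "sw R D D P (comul D d) (\<lambda>d1 d2. sw R D D P (comul D d2) (\<lambda>u v.
      f v (ac (aut A (aut A (p u))) (ac (q d1) m))))
      = sw R D D P (comul D d) (\<lambda>d1 d2. sw R D D P (comul D d1) (\<lambda>u v. ?F d2 u v))"
    by (subst D.coassoc_sw[where f = "\<lambda>d1 u v. f v (ac (aut A (aut A (p u))) (ac (q d1) m))"])
      (simp_all del: q(2))
  also have "\<dots> = sw R D D P (comul D d) (\<lambda>d1 d2. counit D d1 \<odot>\<^bsub>P\<^esub> f (iaut D d2) (aut M (aut M m)))"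
    by (rule sw_cong[OF refl L])
  also have "\<dots> = f (iaut D (iaut D d)) (aut M (aut M m))"
    by (rule D.counit_left_sw[where f = "\<lambda>d2. f (iaut D d2) (aut M (aut M m))"]) simp_all
  finally show ?thesis .
qed


section \<open>The inverse morphism built from a twisted antipode\<close>

locale Doi_left_Hopf = Doi_left R H S A rA B rB C hC \<psi> M N + T: twisted_antipode R B T
  for R :: "('k,'r) ring_scheme" and H :: "('k,'h,'x) hom_structure_scheme" and S :: "'h \<Rightarrow> 'h"
    and A :: "('k,'a,'y) hom_structure_scheme" and rA :: "'a \<Rightarrow> ('k,'a,'h) tens"
    and B :: "('k,'b,'w) hom_structure_scheme" and rB :: "'b \<Rightarrow> ('k,'b,'h) tens"
    and C :: "('k,'c,'z) hom_structure_scheme" and hC :: "'h \<Rightarrow> 'c \<Rightarrow> 'c"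
    and \<psi> :: "'a \<Rightarrow> 'b" and M :: "('k,'a,'c,'m) Doi_obj" and N :: "('k,'b,'c,'n) Doi_obj" and T :: "'b \<Rightarrow> 'b"
begin

lemma T_lin [simp]: "T \<in> lin_maps R B B" "f \<in> lin_maps R X B \<Longrightarrow> (\<lambda>x. T (f x)) \<in> lin_maps R X B"
  by (rule T.lin lin_maps_comp[OF T.lin]; assumption?)+

lemma T_closed [simp]: "b \<in> carrier B \<Longrightarrow> T b \<in> carrier B"
  by (rule lin_maps_closed[OF T.lin])

lemma T_aut [simp]: "b \<in> carrier B \<Longrightarrow> T (aut B b) = aut B (T b)"
  by (rule T.aut)

lemma T_\<psi>_aut [simp]: "a \<in> carrier A \<Longrightarrow> T (\<psi> (aut A a)) = aut B (T (\<psi> a))"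
  using T_aut[of "\<psi> a"] by (simp del: T_aut)

lemma T_right [simp]: "b \<in> carrier B \<Longrightarrow>
    sw R B B B (comul B b) (\<lambda>b1 b2. b2 \<otimes>\<^bsub>B\<^esub> T b1) = counit B b \<odot>\<^bsub>B\<^esub> \<one>\<^bsub>B\<^esub>"
  using T.right[of b] by (simp add: B.A.comul_sweedler)

lemma T_left [simp]: "b \<in> carrier B \<Longrightarrow>
    sw R B B B (comul B b) (\<lambda>b1 b2. T b2 \<otimes>\<^bsub>B\<^esub> b1) = counit B b \<odot>\<^bsub>B\<^esub> \<one>\<^bsub>B\<^esub>"
  using T.left[of b] by (simp add: B.A.comul_sweedler)

lemma T_right_\<psi> [simp]: "a \<in> carrier A \<Longrightarrow>
    sw R A A B (comul A a) (\<lambda>a1 a2. \<psi> a2 \<otimes>\<^bsub>B\<^esub> T (\<psi> a1)) = counit A a \<odot>\<^bsub>B\<^esub> \<one>\<^bsub>B\<^esub>"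
  using T_right[of "\<psi> a"] by (simp add: \<psi>.counit del: T_right)

lemmas collapse_id_T = N.M.collapse_left[OF B.A.hom_coalgebra, where p = "\<lambda>b. b" and q = T, simplified]
lemmas collapse_T_id = N.M.collapse_left[OF B.A.hom_coalgebra, where p = T and q = "\<lambda>b. b", simplified]
lemmas collapse_\<psi>_T = N.M.collapse_left[OF A.hom_coalgebra, where p = \<psi> and q = "\<lambda>a. T (\<psi> a)", simplified]

definition "\<theta>0 t = sw R N B (tensor R N B) t (\<lambda>n b. sw R B B (tensor R N B) (comul B b) (\<lambda>b1 b2.
   tens R N B (act N b1 n) b2))"

definition "\<eta>0 t = sw R N B (tensor R N B) t (\<lambda>n b. sw R B B (tensor R N B) (comul B b) (\<lambda>b1 b2.
   tens R N B (act N (T b1) (iaut N (iaut N n))) (aut B (aut B b2))))"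

text \<open>Here T(b_21) stands before b_1, so T sits on the later coproduct factor. That is the
  order of the law T(x_2) x_1 = eps(x) 1, which a twisted antipode satisfies.\<close>

lemma \<eta>0_\<theta>0: "\<forall>t\<in>carrier (tensor R N B). \<eta>0 (\<theta>0 t) = t"
proof (rule tensor_ext_ball[where P = "tensor R N B"])
  fix n b assume *: "n \<in> carrier N" "b \<in> carrier B"
  show "\<eta>0 (\<theta>0 (tens R N B n b)) = tens R N B n b"
    using * collapse_T_id[where f = "\<lambda>u z. tens R N B (iaut N (iaut N z)) (aut B (aut B u))" and d = b and m = n and P = "tensor R N B"]
    by (simp add: \<eta>0_def \<theta>0_def)
qed (simp_all add: \<eta>0_def \<theta>0_def)

text \<open>Again a substitute for antimultiplicativity: \<open>\<theta>0\<close> sends the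
  right-hand side to the pure tensor of n with the product, and \<open>\<eta>0\<close> is a left
  inverse of \<open>\<theta>0\<close>.\<close>

lemma \<eta>0_mult:
  assumes x: "x \<in> carrier B" and y: "y \<in> carrier B" and n: "n \<in> carrier N"
  shows "\<eta>0 (tens R N B n (x \<otimes>\<^bsub>B\<^esub> y)) = sw R B B (tensor R N B) (comul B x) (\<lambda>x1 x2.
    sw R B B (tensor R N B) (comul B y) (\<lambda>y1 y2.
      tens R N B (act N (aut B (T y1)) (act N (T x1) (iaut N (iaut N (iaut N n)))))
        (aut B (aut B x2) \<otimes>\<^bsub>B\<^esub> aut B (aut B y2))))" (is "_ = ?E")
proof -
  note cy = collapse_id_T[where f = "\<lambda>u z. tens R N B (act N (aut B (aut B (aut B x1))) z) (aut B (aut B x2) \<otimes>\<^bsub>B\<^esub> aut B (aut B u))"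
      and P = "tensor R N B" and d = y for x1 x2]
  have cx: "sw R B B (tensor R N B) (comul B x) (\<lambda>d1 d2. sw R B B (tensor R N B) (comul B d2) (\<lambda>u v.
      tens R N B (act N (aut B (aut B (aut B u))) (act N (aut B (T d1)) (iaut N (iaut N n)))) (aut B (aut B v) \<otimes>\<^bsub>B\<^esub> y)))
      = tens R N B n (x \<otimes>\<^bsub>B\<^esub> y)"
    using x y n collapse_id_T[where f = "\<lambda>u z. tens R N B (aut N z) (aut B (aut B u) \<otimes>\<^bsub>B\<^esub> y)"
      and P = "tensor R N B" and d = x and m = "iaut N (iaut N (iaut N n))"] by simp
  have "\<theta>0 ?E = tens R N B n (x \<otimes>\<^bsub>B\<^esub> y)"
    using x y n cx by (simp add: \<theta>0_def N.M.act_mult sw_swap[where t = "comul B y"] cy)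
  moreover have "\<eta>0 (\<theta>0 ?E) = ?E" using \<eta>0_\<theta>0 x y n by simp
  ultimately show ?thesis by simp
qed

definition E :: "'b \<Rightarrow> 'm \<Rightarrow> 'n \<Rightarrow> ('k,'b,('k,'n,'m) tens) btens" where
  "E b m n = sw R B B I.FM (comul B b) (\<lambda>b1 b2.
     I.bt (aut B (aut B b2)) (tens R N M (act N (T b1) (iaut N (iaut N n))) m))"

lemma E_\<eta>0: "\<lbrakk>b \<in> carrier B; m \<in> carrier M; n \<in> carrier N\<rbrakk> \<Longrightarrow>
    E b m n = sw R N B I.FM (\<eta>0 (tens R N B n b)) (\<lambda>n b. I.bt b (tens R N M n m))"
  by (simp add: E_def \<eta>0_def)

lemma I_bt_sw: "\<lbrakk>module R X; module R Y; t \<in> carrier (tensor R X Y); b \<in> carrier B;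
    \<And>u v. \<lbrakk>u \<in> carrier X; v \<in> carrier Y\<rbrakk> \<Longrightarrow> f u v \<in> carrier (tensor R N M)\<rbrakk> \<Longrightarrow>
    I.bt b (sw R X Y (tensor R N M) t f) = sw R X Y I.FM t (\<lambda>u v. I.bt b (f u v))"
  using I.FM_bt_lin(3)[of b] by (intro lin_sw) simp_all

text \<open>The factor crossing the balanced tensor product is now psi(a_2): psi(a_21) cancels
  against T(psi(a_1)) on the side of N, and a_22 acts on m.\<close>

lemma E_bal: "n \<in> carrier N \<Longrightarrow> (\<lambda>b m. E b m n) \<in> bal_maps I.FM"
proof (rule bal_mapsI)
  assume n: "n \<in> carrier N"
  then show "(\<lambda>b m. E b m n) \<in> bilin_maps R B M I.FM" by (simp add: E_def)
  fix b a m assume *: "b \<in> carrier B" "a \<in> carrier A" "m \<in> carrier M"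
  note c = collapse_\<psi>_T[where f = "\<lambda>u z. I.bt b1 (tens R N M z (act M (aut A (aut A u)) (iaut M m)))"
      and P = I.FM and d = a for b1]
  show "E (b \<otimes>\<^bsub>B\<^esub> \<psi> a) m n = E (aut B b) (act M a (iaut M m)) n"
    using * n by (simp add: E_\<eta>0[of "b \<otimes>\<^bsub>B\<^esub> \<psi> a"] \<eta>0_mult) (simp add: E_def P_eval I_bt_sw c)
qed

definition "\<eta> t = sw R N FM I.FM t (\<lambda>n x. bal_sweedler R I.FM x (\<lambda>b m. E b m n))"

lemma bal_E_lin1: "n \<in> carrier N \<Longrightarrow> (\<lambda>x. bal_sweedler R I.FM x (\<lambda>b m. E b m n)) \<in> lin_maps R FM I.FM"
  by (rule FM_sweedler_lin[OF _ E_bal]) simp_all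

lemma bal_E_bt: "\<lbrakk>b \<in> carrier B; m \<in> carrier M; n \<in> carrier N\<rbrakk> \<Longrightarrow>
    bal_sweedler R I.FM (bt b m) (\<lambda>b m. E b m n) = E b m n"
  by (rule bal_sweedler_bt[OF _ E_bal]) simp_all

lemma bal_E_lin2:
  assumes "x \<in> carrier FM"
  shows "(\<lambda>n. bal_sweedler R I.FM x (\<lambda>b m. E b m n)) \<in> lin_maps R N I.FM"
proof (rule FM_param_lin[where h = "\<lambda>n x. bal_sweedler R I.FM x (\<lambda>b m. E b m n)", OF _ _ assms bal_E_lin1])
  fix b m assume "b \<in> carrier B" "m \<in> carrier M"
  then show "(\<lambda>n. bal_sweedler R I.FM (bt b m) (\<lambda>b m. E b m n)) \<in> lin_maps R N I.FM"
    by (subst lin_maps_cong[OF bal_E_bt]) (simp_all add: E_def[abs_def])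
qed simp_all

lemma \<eta>_lin [simp]: "\<eta> \<in> lin_maps R (tensor R N FM) I.FM"
  unfolding \<eta>_def[abs_def] using bal_E_lin1 bal_E_lin2 by simp

lemma \<eta>_lin' [simp]: "f \<in> lin_maps R X (tensor R N FM) \<Longrightarrow> (\<lambda>x. \<eta> (f x)) \<in> lin_maps R X I.FM"
  by (rule lin_maps_comp[OF \<eta>_lin])

lemma \<eta>_tens [simp]: "\<lbrakk>b \<in> carrier B; m \<in> carrier M; n \<in> carrier N\<rbrakk> \<Longrightarrow> \<eta> (tens R N FM n (bt b m)) = E b m n"
  unfolding \<eta>_def using bal_E_lin1 bal_E_lin2 by (simp add: bal_E_bt)

lemma \<eta>_sw: "\<lbrakk>module R X; module R Y; t \<in> carrier (tensor R X Y);
    \<And>u v. \<lbrakk>u \<in> carrier X; v \<in> carrier Y\<rbrakk> \<Longrightarrow> f u v \<in> carrier (tensor R N FM)\<rbrakk> \<Longrightarrow>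
    \<eta> (sw R X Y (tensor R N FM) t f) = sw R X Y I.FM t (\<lambda>u v. \<eta> (f u v))"
  by (rule lin_sw[OF _ _ _ _ _ \<eta>_lin]) simp_all

lemma \<theta>_sw: "\<lbrakk>module R X; module R Y; t \<in> carrier (tensor R X Y);
    \<And>u v. \<lbrakk>u \<in> carrier X; v \<in> carrier Y\<rbrakk> \<Longrightarrow> f u v \<in> carrier I.FM\<rbrakk> \<Longrightarrow>
    \<theta> (sw R X Y I.FM t f) = sw R X Y (tensor R N FM) t (\<lambda>u v. \<theta> (f u v))"
  by (rule lin_sw[OF _ _ _ _ _ \<theta>_lin]) simp_all

lemma \<eta>_\<theta>: "\<forall>x\<in>carrier I.FM. \<eta> (\<theta> x) = x"
proof (rule I_ext[where P = I.FM])
  fix b m n assume *: "b \<in> carrier B" "m \<in> carrier M" "n \<in> carrier N"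
  show "\<eta> (\<theta> (I.bt b (tens R N M n m))) = I.bt b (tens R N M n m)"
    using * collapse_T_id[where f = "\<lambda>u z. I.bt (aut B (aut B u)) (tens R N M (iaut N (iaut N z)) m)"
      and d = b and m = n and P = I.FM] by (simp add: \<eta>_sw E_def)
qed simp_all

lemma \<theta>_\<eta>: "\<forall>t\<in>carrier (tensor R N FM). \<theta> (\<eta> t) = t"
proof (rule L.MN_ext[where P = "tensor R N FM"])
  fix n x assume n: "n \<in> carrier N" and x: "x \<in> carrier FM"
  have "\<forall>x\<in>carrier FM. \<theta> (\<eta> (tens R N FM n x)) = tens R N FM n x"
  proof (rule FM_ext[where P = "tensor R N FM"])
    fix b m assume *: "b \<in> carrier B" "m \<in> carrier M"
    show "\<theta> (\<eta> (tens R N FM n (bt b m))) = tens R N FM n (bt b m)"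
      using * n collapse_id_T[where f = "\<lambda>u z. tens R N FM z (bt (aut B (aut B u)) m)"
        and d = b and m = "iaut N (iaut N n)" and P = "tensor R N FM"] by (simp add: \<theta>_sw E_def)
  qed (use n in simp_all)
  then show "\<theta> (\<eta> (tens R N FM n x)) = tens R N FM n x" using x by blast
qed simp_all

theorem left_projection_iso: "Doi_iso R B rB C hC I.FM L.MN \<theta>"
proof (rule Doi_isoI[where g = \<eta>, OF I.FM_Doi_module L.MN_Doi_module \<theta>_Doi_map])
  show "\<eta> t \<in> carrier I.FM" if "t \<in> carrier L.MN" for t
    using lin_maps_closed[OF \<eta>_lin] that by simp
qed (use \<theta>_\<eta> \<eta>_\<theta> in simp_all)

end

text \<open>The maps \<open>\<theta>\<close> start at the induced module, whereas the projection
  formulas name the tensor product first.\<close>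

lemma Doi_iso_sym: "Doi_iso R A rA C hC M N f \<Longrightarrow> Doi_isomorphic R A rA C hC N M"
  unfolding Doi_isomorphic_def Doi_iso_def by blast

theorem theorem4p6:
  fixes R :: "'k ring"
    and H :: "('k,'h) hom_structure" and S :: "'h \<Rightarrow> 'h"
    and A :: "('k,'a) hom_structure" and rA :: "'a \<Rightarrow> ('k,'a,'h) tens"
    and A' :: "('k,'b) hom_structure" and rA' :: "'b \<Rightarrow> ('k,'b,'h) tens"
    and C :: "('k,'c) hom_structure" and hC :: "'h \<Rightarrow> 'c \<Rightarrow> 'c"
    and \<psi> :: "'a \<Rightarrow> 'b"
  assumes "cring R"
    and "monoidal_Doi_datum R H S A rA C hC"
    and "monoidal_Doi_datum R H S A' rA' C hC"
    and "monoidal_datum_map R H A rA A' rA' \<psi>"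
  shows "(\<exists>\<phi>. Doi_iso R A' rA' C hC
            (Doi_ind R A A' rA' C hC \<psi> (Doi_regular R H A rA C hC))
            (Doi_regular R H A' rA' C hC) \<phi>
          \<and> (\<forall>a'\<in>carrier A'. \<forall>a\<in>carrier A.
               \<phi> (bal_tens R A A' \<psi> (Doi_regular R H A rA C hC) a' a) = a' \<otimes>\<^bsub>A'\<^esub> \<psi> a))
    \<and> (\<forall>(M :: ('k,'a,'c,'m) Doi_obj) (N :: ('k,'b,'c,'n) Doi_obj).
         Doi_module R A rA C hC M \<longrightarrow> flat_module R M \<longrightarrow> Doi_module R A' rA' C hC N \<longrightarrow>
           ((\<exists>S'. hom_Hopf_algebra R A' S') \<longrightarrow>
              Doi_isomorphic R A' rA' C hC
                (Doi_tensor R A' C (Doi_ind R A A' rA' C hC \<psi> M) N)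
                (Doi_ind R A A' rA' C hC \<psi> (Doi_tensor R A C M (Doi_res \<psi> N))))
         \<and> ((\<exists>S'. twisted_antipode R A' S') \<longrightarrow>
              Doi_isomorphic R A' rA' C hC
                (Doi_tensor R A' C N (Doi_ind R A A' rA' C hC \<psi> M))
                (Doi_ind R A A' rA' C hC \<psi> (Doi_tensor R A C (Doi_res \<psi> N) M))))"
proof -
  note A = assms(2) and A' = assms(3) and map = assms(4)
  interpret Doi_map R H S A rA A' rA' C hC \<psi>
    by (intro Doi_map.intro Doi_data.intro A A' map)
  have ind: "Doi_res_setting R H S A rA A' rA' C hC \<psi> M N"
    if "Doi_module R A rA C hC M" "Doi_module R A' rA' C hC N"
    for M :: "('k,'a,'c,'m) Doi_obj" and N :: "('k,'b,'c,'n) Doi_obj"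
    using that by (intro Doi_res_setting.intro Doi_ind_setting.intro Doi_mod.intro Doi_data.intro A A' map)
  have right: "Doi_isomorphic R A' rA' C hC
      (Doi_tensor R A' C (Doi_ind R A A' rA' C hC \<psi> M) N)
      (Doi_ind R A A' rA' C hC \<psi> (Doi_tensor R A C M (Doi_res \<psi> N)))"
    if "Doi_module R A rA C hC M" "Doi_module R A' rA' C hC N" "hom_Hopf_algebra R A' S'"
    for M :: "('k,'a,'c,'m) Doi_obj" and N :: "('k,'b,'c,'n) Doi_obj" and S'
    by (rule Doi_iso_sym[OF Doi_right_Hopf.right_projection_iso[of R H S A rA A' rA' C hC \<psi> M N S']])
      (intro Doi_right_Hopf.intro Doi_right.intro ind that hom_Hopf_algebra.antipode[OF that(3)])
  have left: "Doi_isomorphic R A' rA' C hC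
      (Doi_tensor R A' C N (Doi_ind R A A' rA' C hC \<psi> M))
      (Doi_ind R A A' rA' C hC \<psi> (Doi_tensor R A C (Doi_res \<psi> N) M))"
    if "Doi_module R A rA C hC M" "Doi_module R A' rA' C hC N" "twisted_antipode R A' S'"
    for M :: "('k,'a,'c,'m) Doi_obj" and N :: "('k,'b,'c,'n) Doi_obj" and S'
    by (rule Doi_iso_sym[OF Doi_left_Hopf.left_projection_iso[of R H S A rA A' rA' C hC \<psi> M N S']])
      (intro Doi_left_Hopf.intro Doi_left.intro ind that)
  show ?thesis using regular_iso right left by blast
qed

end
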